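(* Let $b$ be locally integrable on $\mathbb{Q}_p^n$, $0<\alpha<n$, $1<r<n/\alpha$, $0<\lambda<n-\alpha r$. (T.1) If $1/q=1/r-\alpha/(n-\lambda)$, then $b\in\mathrm{BMO}(\mathbb{Q}_p^n)$ if and only if $\mathcal{M}^p_{\alpha,b}$ is bounded from $L^{r,\lambda}(\mathbb{Q}_p^n)$ to $L^{q,\lambda}(\mathbb{Q}_p^n)$. (T.2) If $1/q=1/r-\alpha/n$ and $\lambda/r=\mu/q$, then $b\in\mathrm{BMO}(\mathbb{Q}_p^n)$ if and only if $\mathcal{M}^p_{\alpha,b}$ is bounded from $L^{r,\lambda}(\mathbb{Q}_p^n)$ to $L^{q,\mu}(\mathbb{Q}_p^n)$.
   Context: Fix a prime $p$; $\mathbb{Q}_p^n$ with $|x|_p=\max_j|x_j|_p$; balls $B_\gamma(x)=\{y:|y-x|_p\le p^\gamma\}$; Haar measure with $|B_\gamma(x)|_h=p^{n\gamma}$; $f_B=|B|_h^{-1}\int_Bf$. $\mathcal{M}^p_{\alpha,b}(f)(x)=\sup_{\gamma\in\mathbb{Z}}|B_\gamma(x)|_h^{\alpha/n-1}\int_{B_\gamma(x)}|b(x)-b(y)||f(y)|dy$. $\mathrm{BMO}$: $\sup_{\gamma,x}|B_\gamma(x)|_h^{-1}\int_{B_\gamma(x)}|b-b_{B_\gamma(x)}|<\infty$. Morrey space $L^{q,\lambda}(\mathbb{Q}_p^n)$ ($1\le q<\infty$, $\lambda\ge0$): $f\in L^q_{\mathrm{loc}}$ with $\|f\|_{L^{q,\lambda}}=\sup_{\gamma,x}\big(|B_\gamma(x)|_h^{-\lambda/n}\int_{B_\gamma(x)}|f|^q\big)^{1/q}<\infty$.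 *)

theory Defs
  imports "HOL-Analysis.Analysis"
begin

text \<open>An element x of Q_p is represented by the family of its residues
  x mod p^k Z_p (k an integer), each given by its canonical representative in
  Z[1/p] intersected with [0, p^k).  Equivalently, Q_p is the inverse limit of the
  groups Z[1/p] / p^k Z; an element has a level N with x in p^N Z_p, i.e. all residues
  at levels k \<le> N vanish.\<close>

definition rmod :: "rat \<Rightarrow> rat \<Rightarrow> rat" where
  "rmod q m = q - m * of_int \<lfloor>q / m\<rfloor>"

definition ppow :: "nat \<Rightarrow> int \<Rightarrow> rat" where
  "ppow p k = (of_nat p) powi k"

definition Qp :: "nat \<Rightarrow> (int \<Rightarrow> rat) set" where
  "Qp p = {a. (\<forall>k. 0 \<le> a k \<and> a k < ppow p k)
              \<and> (\<forall>k. a k = rmod (a (k + 1)) (ppow p k))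
              \<and> (\<exists>N. \<forall>k\<le>N. a k = 0)}"

definition padic_sub :: "nat \<Rightarrow> (int \<Rightarrow> rat) \<Rightarrow> (int \<Rightarrow> rat) \<Rightarrow> (int \<Rightarrow> rat)" where
  "padic_sub p a b = (\<lambda>k. rmod (a k - b k) (ppow p k))"

text \<open>p-adic absolute value: |x|_p = p^(-v(x)), where v(x) is the largest k
  with x in p^k Z_p; |0|_p = 0.\<close>
definition padic_abs :: "nat \<Rightarrow> (int \<Rightarrow> rat) \<Rightarrow> real" where
  "padic_abs p a = (if (\<forall>k. a k = 0) then 0
      else real p powr (- real_of_int (GREATEST k. a k = 0)))"

definition Qpn :: "nat \<Rightarrow> ((int \<Rightarrow> rat) ^ 'n) set" where
  "Qpn p = {x. \<forall>j. x $ j \<in> Qp p}"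

definition vsub :: "nat \<Rightarrow> (int \<Rightarrow> rat) ^ 'n \<Rightarrow> (int \<Rightarrow> rat) ^ 'n \<Rightarrow> (int \<Rightarrow> rat) ^ 'n" where
  "vsub p y x = (\<chi> j. padic_sub p (y $ j) (x $ j))"

definition vnorm :: "nat \<Rightarrow> (int \<Rightarrow> rat) ^ 'n \<Rightarrow> real" where
  "vnorm p x = Max (range (\<lambda>j. padic_abs p (x $ j)))"

definition pball :: "nat \<Rightarrow> int \<Rightarrow> (int \<Rightarrow> rat) ^ 'n \<Rightarrow> ((int \<Rightarrow> rat) ^ 'n) set" where
  "pball p \<gamma> x = {y \<in> Qpn p. vnorm p (vsub p y x) \<le> real p powi \<gamma>}"

text \<open>Haar measure on Q_p^n: the measure on the sigma-algebra generated by the balls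
  (= the Borel sigma-algebra) with |B_gamma(x)|_h = p^(n gamma).\<close>
definition haar :: "nat \<Rightarrow> ((int \<Rightarrow> rat) ^ 'n) measure" where
  "haar p = extend_measure (Qpn p) (UNIV \<times> Qpn p) (\<lambda>(\<gamma>, x). pball p \<gamma> x)
              (\<lambda>(\<gamma>, x). ennreal (real p powi (int CARD('n) * \<gamma>)))"

definition epowr :: "ennreal \<Rightarrow> real \<Rightarrow> ennreal" where
  "epowr x s = (if x = \<infinity> then \<infinity> else ennreal (enn2real x powr s))"

definition maxcomm :: "nat \<Rightarrow> real \<Rightarrow> ((int \<Rightarrow> rat) ^ 'n \<Rightarrow> real)
    \<Rightarrow> ((int \<Rightarrow> rat) ^ 'n \<Rightarrow> real) \<Rightarrow> (int \<Rightarrow> rat) ^ 'n \<Rightarrow> ennreal" where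
  "maxcomm p \<alpha> b f x = (SUP \<gamma>\<in>(UNIV::int set).
      ennreal (measure (haar p) (pball p \<gamma> x) powr (\<alpha> / real CARD('n) - 1))
      * (\<integral>\<^sup>+ y \<in> pball p \<gamma> x. ennreal (\<bar>b x - b y\<bar> * \<bar>f y\<bar>) \<partial>haar p))"

definition morrey_norm :: "nat \<Rightarrow> real \<Rightarrow> real \<Rightarrow> ((int \<Rightarrow> rat) ^ 'n \<Rightarrow> ennreal) \<Rightarrow> ennreal" where
  "morrey_norm p q lam g = epowr (SUP (\<gamma>, x)\<in>(UNIV::int set) \<times> Qpn p.
      ennreal (measure (haar p) (pball p \<gamma> x) powr (- lam / real CARD('n)))
      * (\<integral>\<^sup>+ y \<in> pball p \<gamma> x. epowr (g y) q \<partial>haar p)) (1 / q)"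

text \<open>The Morrey space L^{q,lambda}(Q_p^n) (finiteness of the norm forces
  f in L^q on every ball, i.e. f in L^q_loc).\<close>
definition morrey :: "nat \<Rightarrow> real \<Rightarrow> real \<Rightarrow> ((int \<Rightarrow> rat) ^ 'n \<Rightarrow> real) set" where
  "morrey p q lam = {f. f \<in> borel_measurable (haar p)
      \<and> morrey_norm p q lam (\<lambda>y. ennreal \<bar>f y\<bar>) < \<infinity>}"

definition maxcomm_bounded :: "nat \<Rightarrow> real \<Rightarrow> ((int \<Rightarrow> rat) ^ 'n \<Rightarrow> real)
    \<Rightarrow> real \<Rightarrow> real \<Rightarrow> real \<Rightarrow> real \<Rightarrow> bool" where
  "maxcomm_bounded p \<alpha> b r lam q \<mu> =
     (\<exists>C::real. C \<ge> 0 \<and> (\<forall>f \<in> (morrey p r lam :: ((int \<Rightarrow> rat) ^ 'n \<Rightarrow> real) set).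
        maxcomm p \<alpha> b f \<in> borel_measurable (haar p)
        \<and> morrey_norm p q \<mu> (maxcomm p \<alpha> b f)
            \<le> ennreal C * morrey_norm p r lam (\<lambda>y. ennreal \<bar>f y\<bar>)))"

definition locally_integrable :: "nat \<Rightarrow> ((int \<Rightarrow> rat) ^ 'n \<Rightarrow> real) \<Rightarrow> bool" where
  "locally_integrable p b = (b \<in> borel_measurable (haar p)
      \<and> (\<forall>\<gamma>. \<forall>x \<in> Qpn p. set_integrable (haar p) (pball p \<gamma> x) b))"

definition ball_avg :: "nat \<Rightarrow> ((int \<Rightarrow> rat) ^ 'n \<Rightarrow> real) \<Rightarrow> ((int \<Rightarrow> rat) ^ 'n) set \<Rightarrow> real" where
  "ball_avg p b B = (1 / measure (haar p) B) * (LINT y:B|haar p. b y)"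

definition BMO :: "nat \<Rightarrow> ((int \<Rightarrow> rat) ^ 'n \<Rightarrow> real) \<Rightarrow> bool" where
  "BMO p b = (\<exists>C::real. \<forall>\<gamma>. \<forall>x \<in> Qpn p.
      (1 / measure (haar p) (pball p \<gamma> x))
        * (LINT y:pball p \<gamma> x|haar p. \<bar>b y - ball_avg p b (pball p \<gamma> x)\<bar>) \<le> C)"

end

theory Submission
  imports Defs
begin

text \<open>Balls of a fixed radius partition the space and partitions of smaller radius are finer, so only
  this martingale structure is used. The Haar measure is the image of Lebesgue measure on the positive
  orthant under digit reversal.

  Suppose \<open>b\<close> is in BMO, and let \<open>b\<^sub>\<gamma>(x)\<close> be its mean over the ball of level \<open>\<gamma>\<close>
  about \<open>x\<close>. By Young's inequality the \<open>\<gamma>\<close>-th term of the maximal commutator is at most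
  \<open>C (\<bar>b(x) - b\<^sub>\<gamma>(x)\<bar>\<^sup>t + 1) G\<^sub>\<gamma>(x)\<close>, where \<open>G\<^sub>\<gamma>\<close> is \<open>p\<close> to the power \<open>\<gamma>\<alpha>\<close> times the local
  \<open>L\<^sup>s\<close> mean of \<open>f\<close>, with \<open>s < r\<close>. The supremum over \<open>\<gamma>\<close> is replaced by a sum of \<open>q\<close>-th powers. For balls inside the test
  ball, \<open>G\<^sub>\<gamma>\<close> is constant on each ball of level \<open>\<gamma>\<close> and the oscillation factor has bounded mean by the
  John--Nirenberg inequality; what remains is the sum of the \<open>G\<^sub>\<gamma>\<close>, which the Morrey condition and the
  maximal inequality control as in the classical argument of Hedberg and Adams. For larger balls the Morrey
  condition gives geometric decay. The second scale of exponents follows from the first by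
  an embedding of Morrey spaces, and the converse by testing on indicators of balls.\<close>

subsection \<open>Residues and balls\<close>

text \<open>What rules out a pointwise bound by a maximal function alone is that the oscillation
  factor depends on the point and on the scale at once and is not bounded. Summing over scales
  separates the two: below the test ball the factor is averaged out ball by ball; above it, it grows
  only polynomially in the number of levels, because means over consecutive balls differ by a
  bounded amount, and this loses against the geometric decay. The local mean is an
  \<open>L^s\<close> mean with \<open>s < r\<close> because Young's inequality costs some
  integrability and the maximal inequality needs \<open>r / s > 1\<close>. With
  \<open>\<kappa> = (1 - l) / r\<close> the Morrey condition says that local means scale like
  \<open>N powr (- (g * \<kappa>))\<close>, and the first relation between the exponents says
  \<open>(\<kappa> - a) * q = \<kappa> * r\<close>; all powers balance through this identity. The
  second scale has a smaller \<open>q\<close> but the same scaling of local means, so comparing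
  power means suffices. A model of the Haar measure is needed because \<open>extend_measure\<close>
  takes the prescribed values only if some measure does; digit reversal sends intervals to residue
  classes and so provides one.\<close>

lemma rmod_eq_0_iff:
  assumes "0 < m" "0 \<le> u" "u < m" "0 \<le> v" "v < m"
  shows "rmod (u - v) m = 0 \<longleftrightarrow> u = v"
proof
  assume "rmod (u - v) m = 0"
  then have eq: "u - v = m * of_int \<lfloor>(u - v) / m\<rfloor>" by (simp add: rmod_def)
  have "\<lfloor>(u - v) / m\<rfloor> = 0"
  proof -
    have "\<bar>m * of_int \<lfloor>(u - v) / m\<rfloor>\<bar> < m * 1" using assms eq by linarith
    then have "\<bar>of_int \<lfloor>(u - v) / m\<rfloor> :: rat\<bar> < 1"
      using assms(1) by (simp only: abs_mult) (simp del: of_int_abs)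
    then have "\<bar>\<lfloor>(u - v) / m\<rfloor>\<bar> < 1" by linarith
    then show ?thesis by linarith
  qed
  with eq show "u = v" by simp
qed (simp add: rmod_def)

lemma ppow_pos: "p > 0 \<Longrightarrow> 0 < ppow p k"
  by (simp add: ppow_def)

lemma ppow_add1:
  assumes "p > 0"
  shows "ppow p (k + 1) = of_nat p * ppow p k" "ppow p (1 + k) = of_nat p * ppow p k"
  using assms by (simp_all add: ppow_def power_int_add)

lemma Qp_rec: "x \<in> Qp p \<Longrightarrow> x k = rmod (x (k + 1)) (ppow p k)"
  unfolding Qp_def by blast

lemma Qp_bounds: "x \<in> Qp p \<Longrightarrow> 0 \<le> x k" "x \<in> Qp p \<Longrightarrow> x k < ppow p k"
  unfolding Qp_def by blast+

lemma Qp_level: "x \<in> Qp p \<Longrightarrow> \<exists>N. \<forall>k\<le>N. x k = 0"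
  unfolding Qp_def by blast

text \<open>Downward induction: the recursion computes each residue from the next one, so agreement
  at one level propagates to all lower ones. This is what makes balls nested.\<close>

lemma Qp_eq_mono:
  assumes "x \<in> Qp p" "y \<in> Qp p" "x k = y k" "i \<le> k"
  shows "x i = y i"
  using assms(4,3)
proof (induction i rule: int_le_induct)
  case base then show ?case by simp
next
  case (step i)
  show ?case
    using Qp_rec[OF assms(1), of "i - 1"] Qp_rec[OF assms(2), of "i - 1"] step by simp
qed

text \<open>The zero set of the residues of \<open>y - x\<close> is downward closed and, unless the
  difference vanishes, bounded above, so the \<open>GREATEST\<close> in the absolute value is
  attained. This trades the norm for an equality of single residues, the description of balls used
  from here on.\<close>

lemma padic_abs_sub_le_iff:
  assumes p: "1 < p" and x: "x \<in> Qp p" and y: "y \<in> Qp p"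
  shows "padic_abs p (padic_sub p y x) \<le> real p powi g \<longleftrightarrow> y (- g) = x (- g)"
proof -
  define z where "z = padic_sub p y x"
  have z0: "z k = 0 \<longleftrightarrow> y k = x k" for k
    unfolding z_def padic_sub_def using x y p
    by (intro rmod_eq_0_iff) (auto simp: Qp_bounds ppow_pos)
  have dn: "z i = 0" if "z k = 0" "i \<le> k" for i k
    using that Qp_eq_mono[OF y x] z0 by blast
  show ?thesis
  proof (cases "\<forall>k. z k = 0")
    case True
    then show ?thesis using z0 by (simp add: padic_abs_def z_def[symmetric])
  next
    case False
    then obtain k1 where k1: "z k1 \<noteq> 0" by blast
    obtain N1 N2 where N: "\<forall>k\<le>N1. x k = 0" "\<forall>k\<le>N2. y k = 0"
      using Qp_level x y by blast
    have zN: "z (min N1 N2) = 0" using N z0 by simp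
    \<comment> \<open>Cutting the zero set off below, at a level where both residues vanish, makes
      it finite, so that \<open>Max\<close> applies.\<close>
    define S where "S = {k. min N1 N2 \<le> k \<and> z k = 0}"
    have Ssub: "S \<subseteq> {min N1 N2..k1}" 
      unfolding S_def using dn k1 by (auto, meson linorder_not_less order_less_imp_le)
    have fin: "finite S" using finite_subset[OF Ssub] by simp
    have ne: "S \<noteq> {}" using zN by (auto simp: S_def)
    define G where "G = Max S"
    have GS: "z G = 0" using Max_in[OF fin ne] by (simp add: G_def S_def)
    have Gm: "k \<le> G" if "z k = 0" for k
    proof (cases "min N1 N2 \<le> k")
      case True then show ?thesis unfolding G_def using that fin by (intro Max_ge) (auto simp: S_def)
    next
      case False
      have "min N1 N2 \<le> G" unfolding G_def using zN fin by (intro Max_ge) (auto simp: S_def)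
      with False show ?thesis by simp
    qed
    have Geq: "(GREATEST k. z k = 0) = G" by (rule Greatest_equality) (use GS Gm in auto)
    have "padic_abs p z = real p powr (- real_of_int G)"
      unfolding padic_abs_def by (simp only: if_not_P[OF False] Geq)
    then have "padic_abs p z \<le> real p powi g \<longleftrightarrow> real p powr (- real_of_int G) \<le> real p powr real_of_int g"
      using p by (simp add: powr_real_of_int')
    also have "\<dots> \<longleftrightarrow> - g \<le> G" using p by simp linarith
    also have "\<dots> \<longleftrightarrow> z (- g) = 0" using Gm dn GS by blast
    finally show ?thesis using z0 by (simp add: z_def)
  qed
qed

lemma pball_eq:
  fixes x :: "(int \<Rightarrow> rat) ^ 'n"
  assumes "1 < p" "x \<in> Qpn p"
  shows "pball p g x = {y \<in> Qpn p. \<forall>j. (y $ j) (- g) = (x $ j) (- g)}"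
proof -
  have "vnorm p (vsub p y x) \<le> real p powi g \<longleftrightarrow> (\<forall>j. (y $ j) (- g) = (x $ j) (- g))"
    if "y \<in> Qpn p" for y
  proof -
    have "vnorm p (vsub p y x) \<le> real p powi g
        \<longleftrightarrow> (\<forall>j. padic_abs p (padic_sub p (y $ j) (x $ j)) \<le> real p powi g)"
      unfolding vnorm_def by (subst Max_le_iff) (auto simp: vsub_def)
    then show ?thesis
      using assms that by (simp add: padic_abs_sub_le_iff Qpn_def)
  qed
  then show ?thesis by (auto simp: pball_def)
qed

subsection \<open>The Haar measure\<close>

text \<open>The van der Corput digit reversal; \<open>p ^ k * vdc p m\<close> enumerates the residues modulo
  \<open>p ^ k\<close> in such a way that the nested residue classes become nested intervals of \<open>m\<close>.\<close>

fun vdc :: "nat \<Rightarrow> nat \<Rightarrow> rat" where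
  "vdc p m = (if m = 0 \<or> p \<le> 1 then 0 else (of_nat (m mod p) + vdc p (m div p)) / of_nat p)"

declare vdc.simps [simp del]

lemma vdc_0 [simp]: "vdc p 0 = 0"
  by (simp add: vdc.simps)

lemma vdc_rec: "1 < p \<Longrightarrow> vdc p m = (of_nat (m mod p) + vdc p (m div p)) / of_nat p"
  by (cases "m = 0") (simp, subst vdc.simps, simp)

lemma vdc_bounds:
  assumes "1 < p" shows "0 \<le> vdc p m \<and> vdc p m < 1"
proof (induction m rule: less_induct)
  case (less m)
  show ?case
  proof (cases "m = 0")
    case False
    then have IH: "0 \<le> vdc p (m div p)" "vdc p (m div p) < 1" using less assms by auto
    have "m mod p + 1 \<le> p" using assms by (simp add: Suc_leI)
    then have "(of_nat (m mod p) :: rat) + 1 \<le> of_nat p"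
      by (metis of_nat_1 of_nat_add of_nat_le_iff)
    with IH assms show ?thesis by (subst (1 2) vdc_rec) auto
  qed auto
qed

text \<open>\<open>p * vdc p m\<close> has integer part \<open>m mod p\<close>, hence the lowest
  digit can be read off and the remaining digits are compared by induction. Zero is separate because
  there division by \<open>p\<close> does not decrease \<open>m\<close>.\<close>

lemma vdc_inj:
  assumes "1 < p" shows "vdc p m = vdc p m' \<Longrightarrow> m = m'"
proof (induction m arbitrary: m' rule: less_induct)
  case (less m)
  have eq: "of_nat (m mod p) + vdc p (m div p) = of_nat (m' mod p) + vdc p (m' div p)"
    using less.prems assms vdc_rec[of p m] vdc_rec[of p m'] by (simp add: field_simps)
  have "\<lfloor>of_nat (m mod p) + vdc p (m div p)\<rfloor> = int (m mod p)"
    "\<lfloor>of_nat (m' mod p) + vdc p (m' div p)\<rfloor> = int (m' mod p)"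
    using vdc_bounds[OF assms] by (auto simp: floor_eq_iff)
  with eq have mm: "m mod p = m' mod p" by simp
  with eq have vv: "vdc p (m div p) = vdc p (m' div p)" by simp
  show ?case
  proof (cases "m = 0")
    case False
    then have "m div p = m' div p" using less.IH[OF _ vv] assms by simp
    with mm show ?thesis by (metis div_mult_mod_eq)
  next
    case True
    show ?thesis
    proof (rule ccontr)
      assume "m \<noteq> m'"
      then have "m' \<noteq> 0" using True by simp
      have nz: "vdc p k \<noteq> 0" if "k \<noteq> 0" for k
        using that
      proof (induction k rule: less_induct)
        case (less k)
        then show ?case
          using vdc_rec[OF assms, of k] vdc_bounds[OF assms, of "k div p"] assms
          by (cases "k mod p = 0") (auto simp: add_nonneg_eq_0_iff dvd_div_eq_0_iff mod_eq_0_iff_dvd)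
      qed
      show False using nz[OF \<open>m' \<noteq> 0\<close>] less.prems True by simp
    qed
  qed
qed

text \<open>Going up one level appends one base-\<open>p\<close> digit at the top of the residue;
  under digit reversal it becomes the lowest digit of the index, so \<open>m\<close> turns into
  \<open>p * m + d'\<close>.\<close>

lemma Qp_residue_vdc:
  assumes "1 < p" "x \<in> Qp p"
  shows "\<exists>m. x k = ppow p k * vdc p m"
proof -
  obtain N where N: "\<forall>k\<le>N. x k = 0" using assms Qp_level by blast
  show ?thesis
  proof (cases "k \<le> N")
    case True
    then show ?thesis using N by (intro exI[of _ 0]) simp
  next
    case False
    then have "N \<le> k" by simp
    then show ?thesis
    proof (induction k rule: int_ge_induct)
      case base then show ?case using N by (intro exI[of _ 0]) simp
    next
      case (step k)
      then obtain m where m: "x k = ppow p k * vdc p m" by blast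
      have x: "x k = rmod (x (k + 1)) (ppow p k)" "0 \<le> x (k + 1)" "x (k + 1) < ppow p (k + 1)"
        using assms Qp_rec Qp_bounds by blast+
      define d where "d = \<lfloor>x (k + 1) / ppow p k\<rfloor>"
      have P: "0 < ppow p k" using assms by (simp add: ppow_pos)
      have "0 \<le> d" using x P by (simp add: d_def)
      moreover have "d < int p"
        unfolding d_def using x(3) P assms by (simp add: floor_less_iff ppow_add1 field_simps)
      ultimately obtain d' where d': "d = int d'" "d' < p"
        by (metis nonneg_int_cases of_nat_less_iff)
      have "x (k + 1) = ppow p k * vdc p m + ppow p k * of_nat d'"
        using x(1) m d' by (simp add: rmod_def d_def[symmetric])
      also have "\<dots> = ppow p (k + 1) * vdc p (p * m + d')"
        using assms d' by (subst vdc_rec) (auto simp: ppow_add1 field_simps)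
      finally show ?case by blast
    qed
  qed
qed

text \<open>A section of the Monna map: the base-\<open>p\<close> digits of the real
  \<open>t\<close>, mirrored at the point, become p-adic digits. Only the integer part of
  \<open>t * real p powi k\<close> enters at level \<open>k\<close>, which is why residue classes
  pull back to intervals.\<close>

definition monna :: "nat \<Rightarrow> real \<Rightarrow> int \<Rightarrow> rat" where
  "monna p t k = ppow p k * vdc p (nat \<lfloor>t * real p powi k\<rfloor>)"

text \<open>Dropping the lowest digit of the integer part at level \<open>k + 1\<close> gives the
  integer part at level \<open>k\<close>, and by \<open>vdc_rec\<close> that digit contributes a
  multiple of \<open>ppow p k\<close>; so the residues are coherent. For very negative
  \<open>k\<close> the integer part is 0.\<close>

lemma monna_in_Qp:
  assumes "1 < p" "0 \<le> t"
  shows "monna p t \<in> Qp p"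
proof -
  have P: "0 < ppow p k" for k using assms by (simp add: ppow_pos)
  have bounds: "0 \<le> monna p t k \<and> monna p t k < ppow p k" for k
    using P[of k] vdc_bounds[OF assms(1)] by (simp add: monna_def)
  have rec: "monna p t k = rmod (monna p t (k + 1)) (ppow p k)" for k
  proof -
    define m' where "m' = nat \<lfloor>t * real p powi (k + 1)\<rfloor>"
    have div: "m' div p = nat \<lfloor>t * real p powi k\<rfloor>"
    proof -
      have "\<lfloor>t * real p powi (k + 1) / real p\<rfloor> = \<lfloor>t * real p powi (k + 1)\<rfloor> div int p"
        by (metis floor_divide_real_eq_div of_int_of_nat_eq of_nat_0_le_iff)
      moreover have "t * real p powi (k + 1) / real p = t * real p powi k"
        using assms by (simp add: power_int_add)
      ultimately show ?thesis unfolding m'_def using assms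
        by (simp add: nat_div_distrib)
    qed
    have "monna p t (k + 1) = ppow p k * of_nat (m' mod p) + monna p t k"
      unfolding monna_def m'_def[symmetric] div[symmetric]
      using assms by (subst vdc_rec) (auto simp: ppow_add1 field_simps)
    moreover have "\<lfloor>(ppow p k * of_nat (m' mod p) + monna p t k) / ppow p k\<rfloor> = int (m' mod p)"
      using P[of k] bounds[of k] by (simp add: floor_eq_iff add_divide_distrib)
    ultimately show ?thesis by (simp add: rmod_def)
  qed
  have "\<exists>N. \<forall>k\<le>N. monna p t k = 0"
  proof -
    obtain i :: nat where i: "t < real p ^ i"
      using assms real_arch_pow[of "real p" t] by auto
    have "monna p t k = 0" if "k \<le> - int i" for k
    proof -
      have "t * real p powi k \<le> t * real p powi (- int i)"
        using assms that by (intro mult_left_mono power_int_increasing) auto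
      also have "\<dots> < 1" using i assms by (simp add: power_int_minus field_simps)
      finally have "t * real p powi k < 1" .
      moreover have "0 \<le> t * real p powi k" using assms by simp
      ultimately have "\<lfloor>t * real p powi k\<rfloor> = 0" by (simp add: floor_eq_iff)
      then show ?thesis by (simp add: monna_def)
    qed
    then show ?thesis by blast
  qed
  with bounds rec show ?thesis unfolding Qp_def by blast
qed

lemma monna_class:
  assumes "1 < p" "x \<in> Qp p"
  shows "\<exists>u\<ge>0. {t. 0 \<le> t \<and> monna p t k = x k} = {u..<u + real p powi (- k)}"
proof -
  obtain m where m: "x k = ppow p k * vdc p m" using Qp_residue_vdc[OF assms] by blast
  define c where "c = real p powi k"
  have c: "c > 0" using assms by (simp add: c_def)
  have "monna p t k = x k \<longleftrightarrow> real m \<le> t * c \<and> t * c < real m + 1" if "0 \<le> t" for t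
  proof -
    have "monna p t k = x k \<longleftrightarrow> vdc p (nat \<lfloor>t * c\<rfloor>) = vdc p m"
      using assms by (simp add: monna_def m c_def ppow_def)
    also have "\<dots> \<longleftrightarrow> nat \<lfloor>t * c\<rfloor> = m" using vdc_inj[OF assms(1)] by blast
    also have "\<dots> \<longleftrightarrow> \<lfloor>t * c\<rfloor> = int m"
      using that c by auto
    also have "\<dots> \<longleftrightarrow> real m \<le> t * c \<and> t * c < real m + 1"
      by (simp add: floor_eq_iff)
    finally show ?thesis .
  qed
  moreover have "0 \<le> t" if "real m \<le> t * c" for t
    using that c by (metis mult_less_0_iff not_le of_nat_0_le_iff order_trans)
  ultimately have "{t. 0 \<le> t \<and> monna p t k = x k} = {real m / c..<real m / c + 1 / c}"
    using c by (auto simp: field_simps)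
  moreover have "1 / c = real p powi (- k)" by (simp add: c_def power_int_minus field_simps)
  ultimately show ?thesis using c by (intro exI[of _ "real m / c"]) simp
qed

definition monna_vec :: "nat \<Rightarrow> ('n \<Rightarrow> real) \<Rightarrow> (int \<Rightarrow> rat) ^ 'n" where
  "monna_vec p t = (\<chi> j. monna p (t j))"

definition orthant :: "('n::finite \<Rightarrow> real) measure" where
  "orthant = restrict_space (\<Pi>\<^sub>M j\<in>UNIV. lborel) {t. \<forall>j. 0 \<le> t j}"

text \<open>A ball restricts each coordinate to one residue class, so its preimage is a cube of side
  \<open>real p powi g\<close>.\<close>

lemma monna_vec_ball:
  fixes x :: "(int \<Rightarrow> rat) ^ 'n"
  assumes "1 < p" "x \<in> Qpn p"
  shows "monna_vec p -` pball p g x \<inter> space orthant \<in> sets orthant"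
    and "emeasure orthant (monna_vec p -` pball p g x \<inter> space orthant)
          = ennreal (real p powi (int CARD('n) * g))"
proof -
  have "\<forall>j. \<exists>u\<ge>0. {t. 0 \<le> t \<and> monna p t (- g) = (x $ j) (- g)} = {u..<u + real p powi g}"
    using monna_class[OF assms(1), of "x $ _" "- g"] assms(2) by (simp add: Qpn_def)
  then obtain u where u: "\<And>j. u j \<ge> 0"
      "\<And>j. {t. 0 \<le> t \<and> monna p t (- g) = (x $ j) (- g)} = {u j..<u j + real p powi g}"
    by metis
  have iff: "(0 \<le> s \<and> monna p s (- g) = (x $ j) (- g)) \<longleftrightarrow> (u j \<le> s \<and> s < u j + real p powi g)" for s j
    using u(2)[of j] by (simp add: set_eq_iff)
  let ?B = "PiE UNIV (\<lambda>j. {u j..<u j + real p powi g})"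
  have "t \<in> monna_vec p -` pball p g x \<inter> {t. \<forall>j. 0 \<le> t j} \<longleftrightarrow> t \<in> ?B" for t
    unfolding pball_eq[OF assms]
    using iff monna_in_Qp[OF assms(1)]
    by (auto simp: monna_vec_def Qpn_def PiE_iff) blast+
  then have eq: "monna_vec p -` pball p g x \<inter> {t. \<forall>j. 0 \<le> t j} = ?B" by blast
  have sub: "?B \<subseteq> {t. \<forall>j. 0 \<le> t j}" using eq by blast
  have space: "space orthant = {t :: 'n \<Rightarrow> real. \<forall>j. 0 \<le> t j}"
    by (simp add: orthant_def space_restrict_space space_PiM)
  have O: "{t :: 'n \<Rightarrow> real. \<forall>j. 0 \<le> t j} \<in> sets (\<Pi>\<^sub>M j\<in>UNIV. lborel)"
  proof -
    have "{t :: 'n \<Rightarrow> real. \<forall>j. 0 \<le> t j} = PiE UNIV (\<lambda>_. {0..})" by (auto simp: PiE_iff)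
    also have "\<dots> \<in> sets (\<Pi>\<^sub>M j\<in>UNIV. lborel)" by (intro sets_PiM_I_finite) auto
    finally show ?thesis .
  qed
  have B: "?B \<in> sets (\<Pi>\<^sub>M j\<in>UNIV. lborel)" by (intro sets_PiM_I_finite) auto
  show "monna_vec p -` pball p g x \<inter> space orthant \<in> sets orthant"
    unfolding space eq unfolding orthant_def
    using O B sub by (subst sets_restrict_space_iff) (auto simp: space_PiM)
  interpret product_sigma_finite "\<lambda>_::'n. lborel :: real measure" ..
  have "emeasure orthant ?B = emeasure (\<Pi>\<^sub>M j\<in>UNIV. lborel) ?B"
    unfolding orthant_def using O sub by (intro emeasure_restrict_space) (auto simp: space_PiM)
  also have "\<dots> = (\<Prod>j\<in>(UNIV::'n set). ennreal (real p powi g))"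
    by (subst emeasure_PiM) (auto simp: assms)
  also have "\<dots> = ennreal (real p powi (int CARD('n) * g))"
    by (simp add: prod_constant ennreal_power power_int_power' mult.commute)
  finally show "emeasure orthant (monna_vec p -` pball p g x \<inter> space orthant)
          = ennreal (real p powi (int CARD('n) * g))"
    unfolding space eq .
qed

lemma sets_haar:
  "sets (haar p :: ((int \<Rightarrow> rat) ^ 'n) measure) = sigma_sets (Qpn p) ((\<lambda>(g, x). pball p g x) ` (UNIV \<times> Qpn p))"
  unfolding haar_def by (rule sets_extend_measure) (auto simp: pball_def)

lemma space_haar: "space (haar p :: ((int \<Rightarrow> rat) ^ 'n) measure) = Qpn p"
  unfolding haar_def by (rule space_extend_measure) (auto simp: pball_def)

lemma emeasure_haar_pball:
  fixes x :: "(int \<Rightarrow> rat) ^ 'n"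
  assumes p: "1 < p" and x: "x \<in> Qpn p"
  shows "emeasure (haar p) (pball p g x) = ennreal (real p powi (int CARD('n) * g))"
proof -
  let ?G = "\<lambda>(g, x). pball p g x :: ((int \<Rightarrow> rat) ^ 'n) set"
  let ?I = "UNIV \<times> Qpn p"
  define S :: "((int \<Rightarrow> rat) ^ 'n) measure" where "S = sigma (Qpn p) (?G ` ?I)"
  have sub: "?G ` ?I \<subseteq> Pow (Qpn p)" by (auto simp: pball_def)
  have T: "monna_vec p \<in> measurable orthant S"
    unfolding S_def
  proof (rule measurable_measure_of[OF sub])
    show "monna_vec p \<in> space orthant \<rightarrow> Qpn p"
      using monna_in_Qp[OF p]
      by (auto simp: orthant_def space_restrict_space space_PiM Qpn_def monna_vec_def)
  qed (use monna_vec_ball(1)[OF p] in auto)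
  \<comment> \<open>The image of Lebesgue measure is the witness asked for by
    \<open>emeasure_extend_measure\<close>: a measure on the sigma-algebra of the balls with the
    prescribed values.\<close>
  define D where "D = distr orthant S (monna_vec p)"
  have sets_D: "sets D = sets (haar p :: ((int \<Rightarrow> rat) ^ 'n) measure)"
    using sub by (simp add: D_def S_def sets_haar)
  have ball_S: "pball p g y \<in> sets S" if "y \<in> Qpn p" for g y
    using sub that unfolding S_def by (auto intro!: sigma_sets.Basic)
  have "emeasure (haar p) (?G (g, x)) = (\<lambda>(g, x). ennreal (real p powi (int CARD('n) * g))) (g, x)"
  proof (rule emeasure_extend_measure[OF haar_def, where \<mu>' = "emeasure D"])
    show "emeasure D (?G i) = (\<lambda>(g, x). ennreal (real p powi (int CARD('n) * g))) i" if "i \<in> ?I" for i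
      using that monna_vec_ball(2)[OF p] ball_S
      by (auto simp: D_def emeasure_distr[OF T])
    show "positive (sets (haar p)) (emeasure D)" "countably_additive (sets (haar p)) (emeasure D)"
      unfolding sets_D[symmetric] by (rule emeasure_positive, rule emeasure_countably_additive)
  qed (use sub x in auto)
  then show ?thesis by simp
qed

subsection \<open>Spaces with nested ball partitions\<close>

text \<open>In the application \<open>N\<close> is \<open>p\<close> to the power of the dimension,
  so all further exponents appear divided by the dimension. \<open>N_ge_2\<close> says more than
  \<open>1 < N\<close>: it lets one level be absorbed with a factor 1/2 in the maximal
  inequality.\<close>

locale ball_space =
  fixes M :: "'a measure" and P :: "int \<Rightarrow> 'a \<Rightarrow> 'a set" and N :: real
  assumes N_ge_2: "2 \<le> N"
    and ball_refl: "x \<in> space M \<Longrightarrow> x \<in> P g x"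
    and ball_subset_space: "x \<in> space M \<Longrightarrow> P g x \<subseteq> space M"
    and ball_eq: "x \<in> space M \<Longrightarrow> y \<in> P g x \<Longrightarrow> P g y = P g x"
    and ball_step: "x \<in> space M \<Longrightarrow> P g x \<subseteq> P (g + 1) x"
    and countable_balls: "countable (P g ` space M)"
    and sets_balls: "sets M = sigma_sets (space M) (\<Union>g. P g ` space M)"
    and emeasure_ball: "x \<in> space M \<Longrightarrow> emeasure M (P g x) = ennreal (N powr g)"
begin

lemma N_pos: "0 < N" and N_gt_1: "1 < N"
  using N_ge_2 by auto

lemma ball_mono:
  assumes x: "x \<in> space M" and "g \<le> h"
  shows "P g x \<subseteq> P h x"
  using \<open>g \<le> h\<close>
proof (induction h rule: int_ge_induct)
  case (step i)
  then show ?case using ball_step[OF x, of i] by blast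
qed simp

lemma ball_in_space: "x \<in> space M \<Longrightarrow> y \<in> P g x \<Longrightarrow> y \<in> space M"
  using ball_subset_space by blast

lemma ball_mem_iff:
  assumes "x \<in> space M" "y \<in> P g x" "g \<le> h" "z \<in> space M"
  shows "y \<in> P h z \<longleftrightarrow> x \<in> P h z"
proof -
  have "y \<in> P h x" using ball_mono[OF assms(1,3)] assms(2) by blast
  then have e: "P h y = P h x" using ball_eq assms(1) by blast
  have "y \<in> space M" using assms ball_in_space by blast
  with e show ?thesis using ball_eq[OF assms(4)] ball_refl assms(1) by metis
qed

lemma ball_sets [measurable, intro]:
  assumes "x \<in> space M" shows "P g x \<in> sets M"
  unfolding sets_balls using assms by (intro sigma_sets.Basic) blast

lemma measure_ball: "x \<in> space M \<Longrightarrow> measure M (P g x) = N powr g"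
  by (simp add: measure_def emeasure_ball)

text \<open>Each preimage is a union of balls of level \<open>g\<close>, of which there are only
  countably many.\<close>

lemma level_const_measurable:
  assumes "\<And>x y. x \<in> space M \<Longrightarrow> y \<in> P g x \<Longrightarrow> h y = h x"
    and "\<And>x. x \<in> space M \<Longrightarrow> h x \<in> space K"
  shows "h \<in> measurable M K"
proof (rule measurableI)
  fix S assume "S \<in> sets K"
  have "h -` S \<inter> space M = \<Union> (P g ` {x \<in> space M. h x \<in> S})"
  proof (intro equalityI subsetI)
    fix y assume "y \<in> h -` S \<inter> space M"
    then show "y \<in> \<Union> (P g ` {x \<in> space M. h x \<in> S})" using ball_refl[of y g] by blast
  next
    fix y assume "y \<in> \<Union> (P g ` {x \<in> space M. h x \<in> S})"
    then obtain x where x: "x \<in> space M" "h x \<in> S" "y \<in> P g x" by blast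
    then show "y \<in> h -` S \<inter> space M" using assms(1) ball_in_space by simp
  qed
  moreover have "countable (P g ` {x \<in> space M. h x \<in> S})"
    by (rule countable_subset[OF _ countable_balls[of g]]) auto
  ultimately show "h -` S \<inter> space M \<in> sets M"
    by (auto intro!: sets.countable_Union)
qed (use assms in auto)

lemma sigma_finite: "sigma_finite_measure M"
proof
  show "\<exists>A. countable A \<and> A \<subseteq> sets M \<and> \<Union> A = space M \<and> (\<forall>a\<in>A. emeasure M a \<noteq> \<infinity>)"
  proof (intro exI[of _ "P 0 ` space M"] conjI)
    show "\<Union> (P 0 ` space M) = space M" using ball_subset_space ball_refl by blast
  qed (use countable_balls[of 0] in \<open>auto simp: emeasure_ball\<close>)
qed

text \<open>The maximal balls with a property are pairwise disjoint, so that an inequality between two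
  measures only has to be checked on these.\<close>

lemma top_ball_cover:
  fixes Q :: "int \<Rightarrow> 'a \<Rightarrow> bool" and u v :: "'a \<Rightarrow> ennreal"
  assumes Q: "\<And>g x y. x \<in> space M \<Longrightarrow> y \<in> P g x \<Longrightarrow> Q g y \<longleftrightarrow> Q g x"
    and [measurable]: "u \<in> borel_measurable M" "v \<in> borel_measurable M"
    and le: "\<And>g x. x \<in> space M \<Longrightarrow> g \<le> \<beta> \<Longrightarrow> Q g x \<Longrightarrow> (\<And>h. g < h \<Longrightarrow> h \<le> \<beta> \<Longrightarrow> \<not> Q h x)
      \<Longrightarrow> (\<integral>\<^sup>+y\<in>P g x. u y \<partial>M) \<le> (\<integral>\<^sup>+y\<in>P g x. v y \<partial>M)"
  defines "U \<equiv> {x \<in> space M. \<exists>g\<le>\<beta>. Q g x}"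
  shows "U \<in> sets M" and "(\<integral>\<^sup>+y\<in>U. u y \<partial>M) \<le> (\<integral>\<^sup>+y\<in>U. v y \<partial>M)"
proof -
  define top where "top g x \<longleftrightarrow> g \<le> \<beta> \<and> Q g x \<and> (\<forall>h. g < h \<longrightarrow> h \<le> \<beta> \<longrightarrow> \<not> Q h x)" for g x
  have top_ball: "top g y \<longleftrightarrow> top g x" if "x \<in> space M" "y \<in> P g x" for g x y
  proof -
    have "Q h y \<longleftrightarrow> Q h x" if "g \<le> h" for h
      using Q ball_mono[OF \<open>x \<in> space M\<close> that] \<open>y \<in> P g x\<close> \<open>x \<in> space M\<close> by blast
    then show ?thesis unfolding top_def by auto
  qed
  \<comment> \<open>Uniqueness of the top level at a point gives disjointness: two top balls with a
    common point have the same level, hence coincide.\<close>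
  have top_unique: "g = h" if "top g x" "top h x" for g h x
    using that unfolding top_def by (metis linorder_neqE)
  define \<G> where "\<G> = (\<Union>g. P g ` {x \<in> space M. top g x})"
  have "countable (P g ` {x \<in> space M. top g x})" for g
    by (rule countable_subset[OF _ countable_balls[of g]]) auto
  then have cG: "countable \<G>" unfolding \<G>_def by auto
  have sG: "G \<in> sets M" if "G \<in> \<G>" for G using that by (auto simp: \<G>_def)
  have dG: "disjoint_family_on (\<lambda>G. G) \<G>"
    unfolding disjoint_family_on_def
  proof (intro ballI impI)
    fix G H assume GH: "G \<in> \<G>" "H \<in> \<G>" "G \<noteq> H"
    obtain g x h y where G: "G = P g x" "x \<in> space M" "top g x" and H: "H = P h y" "y \<in> space M" "top h y"
      using GH unfolding \<G>_def by auto
    show "G \<inter> H = {}"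
    proof (rule ccontr)
      assume "G \<inter> H \<noteq> {}"
      then obtain z where z: "z \<in> P g x" "z \<in> P h y" using G H by auto
      then have "top g z" "top h z" using top_ball G H by blast+
      then have "g = h" by (rule top_unique)
      then show False using GH(3) G H z ball_eq by metis
    qed
  qed
  have UG: "U = \<Union> \<G>"
  proof
    show "\<Union> \<G> \<subseteq> U"
    proof
      fix y assume "y \<in> \<Union> \<G>"
      then obtain g x where x: "x \<in> space M" "top g x" "y \<in> P g x" by (auto simp: \<G>_def)
      then have "top g y" "y \<in> space M" using top_ball ball_in_space by blast+
      then show "y \<in> U" by (auto simp: U_def top_def)
    qed
    show "U \<subseteq> \<Union> \<G>"
    proof
      fix x assume "x \<in> U"
      then obtain g where x: "x \<in> space M" and g: "g \<le> \<beta>" "Q g x" by (auto simp: U_def)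
      define S where "S = {h. g \<le> h \<and> h \<le> \<beta> \<and> Q h x}"
      have fin: "finite S" by (rule finite_subset[of _ "{g..\<beta>}"]) (auto simp: S_def)
      have ne: "S \<noteq> {}" using g by (auto simp: S_def)
      obtain m where m: "m \<in> S" "\<And>h. h \<in> S \<Longrightarrow> h \<le> m"
        using Max_in[OF fin ne] Max_ge[OF fin] by blast
      have "\<not> Q h x" if "m < h" "h \<le> \<beta>" for h
        using m(1) m(2)[of h] that by (force simp: S_def)
      then have "top m x" using m(1) unfolding top_def S_def by blast
      then have "P m x \<in> \<G>" using x unfolding \<G>_def by blast
      then show "x \<in> \<Union> \<G>" using ball_refl[OF x] by blast
    qed
  qed
  show U: "U \<in> sets M" unfolding UG using cG sG by (intro sets.countable_Union) auto
  \<comment> \<open>Countable additivity of the measure with density \<open>w\<close> reduces the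
    comparison to single top balls.\<close>
  have sum: "(\<integral>\<^sup>+y\<in>U. w y \<partial>M) = (\<integral>\<^sup>+G. (\<integral>\<^sup>+y\<in>G. w y \<partial>M) \<partial>count_space \<G>)"
    if [measurable]: "w \<in> borel_measurable M" for w
  proof -
    have "(\<integral>\<^sup>+y\<in>U. w y \<partial>M) = emeasure (density M w) (\<Union>G\<in>\<G>. G)"
      using U UG by (simp add: emeasure_density)
    also have "\<dots> = (\<integral>\<^sup>+G. emeasure (density M w) G \<partial>count_space \<G>)"
      using cG sG dG by (subst emeasure_UN_countable) auto
    also have "\<dots> = (\<integral>\<^sup>+G. (\<integral>\<^sup>+y\<in>G. w y \<partial>M) \<partial>count_space \<G>)"
      by (intro nn_integral_cong) (auto simp: emeasure_density sG)
    finally show ?thesis .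
  qed
  show "(\<integral>\<^sup>+y\<in>U. u y \<partial>M) \<le> (\<integral>\<^sup>+y\<in>U. v y \<partial>M)"
    unfolding sum[OF assms(2)] sum[OF assms(3)]
  proof (rule nn_integral_mono)
    fix G assume "G \<in> space (count_space \<G>)"
    then obtain g x where "G = P g x" "x \<in> space M" "top g x" by (auto simp: \<G>_def)
    then show "(\<integral>\<^sup>+y\<in>G. u y \<partial>M) \<le> (\<integral>\<^sup>+y\<in>G. v y \<partial>M)"
      using le[of x g] by (simp add: top_def)
  qed
qed

text \<open>The cover is applied with a property that holds only at level \<open>g\<close> inside
  the test ball, so the top balls are exactly the balls of level \<open>g\<close> that partition
  \<open>P \<beta> x\<close>.\<close>

lemma nn_integral_ball_partition_le:
  fixes u v :: "'a \<Rightarrow> ennreal"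
  assumes [measurable]: "u \<in> borel_measurable M" "v \<in> borel_measurable M"
    and x: "x \<in> space M" and g: "g \<le> \<beta>"
    and le: "\<And>y. y \<in> P \<beta> x \<Longrightarrow> (\<integral>\<^sup>+z\<in>P g y. u z \<partial>M) \<le> (\<integral>\<^sup>+z\<in>P g y. v z \<partial>M)"
  shows "(\<integral>\<^sup>+z\<in>P \<beta> x. u z \<partial>M) \<le> (\<integral>\<^sup>+z\<in>P \<beta> x. v z \<partial>M)"
proof -
  have "{y \<in> space M. \<exists>h\<le>\<beta>. h = g \<and> y \<in> P \<beta> x} = P \<beta> x"
    using g ball_in_space[OF x] by auto
  moreover have "(\<integral>\<^sup>+z\<in>{y \<in> space M. \<exists>h\<le>\<beta>. h = g \<and> y \<in> P \<beta> x}. u z \<partial>M)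
      \<le> (\<integral>\<^sup>+z\<in>{y \<in> space M. \<exists>h\<le>\<beta>. h = g \<and> y \<in> P \<beta> x}. v z \<partial>M)"
  proof (rule top_ball_cover(2))
    fix h y z assume "y \<in> space M" "z \<in> P h y"
    then show "(h = g \<and> z \<in> P \<beta> x) = (h = g \<and> y \<in> P \<beta> x)"
      using ball_mem_iff[OF _ _ g x] by blast
  qed (use le in auto)
  ultimately show ?thesis by simp
qed

subsection \<open>Averages and their convergence\<close>

definition avg :: "('a \<Rightarrow> real) \<Rightarrow> int \<Rightarrow> 'a \<Rightarrow> real" where
  "avg b g x = (1 / measure M (P g x)) * (LINT y:P g x|M. b y)"

definition loc_integrable :: "('a \<Rightarrow> real) \<Rightarrow> bool" where
  "loc_integrable b \<longleftrightarrow> b \<in> borel_measurable M \<and> (\<forall>g. \<forall>x \<in> space M. set_integrable M (P g x) b)"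

lemma loc_integrable_measurable: "loc_integrable b \<Longrightarrow> b \<in> borel_measurable M"
  by (simp add: loc_integrable_def)

lemma loc_integrableD: "loc_integrable b \<Longrightarrow> x \<in> space M \<Longrightarrow> set_integrable M (P g x) b"
  by (simp add: loc_integrable_def)

lemma avg_ball: "x \<in> space M \<Longrightarrow> y \<in> P g x \<Longrightarrow> avg b g y = avg b g x"
  using ball_eq by (simp add: avg_def)

lemma avg_measurable [measurable]: "avg b g \<in> borel_measurable M"
  by (rule level_const_measurable[of g]) (auto simp: avg_ball)

lemma set_nn_integral_eq_integral:
  fixes b :: "'a \<Rightarrow> real"
  assumes "set_integrable M A b" "\<And>y. y \<in> A \<Longrightarrow> 0 \<le> b y"
  shows "(\<integral>\<^sup>+y\<in>A. ennreal (b y) \<partial>M) = ennreal (LINT y:A|M. b y)"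
proof -
  have "(\<integral>\<^sup>+y\<in>A. ennreal (b y) \<partial>M) = (\<integral>\<^sup>+y. ennreal (indicator A y * b y) \<partial>M)"
    by (intro nn_integral_cong) (auto simp: indicator_def)
  also have "\<dots> = ennreal (LINT y:A|M. b y)"
    using assms unfolding set_integrable_def set_lebesgue_integral_def
    by (subst nn_integral_eq_integral) (auto simp: indicator_def)
  finally show ?thesis .
qed

lemma set_nn_integral_const: "x \<in> space M \<Longrightarrow> 0 \<le> c \<Longrightarrow> (\<integral>\<^sup>+y\<in>P g x. ennreal c \<partial>M) = ennreal (c * N powr g)"
  by (subst nn_integral_cmult_indicator) (auto simp: emeasure_ball ennreal_mult)

lemma set_integrable_const_ball: "x \<in> space M \<Longrightarrow> set_integrable M (P g x) (\<lambda>_. c :: real)"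
  unfolding set_integrable_def by (auto simp: emeasure_ball)

lemma set_integral_const_ball: "x \<in> space M \<Longrightarrow> (LINT y:P g x|M. (c :: real)) = c * N powr g"
  by (simp add: set_lebesgue_integral_def measure_ball measure_def[symmetric] Int_absorb2 ball_subset_space mult.commute)

text \<open>Stated without division and with an extended integral on the right, so that it chains
  directly with \<open>nn_integral\<close> estimates.\<close>

lemma avg_diff_le:
  assumes b: "loc_integrable b" and x: "x \<in> space M"
  shows "ennreal (\<bar>avg b g x - c\<bar> * N powr g) \<le> (\<integral>\<^sup>+y\<in>P g x. ennreal \<bar>b y - c\<bar> \<partial>M)"
proof -
  note bi = loc_integrableD[OF b x, of g]
  note ci = set_integrable_const_ball[OF x, of g c]
  have di: "set_integrable M (P g x) (\<lambda>y. b y - c)" using bi ci by (rule set_integral_diff)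
  have pos: "0 < N powr g" using N_pos by simp
  have "(avg b g x - c) * N powr g = (LINT y:P g x|M. b y - c)"
    using pos bi ci x
    by (simp add: set_integral_diff set_integral_const_ball avg_def measure_ball field_simps)
  then have "\<bar>avg b g x - c\<bar> * N powr g = \<bar>LINT y:P g x|M. b y - c\<bar>"
    using pos by (metis abs_mult abs_of_pos)
  also have "\<dots> \<le> (LINT y:P g x|M. \<bar>b y - c\<bar>)"
    using set_integral_norm_bound[OF di] by simp
  finally have "ennreal (\<bar>avg b g x - c\<bar> * N powr g) \<le> ennreal (LINT y:P g x|M. \<bar>b y - c\<bar>)"
    by (rule ennreal_leI)
  also have "\<dots> = (\<integral>\<^sup>+y\<in>P g x. ennreal \<bar>b y - c\<bar> \<partial>M)"
    using set_integrable_abs[OF di] by (subst set_nn_integral_eq_integral) auto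
  finally show ?thesis .
qed

section \<open>\<open>L^1\<close> approximation on a ball by functions constant on the balls of one
  level\<close>

definition level_const :: "int \<Rightarrow> ('a \<Rightarrow> 'b) \<Rightarrow> bool" where
  "level_const g h \<longleftrightarrow> (\<forall>z\<in>space M. \<forall>y\<in>P g z. h y = h z)"

lemma level_constD: "level_const g h \<Longrightarrow> z \<in> space M \<Longrightarrow> y \<in> P g z \<Longrightarrow> h y = h z"
  by (simp add: level_const_def)

lemma level_const_mono: "level_const g h \<Longrightarrow> g' \<le> g \<Longrightarrow> level_const g' h"
  unfolding level_const_def using ball_mono by blast

lemma level_const_borel_measurable:
  assumes "level_const g (h :: 'a \<Rightarrow> real)" shows "h \<in> borel_measurable M"
  by (rule level_const_measurable[of g]) (use level_constD[OF assms] in auto)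

text \<open>Density of step functions in \<open>L^1\<close> of one ball; with
  \<open>g \<le> \<beta>\<close> the steps are pieces of the test ball. The closure properties below
  feed the induction rules for measurable sets and integrable functions, as a substitute for
  martingale convergence.\<close>

definition approximable :: "int \<Rightarrow> 'a \<Rightarrow> ('a \<Rightarrow> real) \<Rightarrow> bool" where
  "approximable \<beta> x f \<longleftrightarrow> f \<in> borel_measurable M \<and> (\<forall>\<delta>>0. \<exists>g\<le>\<beta>. \<exists>h.
      level_const g h \<and> (\<integral>\<^sup>+y\<in>P \<beta> x. ennreal \<bar>f y - h y\<bar> \<partial>M) \<le> ennreal \<delta>)"

lemma set_nn_integral_triangle:
  fixes u v w :: "'a \<Rightarrow> real"
  assumes [measurable]: "u \<in> borel_measurable M" "v \<in> borel_measurable M" "A \<in> sets M"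
    and "\<And>y. y \<in> A \<Longrightarrow> \<bar>w y\<bar> \<le> \<bar>u y\<bar> + \<bar>v y\<bar>"
    and "(\<integral>\<^sup>+y\<in>A. ennreal \<bar>u y\<bar> \<partial>M) \<le> ennreal (\<delta> / 2)" "(\<integral>\<^sup>+y\<in>A. ennreal \<bar>v y\<bar> \<partial>M) \<le> ennreal (\<delta> / 2)" "0 < \<delta>"
  shows "(\<integral>\<^sup>+y\<in>A. ennreal \<bar>w y\<bar> \<partial>M) \<le> ennreal \<delta>"
proof -
  have "(\<integral>\<^sup>+y\<in>A. ennreal \<bar>w y\<bar> \<partial>M) \<le> (\<integral>\<^sup>+y. ennreal \<bar>u y\<bar> * indicator A y + ennreal \<bar>v y\<bar> * indicator A y \<partial>M)"
    using assms(4) by (intro nn_integral_mono) (auto simp: indicator_def simp flip: ennreal_plus intro!: ennreal_leI)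
  also have "\<dots> = (\<integral>\<^sup>+y\<in>A. ennreal \<bar>u y\<bar> \<partial>M) + (\<integral>\<^sup>+y\<in>A. ennreal \<bar>v y\<bar> \<partial>M)"
    by (rule nn_integral_add) auto
  also have "\<dots> \<le> ennreal (\<delta> / 2) + ennreal (\<delta> / 2)" using assms by (intro add_mono)
  also have "\<dots> = ennreal \<delta>" using assms by (simp flip: ennreal_plus)
  finally show ?thesis .
qed

lemma approximable_add:
  assumes "x \<in> space M" "approximable \<beta> x f1" "approximable \<beta> x f2"
  shows "approximable \<beta> x (\<lambda>y. f1 y + f2 y)"
  unfolding approximable_def
proof (intro conjI allI impI)
  have [measurable]: "f1 \<in> borel_measurable M" "f2 \<in> borel_measurable M" "P \<beta> x \<in> sets M"
    using assms by (auto simp: approximable_def)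
  show "(\<lambda>y. f1 y + f2 y) \<in> borel_measurable M" by measurable
  fix \<delta> :: real assume "\<delta> > 0"
  then have d2: "\<delta> / 2 > 0" by simp
  obtain g1 h1 where 1: "g1 \<le> \<beta>" "level_const g1 h1"
      "(\<integral>\<^sup>+y\<in>P \<beta> x. ennreal \<bar>f1 y - h1 y\<bar> \<partial>M) \<le> ennreal (\<delta> / 2)"
    using assms(2) d2 unfolding approximable_def by meson
  obtain g2 h2 where 2: "g2 \<le> \<beta>" "level_const g2 h2"
      "(\<integral>\<^sup>+y\<in>P \<beta> x. ennreal \<bar>f2 y - h2 y\<bar> \<partial>M) \<le> ennreal (\<delta> / 2)"
    using assms(3) d2 unfolding approximable_def by meson
  have [measurable]: "h1 \<in> borel_measurable M" "h2 \<in> borel_measurable M"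
    using 1(2) 2(2) level_const_borel_measurable by blast+
  let ?g = "min g1 g2"
  have "level_const ?g (\<lambda>y. h1 y + h2 y)"
    using level_const_mono[OF 1(2), of ?g] level_const_mono[OF 2(2), of ?g] by (simp add: level_const_def)
  moreover have "(\<integral>\<^sup>+y\<in>P \<beta> x. ennreal \<bar>f1 y + f2 y - (h1 y + h2 y)\<bar> \<partial>M) \<le> ennreal \<delta>"
    by (rule set_nn_integral_triangle[where u = "\<lambda>y. f1 y - h1 y" and v = "\<lambda>y. f2 y - h2 y"])
       (use 1(3) 2(3) \<open>\<delta> > 0\<close> in auto)
  ultimately show "\<exists>g\<le>\<beta>. \<exists>h. level_const g h
      \<and> (\<integral>\<^sup>+y\<in>P \<beta> x. ennreal \<bar>f1 y + f2 y - h y\<bar> \<partial>M) \<le> ennreal \<delta>"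
    using 1(1) by (intro exI[of _ ?g] conjI exI[of _ "\<lambda>y. h1 y + h2 y"]) auto
qed

lemma approximable_limit:
  assumes x: "x \<in> space M" and [measurable]: "f \<in> borel_measurable M"
    and lim: "\<And>\<delta>. 0 < \<delta> \<Longrightarrow> \<exists>f'. approximable \<beta> x f' \<and> (\<integral>\<^sup>+y\<in>P \<beta> x. ennreal \<bar>f y - f' y\<bar> \<partial>M) \<le> ennreal \<delta>"
  shows "approximable \<beta> x f"
  unfolding approximable_def
proof (intro conjI allI impI)
  have [measurable]: "P \<beta> x \<in> sets M" using x by auto
  fix \<delta> :: real assume "\<delta> > 0"
  then have d2: "\<delta> / 2 > 0" by simp
  obtain f' where f': "approximable \<beta> x f'" "(\<integral>\<^sup>+y\<in>P \<beta> x. ennreal \<bar>f y - f' y\<bar> \<partial>M) \<le> ennreal (\<delta> / 2)"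
    using lim[OF d2] by blast
  have [measurable]: "f' \<in> borel_measurable M" using f' by (auto simp: approximable_def)
  obtain g h where 1: "g \<le> \<beta>" "level_const g h"
      "(\<integral>\<^sup>+y\<in>P \<beta> x. ennreal \<bar>f' y - h y\<bar> \<partial>M) \<le> ennreal (\<delta> / 2)"
    using f'(1) d2 unfolding approximable_def by meson
  have [measurable]: "h \<in> borel_measurable M"
    using 1(2) level_const_borel_measurable by blast
  have "(\<integral>\<^sup>+y\<in>P \<beta> x. ennreal \<bar>f y - h y\<bar> \<partial>M) \<le> ennreal \<delta>"
    by (rule set_nn_integral_triangle[where u = "\<lambda>y. f y - f' y" and v = "\<lambda>y. f' y - h y"])
       (use 1(3) f'(2) \<open>\<delta> > 0\<close> in auto)
  with 1 show "\<exists>g\<le>\<beta>. \<exists>h. level_const g h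
      \<and> (\<integral>\<^sup>+y\<in>P \<beta> x. ennreal \<bar>f y - h y\<bar> \<partial>M) \<le> ennreal \<delta>" by blast
qed fact

lemma approximable_level_const:
  assumes "g \<le> \<beta>" "level_const g h"
  shows "approximable \<beta> x h"
  unfolding approximable_def
proof (intro conjI allI impI)
  show "h \<in> borel_measurable M"
    using assms(2) level_const_borel_measurable by blast
  show "\<exists>g\<le>\<beta>. \<exists>h'. level_const g h'
      \<and> (\<integral>\<^sup>+y\<in>P \<beta> x. ennreal \<bar>h y - h' y\<bar> \<partial>M) \<le> ennreal \<delta>" for \<delta>
    using assms by (intro exI[of _ g] conjI exI[of _ h]) simp_all
qed

lemma approximable_cong_ball:
  assumes "x \<in> space M" "approximable \<beta> x f" "f' \<in> borel_measurable M" "\<And>y. y \<in> P \<beta> x \<Longrightarrow> f y = f' y"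
  shows "approximable \<beta> x f'"
proof -
  have "(\<integral>\<^sup>+y\<in>P \<beta> x. ennreal \<bar>f y - h y\<bar> \<partial>M) = (\<integral>\<^sup>+y\<in>P \<beta> x. ennreal \<bar>f' y - h y\<bar> \<partial>M)" for h
    using assms by (intro nn_integral_cong) (auto simp: indicator_def)
  with assms show ?thesis by (simp add: approximable_def)
qed

lemma approximable_cmult:
  assumes x: "x \<in> space M" and "approximable \<beta> x f"
  shows "approximable \<beta> x (\<lambda>y. c * f y)"
  unfolding approximable_def
proof (intro conjI allI impI)
  have [measurable]: "f \<in> borel_measurable M" "P \<beta> x \<in> sets M"
    using assms by (auto simp: approximable_def)
  show "(\<lambda>y. c * f y) \<in> borel_measurable M" by measurable
  fix \<delta> :: real assume "\<delta> > 0"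
  then have d2: "\<delta> / (\<bar>c\<bar> + 1) > 0" by simp
  obtain g h where 1: "g \<le> \<beta>" "level_const g h"
      "(\<integral>\<^sup>+y\<in>P \<beta> x. ennreal \<bar>f y - h y\<bar> \<partial>M) \<le> ennreal (\<delta> / (\<bar>c\<bar> + 1))"
    using assms(2) d2 unfolding approximable_def by meson
  have [measurable]: "h \<in> borel_measurable M"
    using 1(2) level_const_borel_measurable by blast
  have "(\<integral>\<^sup>+y\<in>P \<beta> x. ennreal \<bar>c * f y - c * h y\<bar> \<partial>M) = (\<integral>\<^sup>+y. ennreal \<bar>c\<bar> * (ennreal \<bar>f y - h y\<bar> * indicator (P \<beta> x) y) \<partial>M)"
    by (intro nn_integral_cong) (auto simp: indicator_def abs_mult simp flip: ennreal_mult right_diff_distrib)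
  also have "\<dots> = ennreal \<bar>c\<bar> * (\<integral>\<^sup>+y\<in>P \<beta> x. ennreal \<bar>f y - h y\<bar> \<partial>M)"
    by (rule nn_integral_cmult) measurable
  also have "\<dots> \<le> ennreal \<bar>c\<bar> * ennreal (\<delta> / (\<bar>c\<bar> + 1))" using 1 by (intro mult_left_mono) auto
  also have "\<dots> = ennreal (\<bar>c\<bar> * (\<delta> / (\<bar>c\<bar> + 1)))" using \<open>\<delta> > 0\<close> by (simp flip: ennreal_mult)
  also have "\<dots> \<le> ennreal \<delta>" using \<open>\<delta> > 0\<close> by (intro ennreal_leI) (simp add: field_simps)
  finally have "(\<integral>\<^sup>+y\<in>P \<beta> x. ennreal \<bar>c * f y - c * h y\<bar> \<partial>M) \<le> ennreal \<delta>" .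
  moreover have "level_const g (\<lambda>y. c * h y)" using 1(2) by (simp add: level_const_def)
  ultimately show "\<exists>g\<le>\<beta>. \<exists>h. level_const g h
      \<and> (\<integral>\<^sup>+y\<in>P \<beta> x. ennreal \<bar>c * f y - h y\<bar> \<partial>M) \<le> ennreal \<delta>"
    using 1(1) by (intro exI[of _ g] conjI exI[of _ "\<lambda>y. c * h y"])
qed

text \<open>Two balls that meet are nested, so the balls together with the empty set form a
  generator stable under intersection; the sets with approximable indicator satisfy the closure
  conditions of a Dynkin system.\<close>

lemma approximable_indicator:
  assumes x: "x \<in> space M" and A: "A \<in> sets M"
  shows "approximable \<beta> x (indicator A)"
proof -
  define \<B> where "\<B> = insert {} (\<Union>g. P g ` space M)"
  have sets_\<B>: "sets M = sigma_sets (space M) \<B>"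
    unfolding sets_balls \<B>_def
    by (intro sigma_sets_eqI) (auto intro: sigma_sets.Basic sigma_sets.Empty)
  have stable: "Int_stable \<B>"
  proof (rule Int_stableI)
    fix a b assume ab: "a \<in> \<B>" "b \<in> \<B>"
    show "a \<inter> b \<in> \<B>"
    proof (cases "a \<inter> b = {}")
      case False
      then obtain z where z: "z \<in> a" "z \<in> b" by blast
      then obtain g y h w where "a = P g y" "y \<in> space M" "b = P h w" "w \<in> space M"
        using ab by (auto simp: \<B>_def)
      then have zs: "z \<in> space M" "a = P g z" "b = P h z" using z ball_eq[of y z g] ball_eq[of w z h] ball_in_space[of y z g] by simp_all
      then have "a \<inter> b = P (min g h) z"
        using ball_mono[OF zs(1), of g h] ball_mono[OF zs(1), of h g] by (cases "g \<le> h") auto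
      then show ?thesis using zs(1) by (auto simp: \<B>_def)
    qed (auto simp: \<B>_def)
  qed
  have sub: "\<B> \<subseteq> Pow (space M)" using ball_subset_space by (auto simp: \<B>_def)
  from A have "A \<in> sigma_sets (space M) \<B>" by (simp add: sets_\<B>)
  from stable sub this show ?thesis
  proof (induction rule: sigma_sets_induct_disjoint)
    case (basic A)
    show ?case
    proof (cases "A = {}")
      case False
      then obtain g z where gz: "A = P g z" "z \<in> space M" using basic by (auto simp: \<B>_def)
      \<comment> \<open>The indicator of a ball of level \<open>g\<close> is constant at level
        \<open>min g \<beta>\<close>; the minimum keeps the approximation from being coarser than
        the test ball.\<close>
      show ?thesis
        by (rule approximable_level_const[of "min g \<beta>"])
           (use ball_mem_iff[where g = "min g \<beta>" and h = g, OF _ _ _ gz(2)] gz(1) in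
              \<open>auto simp: indicator_def level_const_def\<close>)
    qed (rule approximable_level_const[of \<beta>], auto simp: level_const_def)
  next
    case empty
    show ?case by (rule approximable_level_const[of \<beta>]) (auto simp: level_const_def)
  next
    case (compl A)
    have "approximable \<beta> x (\<lambda>y. 1 + (- 1) * indicator A y)"
      by (intro approximable_add approximable_cmult x compl approximable_level_const[of \<beta>]) (auto simp: level_const_def)
    moreover have "(indicator (space M - A) :: 'a \<Rightarrow> real) \<in> borel_measurable M"
      using compl.hyps by (intro borel_measurable_indicator) (simp add: sets_\<B> sigma_sets.Compl)
    ultimately show ?case
      by (rule approximable_cong_ball[OF x]) (use ball_in_space[OF x] in \<open>auto simp: indicator_def\<close>)
  next
    case (union A)
    have [measurable]: "A i \<in> sets M" "P \<beta> x \<in> sets M" for i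
      using union.hyps ball_sets[OF x] by (auto simp: sets_\<B>)
    have dj: "A i \<inter> A j = {}" if "i \<noteq> j" for i j
      using union.hyps that by (auto simp: disjoint_family_on_def)
    have fin: "approximable \<beta> x (\<lambda>y. \<Sum>i<n. indicator (A i) y)" for n :: nat
      by (induction n) (auto simp: level_const_def intro: approximable_level_const[of \<beta>] approximable_add x union)
    \<comment> \<open>The tails of the disjoint union decrease to the empty set inside a ball of
      finite measure; their measure is exactly the \<open>L^1\<close> error of the partial
      sums.\<close>
    let ?T = "\<lambda>n :: nat. P \<beta> x \<inter> (\<Union>i\<in>{n..}. A i)"
    have "(\<lambda>n. emeasure M (?T n)) \<longlonglongrightarrow> emeasure M (\<Inter>n. ?T n)"
    proof (rule Lim_emeasure_decseq)
      show "decseq ?T" by (force simp: decseq_def)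
      show "emeasure M (?T n) \<noteq> \<infinity>" for n
      proof -
        have "emeasure M (?T n) \<le> emeasure M (P \<beta> x)" by (intro emeasure_mono) auto
        then show ?thesis by (auto simp: emeasure_ball x top_unique)
      qed
    qed auto
    moreover have "(\<Inter>n. ?T n) = {}"
    proof (rule ccontr)
      assume "(\<Inter>n. ?T n) \<noteq> {}"
      then obtain y where y: "\<And>n. y \<in> ?T n" by blast
      obtain i where i: "y \<in> A i" using y[of 0] by blast
      obtain j where "j \<ge> Suc i" "y \<in> A j" using y[of "Suc i"] by auto
      with i dj[of i j] show False by auto
    qed
    ultimately have T0: "(\<lambda>n. emeasure M (?T n)) \<longlonglongrightarrow> 0" by simp
    show ?case
    proof (rule approximable_limit[OF x])
      show "indicator (\<Union> (range A)) \<in> borel_measurable M" by measurable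
      fix \<delta> :: real assume "\<delta> > 0"
      then have "\<forall>\<^sub>F n in sequentially. emeasure M (?T n) < ennreal \<delta>"
        by (intro order_tendstoD[OF T0]) auto
      then obtain n where n: "emeasure M (?T n) < ennreal \<delta>" by (auto simp: eventually_sequentially)
      have "ennreal \<bar>indicator (\<Union> (range A)) y - (\<Sum>i<n. indicator (A i) y)\<bar> * indicator (P \<beta> x) y = indicator (?T n) y" for y
      proof (cases "\<exists>i. y \<in> A i")
        case True
        then obtain i where i: "y \<in> A i" by blast
        then have eq: "y \<in> A j \<longleftrightarrow> j = i" for j using dj[of i j] by blast
        have "(\<Sum>j<n. indicator (A j) y :: real) = (\<Sum>j<n. if j = i then 1 else 0)"
          by (intro sum.cong) (auto simp: indicator_def eq)
        also have "\<dots> = (if i < n then 1 else 0)" by simp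
        finally show ?thesis using i eq by (auto simp: indicator_def)
      qed (auto simp: indicator_def)
      then have "(\<integral>\<^sup>+y\<in>P \<beta> x. ennreal \<bar>indicator (\<Union> (range A)) y - (\<Sum>i<n. indicator (A i) y)\<bar> \<partial>M) = emeasure M (?T n)"
        by simp
      with fin[of n] n show "\<exists>f'. approximable \<beta> x f' \<and>
          (\<integral>\<^sup>+y\<in>P \<beta> x. ennreal \<bar>indicator (\<Union> (range A)) y - f' y\<bar> \<partial>M) \<le> ennreal \<delta>"
        by (intro exI[of _ "\<lambda>y. \<Sum>i<n. indicator (A i) y"]) auto
    qed
  qed
qed

lemma approximable_integrable:
  fixes f :: "'a \<Rightarrow> real"
  assumes x: "x \<in> space M" and f: "integrable M f"
  shows "approximable \<beta> x f"
  using f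
proof (induction rule: integrable_induct)
  case (base A c)
  then show ?case
    using approximable_cmult[OF x approximable_indicator[OF x, of A], of \<beta> c]
    by (simp add: mult.commute)
next
  case (add f g)
  then show ?case using approximable_add[OF x] by blast
next
  case (lim f s)
  have [measurable]: "f \<in> borel_measurable M" "s i \<in> borel_measurable M" "P \<beta> x \<in> sets M" for i
    using lim x by auto
  have "(\<lambda>i. \<integral>\<^sup>+y. norm (f y - s i y) \<partial>M) \<longlonglongrightarrow> 0"
  proof (rule nn_integral_dominated_convergence_norm[where w = "\<lambda>y. 2 * norm (f y)"])
    show "(\<integral>\<^sup>+y. ennreal (2 * norm (f y)) \<partial>M) < \<infinity>"
      using lim(4) by (simp add: integrable_iff_bounded ennreal_mult nn_integral_cmult ennreal_mult_less_top)
  qed (use lim in auto)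
  note L = this
  show ?case
  proof (rule approximable_limit[OF x])
    fix \<delta> :: real assume "\<delta> > 0"
    then have "\<forall>\<^sub>F n in sequentially. (\<integral>\<^sup>+y. norm (f y - s n y) \<partial>M) < ennreal \<delta>"
      by (intro order_tendstoD[OF L]) auto
    then obtain n where n: "(\<integral>\<^sup>+y. norm (f y - s n y) \<partial>M) < ennreal \<delta>" by (auto simp: eventually_sequentially)
    have "(\<integral>\<^sup>+y\<in>P \<beta> x. ennreal \<bar>f y - s n y\<bar> \<partial>M) \<le> (\<integral>\<^sup>+y. norm (f y - s n y) \<partial>M)"
      by (intro nn_integral_mono) (auto simp: indicator_def)
    also note n
    finally show "\<exists>f'. approximable \<beta> x f' \<and> (\<integral>\<^sup>+y\<in>P \<beta> x. ennreal \<bar>f y - f' y\<bar> \<partial>M) \<le> ennreal \<delta>"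
      using lim.IH by (intro exI[of _ "s n"]) auto
  qed measurable
qed

text \<open>Averaging at level \<open>g\<close> fixes a function \<open>h\<close> constant at that
  level and does not increase the \<open>L^1\<close> distance to it. If \<open>h\<close> is within
  \<open>\<delta> / 2\<close> of \<open>b\<close>, so is it of the average, which is then within
  \<open>\<delta>\<close> of \<open>b\<close>.\<close>

lemma avg_L1_approx:
  assumes b: "loc_integrable b" and x: "x \<in> space M" and "0 < \<delta>"
  shows "\<exists>g\<le>\<beta>. (\<integral>\<^sup>+y\<in>P \<beta> x. ennreal \<bar>avg b g y - b y\<bar> \<partial>M) \<le> ennreal \<delta>"
proof -
  have [measurable]: "b \<in> borel_measurable M" "P \<beta> x \<in> sets M"
    using b x by (auto simp: loc_integrable_def)
  have "approximable \<beta> x (\<lambda>y. indicator (P \<beta> x) y * b y)"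
    using loc_integrableD[OF b x] by (intro approximable_integrable[OF x]) (auto simp: set_integrable_def)
  then have "approximable \<beta> x b"
    by (rule approximable_cong_ball[OF x]) auto
  then obtain g h where h: "g \<le> \<beta>" "level_const g h"
      "(\<integral>\<^sup>+y\<in>P \<beta> x. ennreal \<bar>b y - h y\<bar> \<partial>M) \<le> ennreal (\<delta> / 2)"
    using half_gt_zero[OF \<open>0 < \<delta>\<close>] unfolding approximable_def by meson
  have [measurable]: "h \<in> borel_measurable M"
    using h(2) level_const_borel_measurable by blast
  have "(\<integral>\<^sup>+y\<in>P \<beta> x. ennreal \<bar>avg b g y - h y\<bar> \<partial>M) \<le> (\<integral>\<^sup>+y\<in>P \<beta> x. ennreal \<bar>b y - h y\<bar> \<partial>M)"
  proof (rule nn_integral_ball_partition_le[OF _ _ x h(1)])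
    fix y assume "y \<in> P \<beta> x"
    then have y: "y \<in> space M" by (rule ball_in_space[OF x])
    have hy: "h z = h y" if "z \<in> P g y" for z using level_constD[OF h(2) y that] .
    have "(\<integral>\<^sup>+z\<in>P g y. ennreal \<bar>avg b g z - h z\<bar> \<partial>M) = (\<integral>\<^sup>+z\<in>P g y. ennreal \<bar>avg b g y - h y\<bar> \<partial>M)"
      by (intro nn_integral_cong) (use hy avg_ball[OF y] in \<open>auto simp: indicator_def\<close>)
    also have "\<dots> = ennreal (\<bar>avg b g y - h y\<bar> * N powr g)" using y by (simp add: set_nn_integral_const)
    also have "\<dots> \<le> (\<integral>\<^sup>+z\<in>P g y. ennreal \<bar>b z - h y\<bar> \<partial>M)" by (rule avg_diff_le[OF b y])
    also have "\<dots> = (\<integral>\<^sup>+z\<in>P g y. ennreal \<bar>b z - h z\<bar> \<partial>M)"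
      by (intro nn_integral_cong) (use hy in \<open>auto simp: indicator_def\<close>)
    finally show "(\<integral>\<^sup>+z\<in>P g y. ennreal \<bar>avg b g z - h z\<bar> \<partial>M) \<le> (\<integral>\<^sup>+z\<in>P g y. ennreal \<bar>b z - h z\<bar> \<partial>M)" .
  qed measurable
  then have le2: "(\<integral>\<^sup>+y\<in>P \<beta> x. ennreal \<bar>avg b g y - h y\<bar> \<partial>M) \<le> ennreal (\<delta> / 2)"
    using h(3) by (rule order_trans)
  have "(\<integral>\<^sup>+y\<in>P \<beta> x. ennreal \<bar>avg b g y - b y\<bar> \<partial>M) \<le> ennreal \<delta>"
    by (rule set_nn_integral_triangle[where u = "\<lambda>y. avg b g y - h y" and v = "\<lambda>y. b y - h y"])
       (use h(3) le2 \<open>0 < \<delta>\<close> in auto)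
  with h(1) show ?thesis by blast
qed

text \<open>A weak form of Lebesgue differentiation: almost everywhere some average at a level up to
  \<open>\<beta>\<close>, though not necessarily every small one, comes arbitrarily close to
  \<open>b\<close>. For this, approximation in \<open>L^1\<close> suffices.\<close>

lemma AE_avg_gt:
  assumes b: "loc_integrable b" and x: "x \<in> space M"
  shows "AE y in M. y \<in> P \<beta> x \<longrightarrow> \<bar>b y - c\<bar> > t \<longrightarrow> (\<exists>g\<le>\<beta>. \<bar>avg b g y - c\<bar> > t)"
proof -
  have [measurable]: "b \<in> borel_measurable M" "P \<beta> x \<in> sets M"
    using b x by (auto simp: loc_integrable_def)
  have "AE y in M. y \<in> P \<beta> x \<longrightarrow> (\<exists>g\<le>\<beta>. \<bar>avg b g y - b y\<bar> < inverse (real (Suc n)))" for n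
  proof -
    define e where "e = inverse (real (Suc n))"
    have e: "0 < e" by (simp add: e_def)
    \<comment> \<open>\<open>E\<close> lies in the deviation set of every level
      \<open>g \<le> \<beta>\<close>, so Markov's inequality at a level with small
      \<open>L^1\<close> error forces measure zero.\<close>
    define E where "E = {y \<in> space M. y \<in> P \<beta> x \<and> (\<forall>g\<le>\<beta>. \<not> \<bar>avg b g y - b y\<bar> < e)}"
    have [measurable]: "E \<in> sets M" unfolding E_def by measurable
    have le: "ennreal e * emeasure M E \<le> 0 + ennreal \<delta>" if pos: "0 < \<delta>" for \<delta>
    proof -
      obtain g where g: "g \<le> \<beta>" "(\<integral>\<^sup>+y\<in>P \<beta> x. ennreal \<bar>avg b g y - b y\<bar> \<partial>M) \<le> ennreal \<delta>"
        using avg_L1_approx[OF b x pos] by blast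
      have "ennreal e * emeasure M E = (\<integral>\<^sup>+y. ennreal e * indicator E y \<partial>M)"
        by (simp add: nn_integral_cmult_indicator)
      also have "\<dots> \<le> (\<integral>\<^sup>+y\<in>P \<beta> x. ennreal \<bar>avg b g y - b y\<bar> \<partial>M)"
        using g(1) by (intro nn_integral_mono) (auto simp: E_def indicator_def not_less intro!: ennreal_leI)
      finally show ?thesis using g(2) by simp
    qed
    have "ennreal e * emeasure M E \<le> 0" by (rule ennreal_le_epsilon) (rule le)
    then have "emeasure M E = 0" using e by simp
    then have "E \<in> null_sets M" by (intro null_setsI) auto
    then show ?thesis unfolding e_def[symmetric] by (rule AE_I') (auto simp: E_def)
  qed
  then have "AE y in M. \<forall>n. y \<in> P \<beta> x \<longrightarrow> (\<exists>g\<le>\<beta>. \<bar>avg b g y - b y\<bar> < inverse (real (Suc n)))"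
    unfolding AE_all_countable by blast
  then show ?thesis
  proof (eventually_elim, intro impI)
    fix y assume H: "\<forall>n. y \<in> P \<beta> x \<longrightarrow> (\<exists>g\<le>\<beta>. \<bar>avg b g y - b y\<bar> < inverse (real (Suc n)))"
      and y: "y \<in> P \<beta> x" "\<bar>b y - c\<bar> > t"
    obtain n where n: "inverse (real (Suc n)) < \<bar>b y - c\<bar> - t"
      using reals_Archimedean[of "\<bar>b y - c\<bar> - t"] y by auto
    obtain g where "g \<le> \<beta>" "\<bar>avg b g y - b y\<bar> < inverse (real (Suc n))" using H y by blast
    with n have "g \<le> \<beta> \<and> \<bar>avg b g y - c\<bar> > t" by linarith
    then show "\<exists>g\<le>\<beta>. \<bar>avg b g y - c\<bar> > t" by blast
  qed
qed

end

text \<open>Serves twice: for the moments of a function with exponential tails, and to set the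
  polynomial growth of the oscillation over \<open>n\<close> levels against the geometric decay of
  large balls.\<close>

lemma summable_poly_geometric:
  fixes \<rho> :: real
  assumes "0 < \<rho>" "\<rho> < 1"
  shows "summable (\<lambda>k. (real k + 1) ^ j * \<rho> ^ k)"
proof -
  have "(\<lambda>k. 1 + 1 / (real k + 1)) \<longlonglongrightarrow> 1 + 0"
    by (intro tendsto_add tendsto_const tendsto_divide_0[OF tendsto_const])
       (auto intro!: filterlim_at_top_imp_at_infinity filterlim_tendsto_add_at_top[OF tendsto_const] filterlim_real_sequentially simp: add.commute)
  then have "(\<lambda>k. (1 + 1 / (real k + 1)) ^ j * \<rho>) \<longlonglongrightarrow> 1 ^ j * \<rho>"
    by (intro tendsto_mult tendsto_power tendsto_const) simp
  then have "\<forall>\<^sub>F k in sequentially. (1 + 1 / (real k + 1)) ^ j * \<rho> < (1 + \<rho>) / 2"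
    by (rule order_tendstoD) (use assms in simp)
  then obtain n where n: "\<And>k. k \<ge> n \<Longrightarrow> (1 + 1 / (real k + 1)) ^ j * \<rho> < (1 + \<rho>) / 2"
    unfolding eventually_sequentially by blast
  show ?thesis
  proof (rule summable_ratio_test)
    show "(1 + \<rho>) / 2 < 1" using assms by simp
    fix k assume "k \<ge> n"
    have "(real (Suc k) + 1) = (1 + 1 / (real k + 1)) * (real k + 1)" by (simp add: field_simps)
    then have "(real (Suc k) + 1) ^ j * \<rho> ^ Suc k = ((1 + 1 / (real k + 1)) ^ j * \<rho>) * ((real k + 1) ^ j * \<rho> ^ k)"
      by (simp add: power_mult_distrib)
    also have "\<dots> \<le> (1 + \<rho>) / 2 * ((real k + 1) ^ j * \<rho> ^ k)"
      using n[OF \<open>k \<ge> n\<close>] assms by (intro mult_right_mono) auto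
    finally show "norm ((real (Suc k) + 1) ^ j * \<rho> ^ Suc k) \<le> (1 + \<rho>) / 2 * norm ((real k + 1) ^ j * \<rho> ^ k)"
      using assms by (simp add: abs_mult)
  qed
qed

context ball_space
begin

subsection \<open>The John--Nirenberg inequality\<close>

definition bmo_bound :: "('a \<Rightarrow> real) \<Rightarrow> real \<Rightarrow> bool" where
  "bmo_bound b K \<longleftrightarrow> (\<forall>g. \<forall>x\<in>space M.
      (\<integral>\<^sup>+y\<in>P g x. ennreal \<bar>b y - avg b g x\<bar> \<partial>M) \<le> ennreal (K * N powr g))"

lemma bmo_boundD: "bmo_bound b K \<Longrightarrow> x \<in> space M \<Longrightarrow>
    (\<integral>\<^sup>+y\<in>P g x. ennreal \<bar>b y - avg b g x\<bar> \<partial>M) \<le> ennreal (K * N powr g)"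
  by (simp add: bmo_bound_def)

lemma nn_integral_ball_mono:
  assumes "A \<subseteq> B" "\<And>y. y \<in> A \<Longrightarrow> u y \<le> v y"
  shows "(\<integral>\<^sup>+y\<in>A. u y \<partial>M) \<le> (\<integral>\<^sup>+y\<in>B. (v y :: ennreal) \<partial>M)"
  using assms by (intro nn_integral_mono) (auto simp: indicator_def)

text \<open>The smaller ball carries at most the oscillation of its parent; \<open>N\<close> is the
  ratio of their measures.\<close>

lemma avg_step_le:
  assumes b: "loc_integrable b" "bmo_bound b K" "0 \<le> K" and x: "x \<in> space M"
  shows "\<bar>avg b g x - avg b (g + 1) x\<bar> \<le> N * K"
proof -
  have "ennreal (\<bar>avg b g x - avg b (g + 1) x\<bar> * N powr g) \<le> (\<integral>\<^sup>+y\<in>P g x. ennreal \<bar>b y - avg b (g + 1) x\<bar> \<partial>M)"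
    by (rule avg_diff_le[OF b(1) x])
  also have "\<dots> \<le> (\<integral>\<^sup>+y\<in>P (g + 1) x. ennreal \<bar>b y - avg b (g + 1) x\<bar> \<partial>M)"
    by (rule nn_integral_ball_mono[OF ball_step[OF x]]) simp
  also have "\<dots> \<le> ennreal (K * N powr (g + 1))" using bmo_boundD[OF b(2) x, of "g + 1"] by simp
  finally have "\<bar>avg b g x - avg b (g + 1) x\<bar> * N powr g \<le> K * N powr (g + 1)"
    using \<open>0 \<le> K\<close> by (subst (asm) ennreal_le_iff) auto
  then have "\<bar>avg b g x - avg b (g + 1) x\<bar> * N powr g \<le> (N * K) * N powr g"
    using N_pos by (simp add: powr_add mult_ac)
  then show ?thesis using N_pos by simp
qed

text \<open>Calderon-Zygmund stopping: the largest balls whose mean deviates from \<open>c\<close>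
  by more than \<open>2 * K\<close> cover at most half of the test ball. The parent of such a ball
  was not selected, so its own mean deviates by at most \<open>2 * K + N * K\<close>, which is the
  step \<open>A\<close>. A deviation beyond \<open>Suc k\<close> steps thus leaves more than
  \<open>k\<close> steps measured from the mean of the selected ball, where the induction hypothesis
  applies. Speaking of means instead of \<open>b\<close> keeps almost-everywhere statements out of
  the induction.\<close>

lemma john_nirenberg_avg:
  assumes b: "loc_integrable b" "bmo_bound b K" and K: "0 < K" and x: "x \<in> space M"
  shows "emeasure M {y \<in> space M. y \<in> P \<beta> x \<and> (\<exists>g\<le>\<beta>. \<bar>avg b g y - avg b \<beta> x\<bar> > real k * ((N + 2) * K))}
    \<le> ennreal ((1/2) ^ k * N powr \<beta>)"
  using x
proof (induction k arbitrary: \<beta> x)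
  case 0
  have "emeasure M {y \<in> space M. y \<in> P \<beta> x \<and> (\<exists>g\<le>\<beta>. \<bar>avg b g y - avg b \<beta> x\<bar> > real 0 * ((N + 2) * K))}
      \<le> emeasure M (P \<beta> x)"
    using 0 by (intro emeasure_mono) auto
  then show ?case using 0 by (simp add: emeasure_ball)
next
  case (Suc k)
  note x = \<open>x \<in> space M\<close>
  define A where "A = (N + 2) * K"
  define c where "c = avg b \<beta> x"
  define Q where "Q g y \<longleftrightarrow> y \<in> P \<beta> x \<and> \<bar>avg b g y - c\<bar> > 2 * K" for g y
  define U where "U = {y \<in> space M. \<exists>g\<le>\<beta>. Q g y}"
  define Big where "Big = {y \<in> space M. y \<in> P \<beta> x \<and> (\<exists>g\<le>\<beta>. \<bar>avg b g y - c\<bar> > real (Suc k) * A)}"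
  have [measurable]: "b \<in> borel_measurable M" "P \<beta> x \<in> sets M"
    using b(1) x by (auto simp: loc_integrable_def)
  have Bs [measurable]: "Big \<in> sets M" unfolding Big_def by measurable
  have A: "2 * K \<le> A" "N * K + 2 * K = A" "0 < A"
    unfolding A_def using K N_pos by (simp_all add: distrib_right add_pos_pos)
  have U_sub: "U \<subseteq> P \<beta> x" by (auto simp: U_def Q_def)
  have QQ: "Q g z \<longleftrightarrow> Q g y" if y: "y \<in> space M" "z \<in> P g y" "g \<le> \<beta>" for g y z
    using ball_mem_iff[OF y x] avg_ball[OF y(1,2), of b] by (simp add: Q_def)
  \<comment> \<open>The bound \<open>g \<le> \<beta>\<close> is built into the property because its
    constancy on balls is known only up to the level of the test ball, while
    \<open>top_ball_cover\<close> asks for it at every level.\<close>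
  have Q': "(g \<le> \<beta> \<and> Q g z) \<longleftrightarrow> (g \<le> \<beta> \<and> Q g y)" if y: "y \<in> space M" "z \<in> P g y" for g y z
    using QQ[OF y] by blast
  have Ueq: "{y \<in> space M. \<exists>g\<le>\<beta>. g \<le> \<beta> \<and> Q g y} = U" by (auto simp: U_def)
  have Us [measurable]: "U \<in> sets M" unfolding U_def Q_def by measurable
  have "(\<integral>\<^sup>+y\<in>U. ennreal (2 * K) \<partial>M) \<le> (\<integral>\<^sup>+y\<in>U. ennreal \<bar>b y - c\<bar> \<partial>M)"
    unfolding Ueq[symmetric]
  proof (rule top_ball_cover(2)[OF Q'])
    fix g y assume y: "y \<in> space M" and g: "g \<le> \<beta> \<and> Q g y"
    have "(\<integral>\<^sup>+z\<in>P g y. ennreal (2 * K) \<partial>M) = ennreal (2 * K * N powr g)"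
      using y K by (simp add: set_nn_integral_const)
    also have "\<dots> \<le> ennreal (\<bar>avg b g y - c\<bar> * N powr g)"
      using g by (intro ennreal_leI mult_right_mono) (auto simp: Q_def)
    also have "\<dots> \<le> (\<integral>\<^sup>+z\<in>P g y. ennreal \<bar>b z - c\<bar> \<partial>M)" by (rule avg_diff_le[OF b(1) y])
    finally show "(\<integral>\<^sup>+z\<in>P g y. ennreal (2 * K) \<partial>M) \<le> (\<integral>\<^sup>+z\<in>P g y. ennreal \<bar>b z - c\<bar> \<partial>M)" .
  qed measurable
  also have "\<dots> \<le> (\<integral>\<^sup>+y\<in>P \<beta> x. ennreal \<bar>b y - c\<bar> \<partial>M)"
    by (rule nn_integral_ball_mono[OF U_sub]) simp
  also have "\<dots> \<le> ennreal (K * N powr \<beta>)" unfolding c_def by (rule bmo_boundD[OF b(2) x])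
  finally have "ennreal (2 * K) * emeasure M U \<le> ennreal (K * N powr \<beta>)"
    by (simp add: nn_integral_cmult_indicator)
  then have "ennreal (1 / (2 * K)) * (ennreal (2 * K) * emeasure M U) \<le> ennreal (1 / (2 * K)) * ennreal (K * N powr \<beta>)"
    by (rule mult_left_mono) simp
  moreover have "ennreal (1 / (2 * K)) * (ennreal (2 * K) * emeasure M U) = emeasure M U"
    using K by (simp add: mult.assoc[symmetric] flip: ennreal_mult)
  moreover have "ennreal (1 / (2 * K)) * ennreal (K * N powr \<beta>) = ennreal (1/2 * N powr \<beta>)"
    using K by (simp flip: ennreal_mult)
  ultimately have mU: "emeasure M U \<le> ennreal (1/2 * N powr \<beta>)" by simp
  have "(\<integral>\<^sup>+y\<in>U. indicator Big y \<partial>M) \<le> (\<integral>\<^sup>+y\<in>U. ennreal ((1/2) ^ k) \<partial>M)"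
    unfolding Ueq[symmetric]
  proof (rule top_ball_cover(2)[OF Q'])
    fix g y assume y: "y \<in> space M" and g: "g \<le> \<beta> \<and> Q g y"
      and top: "\<And>h. g < h \<Longrightarrow> h \<le> \<beta> \<Longrightarrow> \<not> (h \<le> \<beta> \<and> Q h y)"
    have yP: "y \<in> P \<beta> x" using g by (simp add: Q_def)
    \<comment> \<open>The test ball itself is never selected, its mean being \<open>c\<close>; hence
      the parent of a selected ball still lies inside it.\<close>
    have "g \<noteq> \<beta>"
    proof
      assume "g = \<beta>"
      then have "avg b g y = c" unfolding c_def using avg_ball[OF x yP, of b] by simp
      then show False using g K by (simp add: Q_def)
    qed
    then have "g < \<beta>" using g by simp
    then have "\<not> Q (g + 1) y" using top[of "g + 1"] by simp
    then have "\<bar>avg b (g + 1) y - c\<bar> \<le> 2 * K" using yP by (simp add: Q_def)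
    with avg_step_le[OF b less_imp_le[OF K] y, of g] have dc: "\<bar>avg b g y - c\<bar> \<le> A" using A(2) by linarith
    have "Big \<inter> P g y \<subseteq> {z \<in> space M. z \<in> P g y \<and> (\<exists>h\<le>g. \<bar>avg b h z - avg b g y\<bar> > real k * A)}"
    proof
      fix z assume z: "z \<in> Big \<inter> P g y"
      then obtain h where h: "h \<le> \<beta>" "\<bar>avg b h z - c\<bar> > real (Suc k) * A" and zs: "z \<in> space M" by (auto simp: Big_def)
      have zy: "z \<in> P g y" using z by blast
      \<comment> \<open>Above a selected ball the deviation is at most \<open>2 * K \<le> A\<close>,
        so a large deviation can occur only at levels up to that of the ball.\<close>
      have "h \<le> g"
      proof (rule ccontr)
        assume "\<not> h \<le> g"
        then have hg: "g < h" by simp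
        have "z \<in> P h y" using ball_mono[OF y, of g h] hg zy by auto
        then have "avg b h z = avg b h y" by (rule avg_ball[OF y])
        moreover have "\<bar>avg b h y - c\<bar> \<le> 2 * K" using top[OF hg h(1)] h(1) yP by (simp add: Q_def)
        moreover have "1 * A \<le> real (Suc k) * A" using A(3) by (intro mult_right_mono) auto
        ultimately show False using h(2) A(1) by linarith
      qed
      moreover have "\<bar>avg b h z - avg b g y\<bar> > real k * A" using h(2) dc by (simp add: distrib_right)
      ultimately show "z \<in> {z \<in> space M. z \<in> P g y \<and> (\<exists>h\<le>g. \<bar>avg b h z - avg b g y\<bar> > real k * A)}"
        using zs zy by blast
    qed
    moreover have "{z \<in> space M. z \<in> P g y \<and> (\<exists>h\<le>g. \<bar>avg b h z - avg b g y\<bar> > real k * A)} \<in> sets M"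
      using ball_sets[OF y, of g] by measurable
    ultimately have "emeasure M (Big \<inter> P g y) \<le> ennreal ((1/2) ^ k * N powr g)"
      using Suc.IH[OF y, of g] unfolding A_def by (meson emeasure_mono order_trans)
    moreover have "(\<integral>\<^sup>+z\<in>P g y. indicator Big z \<partial>M) = emeasure M (Big \<inter> P g y)"
      using ball_sets[OF y] Bs by (simp add: indicator_inter_arith[symmetric] sets.Int)
    ultimately show "(\<integral>\<^sup>+z\<in>P g y. indicator Big z \<partial>M) \<le> (\<integral>\<^sup>+z\<in>P g y. ennreal ((1/2) ^ k) \<partial>M)"
      using y by (subst set_nn_integral_const) auto
  qed measurable
  moreover have "(\<integral>\<^sup>+y\<in>U. indicator Big y \<partial>M) = emeasure M Big"
  proof -
    have "Big \<subseteq> U"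
    proof
      fix z assume "z \<in> Big"
      then obtain h where h: "h \<le> \<beta>" "\<bar>avg b h z - c\<bar> > real (Suc k) * A" "z \<in> space M" "z \<in> P \<beta> x"
        by (auto simp: Big_def)
      have "1 * A \<le> real (Suc k) * A" using A(3) by (intro mult_right_mono) auto
      then have "\<bar>avg b h z - c\<bar> > 2 * K" using h(2) A(1) by linarith
      then show "z \<in> U" using h unfolding U_def Q_def by blast
    qed
    then have "indicator Big y * indicator U y = (indicator Big y :: ennreal)" for y
      by (auto simp: indicator_def)
    then show ?thesis by simp
  qed
  ultimately have "emeasure M Big \<le> ennreal ((1/2) ^ k) * emeasure M U"
    by (simp add: nn_integral_cmult_indicator)
  also have "\<dots> \<le> ennreal ((1/2) ^ k) * ennreal (1/2 * N powr \<beta>)" by (rule mult_left_mono[OF mU]) simp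
  also have "\<dots> = ennreal ((1/2) ^ Suc k * N powr \<beta>)" by (subst ennreal_mult[symmetric]) auto
  finally show ?case unfolding Big_def A_def c_def .
qed

text \<open>The tail estimate for means passes to \<open>b\<close> because, almost everywhere, a
  strict deviation of \<open>b\<close> is already exhibited by some mean.\<close>

lemma john_nirenberg:
  assumes b: "loc_integrable b" "bmo_bound b K" and K: "0 < K" and x: "x \<in> space M"
  shows "emeasure M {y \<in> space M. y \<in> P \<beta> x \<and> \<bar>b y - avg b \<beta> x\<bar> > real k * ((N + 2) * K)}
    \<le> ennreal ((1/2) ^ k * N powr \<beta>)"
proof -
  have [measurable]: "b \<in> borel_measurable M" "P \<beta> x \<in> sets M"
    using b(1) x by (auto simp: loc_integrable_def)
  have "emeasure M {y \<in> space M. y \<in> P \<beta> x \<and> \<bar>b y - avg b \<beta> x\<bar> > real k * ((N + 2) * K)}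
     \<le> emeasure M {y \<in> space M. y \<in> P \<beta> x \<and> (\<exists>g\<le>\<beta>. \<bar>avg b g y - avg b \<beta> x\<bar> > real k * ((N + 2) * K))}"
  proof (rule emeasure_mono_AE)
    show "AE y in M. y \<in> {y \<in> space M. y \<in> P \<beta> x \<and> \<bar>b y - avg b \<beta> x\<bar> > real k * ((N + 2) * K)}
      \<longrightarrow> y \<in> {y \<in> space M. y \<in> P \<beta> x \<and> (\<exists>g\<le>\<beta>. \<bar>avg b g y - avg b \<beta> x\<bar> > real k * ((N + 2) * K))}"
      by (rule eventually_mono[OF AE_avg_gt[OF b(1) x, where \<beta> = \<beta> and c = "avg b \<beta> x" and t = "real k * ((N + 2) * K)"]]) simp
    show "{y \<in> space M. y \<in> P \<beta> x \<and> (\<exists>g\<le>\<beta>. \<bar>avg b g y - avg b \<beta> x\<bar> > real k * ((N + 2) * K))} \<in> sets M"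
      by measurable
  qed
  then show ?thesis using john_nirenberg_avg[OF b K x] by (rule order_trans)
qed

lemma bmo_moments:
  assumes b: "loc_integrable b" "bmo_bound b K" and K: "0 < K"
  shows "\<exists>C>0. \<forall>g. \<forall>x\<in>space M. (\<integral>\<^sup>+y\<in>P g x. ennreal (\<bar>b y - avg b g x\<bar> ^ j) \<partial>M) \<le> ennreal (C * N powr g)"
proof -
  define A where "A = (N + 2) * K"
  have A: "A > 0" using K N_pos by (simp add: A_def)
  define a where "a k = (A ^ j * 2) * ((real k + 1) ^ j * (1/2) ^ k)" for k
  have a: "summable a" unfolding a_def by (intro summable_mult summable_poly_geometric) auto
  have a0: "0 < a k" for k using A by (simp add: a_def)
  show ?thesis
  proof (intro exI[of _ "suminf a"] conjI allI ballI)
    show "0 < suminf a" using a a0 by (rule suminf_pos)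
    fix g x assume x: "x \<in> space M"
    have [measurable]: "b \<in> borel_measurable M" "P g x \<in> sets M"
      using b(1) x by (auto simp: loc_integrable_def)
    let ?u = "\<lambda>y. \<bar>b y - avg b g x\<bar>"
    \<comment> \<open>Heights are counted one step low, so that a point with
      \<open>real i * A \<le> ?u y\<close> lies in \<open>F i\<close> in spite of the strict
      inequality; the price is the factor 2 in the bound for \<open>F k\<close>.\<close>
    define F where "F k = {y \<in> space M. y \<in> P g x \<and> ?u y > (real k - 1) * A}" for k
    have [measurable]: "F k \<in> sets M" for k unfolding F_def by measurable
    have F: "emeasure M (F k) \<le> ennreal (2 * (1/2) ^ k * N powr g)" for k
    proof (cases k)
      case 0
      have "emeasure M (F k) \<le> emeasure M (P g x)" by (intro emeasure_mono) (auto simp: F_def)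
      also have "\<dots> \<le> ennreal (2 * (1/2) ^ k * N powr g)" using x 0 by (simp add: emeasure_ball ennreal_leI)
      finally show ?thesis .
    next
      case (Suc m)
      then show ?thesis using john_nirenberg[OF b K x, of g m] by (simp add: F_def A_def)
    qed
    have "(\<integral>\<^sup>+y\<in>P g x. ennreal (?u y ^ j) \<partial>M) \<le> (\<integral>\<^sup>+y. (\<Sum>k. ennreal (((real k + 1) * A) ^ j) * indicator (F k) y) \<partial>M)"
    proof (rule nn_integral_mono)
      fix y assume ys: "y \<in> space M"
      show "ennreal (?u y ^ j) * indicator (P g x) y \<le> (\<Sum>k. ennreal (((real k + 1) * A) ^ j) * indicator (F k) y)"
      proof (cases "y \<in> P g x")
        case True
        define i where "i = nat \<lfloor>?u y / A\<rfloor>"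
        have i: "real i \<le> ?u y / A" "?u y / A < real i + 1"
          using A unfolding i_def by (auto simp: of_nat_nat)
        then have "real i * A \<le> ?u y" "?u y \<le> (real i + 1) * A" using A by (auto simp: field_simps)
        then have "y \<in> F i" using True ys A by (auto simp: F_def algebra_simps)
        then have "ennreal (?u y ^ j) * indicator (P g x) y \<le> ennreal (((real i + 1) * A) ^ j) * indicator (F i) y"
          using True \<open>?u y \<le> (real i + 1) * A\<close> by (simp add: ennreal_leI power_mono)
        also have "\<dots> \<le> (\<Sum>k. ennreal (((real k + 1) * A) ^ j) * indicator (F k) y)"
        proof -
          have "f i \<le> suminf f" for f :: "nat \<Rightarrow> ennreal" using sum_le_suminf[of f "{i}"] by simp
          then show ?thesis .
        qed
        finally show ?thesis .
      qed simp
    qed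
    also have "\<dots> = (\<Sum>k. ennreal (((real k + 1) * A) ^ j) * emeasure M (F k))"
      by (subst nn_integral_suminf) (auto simp: nn_integral_cmult_indicator)
    also have "\<dots> \<le> (\<Sum>k. ennreal (a k * N powr g))"
    proof (intro suminf_le summableI)
      fix k
      have "ennreal (((real k + 1) * A) ^ j) * emeasure M (F k)
          \<le> ennreal (((real k + 1) * A) ^ j) * ennreal (2 * (1/2) ^ k * N powr g)"
        by (rule mult_left_mono[OF F]) simp
      also have "\<dots> = ennreal (a k * N powr g)"
        using A by (subst ennreal_mult[symmetric]) (auto simp: a_def power_mult_distrib)
      finally show "ennreal (((real k + 1) * A) ^ j) * emeasure M (F k) \<le> ennreal (a k * N powr g)" .
    qed
    also have "\<dots> = ennreal (\<Sum>k. a k * N powr g)"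
      using a0 by (intro suminf_ennreal2 summable_mult2 a) (auto simp: less_imp_le)
    also have "\<dots> = ennreal (suminf a * N powr g)" using suminf_mult2[OF a, of "N powr g"] by simp
    finally show "(\<integral>\<^sup>+y\<in>P g x. ennreal (?u y ^ j) \<partial>M) \<le> ennreal (suminf a * N powr g)" .
  qed
qed

end

subsection \<open>Elementary inequalities\<close>

lemma epowr_ennreal [simp]: "0 \<le> u \<Longrightarrow> epowr (ennreal u) s = ennreal (u powr s)"
  by (simp add: epowr_def)

lemma epowr_measurable [measurable]: "(\<lambda>x. epowr x s) \<in> borel_measurable borel"
  unfolding epowr_def by measurable

lemma epowr_mono: "x \<le> y \<Longrightarrow> 0 \<le> s \<Longrightarrow> epowr x s \<le> epowr y s"
  by (cases x; cases y) (auto simp: epowr_def top_unique intro!: ennreal_leI powr_mono2)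

lemma epowr_SUP_le:
  fixes u :: "int \<Rightarrow> real"
  assumes "0 < q" "\<And>i. 0 \<le> u i"
  shows "epowr (SUP i. ennreal (u i)) q \<le> (\<integral>\<^sup>+i. ennreal (u i powr q) \<partial>count_space UNIV)"
proof (cases "(\<integral>\<^sup>+i. ennreal (u i powr q) \<partial>count_space UNIV)")
  case (real c)
  have "ennreal (u i powr q) \<le> ennreal c" for i
    unfolding real(2)[symmetric] by (rule nn_integral_ge_point) simp
  then have "u i powr q \<le> c" for i using real(1) by simp
  then have "(u i powr q) powr (1 / q) \<le> c powr (1 / q)" for i
    using assms by (intro powr_mono2) auto
  then have "u i \<le> c powr (1 / q)" for i using assms by (simp add: powr_powr)
  then have "(SUP i. ennreal (u i)) \<le> ennreal (c powr (1 / q))"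
    by (intro SUP_least ennreal_leI)
  then have "epowr (SUP i. ennreal (u i)) q \<le> epowr (ennreal (c powr (1 / q))) q"
    using assms by (intro epowr_mono) auto
  also have "\<dots> = ennreal c" using assms real by (simp add: powr_powr)
  finally show ?thesis using real by simp
qed simp

text \<open>Up to \<open>c\<close> the first term dominates, above \<open>c\<close> the second. With
  \<open>c\<close> an \<open>r\<close>-mean over a ball, integration bounds the
  \<open>s\<close>-mean at the cost of a factor 2; this stands in for Jensen's inequality.\<close>

lemma epowr_le_interpolate:
  assumes "0 < c" "0 < s" "s \<le> r"
  shows "epowr h s \<le> ennreal (c powr s) + ennreal (c powr (s - r)) * epowr h r"
proof (cases h)
  case (real u)
  have "u powr s \<le> c powr s + c powr (s - r) * u powr r"
  proof (cases "u \<le> c")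
    case True
    then have "u powr s \<le> c powr s" using assms real by (intro powr_mono2) auto
    then show ?thesis by (simp add: add_increasing2)
  next
    case False
    then have u: "0 < u" using assms by simp
    have "u powr s = u powr r * u powr (s - r)" by (simp flip: powr_add)
    also have "\<dots> \<le> u powr r * c powr (s - r)"
      using False assms by (intro mult_left_mono powr_mono2') auto
    finally show ?thesis by (simp add: add_increasing mult.commute)
  qed
  then show ?thesis using real by (simp flip: ennreal_mult ennreal_plus)
qed (use assms in \<open>simp add: epowr_def ennreal_mult_top\<close>)

text \<open>A crude Young inequality without the factors \<open>1 / t\<close> and
  \<open>1 / s\<close>: according to whether \<open>v \<le> u ^ (t - 1)\<close>, one of the two
  terms alone dominates. A natural \<open>t\<close> lets the oscillation of \<open>b\<close> enter
  through an integer moment.\<close>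

lemma young_conjugate:
  fixes u v :: real
  assumes "2 \<le> t" "s = real t / (real t - 1)" "0 \<le> u" "0 \<le> v"
  shows "u * v \<le> u ^ t + v powr s"
proof (cases "v \<le> u ^ (t - 1)")
  case True
  then have "u * v \<le> u * u ^ (t - 1)" using assms by (intro mult_left_mono) auto
  also have "\<dots> = u ^ t" using assms by (simp flip: power_Suc)
  finally show ?thesis by (simp add: add_increasing2)
next
  case False
  then have v: "u ^ (t - 1) < v" "0 < v" using assms by (auto intro: le_less_trans[of 0 "u ^ (t - 1)"])
  have t: "0 < real t - 1" using assms by auto
  have "u \<le> v powr (1 / (real t - 1))"
  proof (cases "u = 0")
    case False
    then have u: "0 < u" using assms by simp
    have "u = (u ^ (t - 1)) powr (1 / (real t - 1))"
      using u t assms by (simp add: powr_powr flip: powr_realpow)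
    also have "\<dots> \<le> v powr (1 / (real t - 1))" using v u t by (intro powr_mono2) auto
    finally show ?thesis .
  qed simp
  then have "u * v \<le> v powr (1 / (real t - 1)) * v" using v by (intro mult_right_mono) auto
  also have "\<dots> = v powr (1 / (real t - 1) + 1)" using v by (simp add: powr_add)
  also have "1 / (real t - 1) + 1 = s" using t assms by (simp add: field_simps)
  finally show ?thesis using assms by (simp add: add_increasing)
qed

lemma power_sum_le:
  fixes u v :: real
  assumes "0 \<le> u" "0 \<le> v"
  shows "(u + v) ^ t \<le> 2 ^ t * (u ^ t + v ^ t)"
proof -
  have "(u + v) ^ t \<le> (2 * max u v) ^ t" using assms by (intro power_mono) auto
  also have "\<dots> = 2 ^ t * max u v ^ t" by (simp add: power_mult_distrib)
  also have "\<dots> \<le> 2 ^ t * (u ^ t + v ^ t)" using assms by (intro mult_left_mono) (auto simp: max_def)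
  finally show ?thesis .
qed

text \<open>A geometric series running down to minus infinity is comparable to its largest term. It
  is used with \<open>\<rho> = r - s\<close> for the maximal inequality and with
  \<open>\<rho> = a * q\<close> for the sum over scales.\<close>

lemma geometric_sum_below:
  fixes N \<rho> :: real
  assumes N: "1 < N" and \<rho>: "0 < \<rho>"
  shows "\<exists>C>0. \<forall>T>0. (\<integral>\<^sup>+k. ennreal (N powr (real_of_int k * \<rho>)) * indicator {k. N powr real_of_int k < T} k \<partial>count_space UNIV)
     \<le> ennreal (C * T powr \<rho>)"
proof (intro exI[of _ "1 / (1 - N powr (- \<rho>))"] conjI allI impI)
  have x: "0 < N powr (- \<rho>)" "N powr (- \<rho>) < 1"
    using assms powr_less_mono[of "- \<rho>" 0 N] by auto
  then show "0 < 1 / (1 - N powr (- \<rho>))" by simp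
  fix T :: real assume T: "0 < T"
  \<comment> \<open>The largest integer with \<open>N powr m < T\<close>; the inequality is strict,
    hence ceiling minus one.\<close>
  define m where "m = \<lceil>log N T\<rceil> - 1"
  have m: "N powr k < T \<longleftrightarrow> k \<le> m" for k :: int
  proof -
    have "N powr k < T \<longleftrightarrow> real_of_int k < log N T" using N T by (simp add: less_log_iff)
    also have "\<dots> \<longleftrightarrow> k \<le> m" unfolding m_def by linarith
    finally show ?thesis .
  qed
  have bij: "bij_betw (\<lambda>i::nat. m - int i) UNIV {..m}"
    by (rule bij_betw_byWitness[where f' = "\<lambda>k. nat (m - k)"]) auto
  have "(\<integral>\<^sup>+k. ennreal (N powr (real_of_int k * \<rho>)) * indicator {k. N powr real_of_int k < T} k \<partial>count_space UNIV)
    = (\<integral>\<^sup>+k. ennreal (N powr (real_of_int k * \<rho>)) * indicator {..m} k \<partial>count_space UNIV)"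
    by (intro nn_integral_cong) (simp add: m indicator_def)
  also have "\<dots> = (\<integral>\<^sup>+k. ennreal (N powr (real_of_int k * \<rho>)) \<partial>count_space {..m})"
    by (subst nn_integral_count_space_indicator) auto
  also have "\<dots> = (\<integral>\<^sup>+i. ennreal (N powr (real_of_int (m - int i) * \<rho>)) \<partial>count_space UNIV)"
    by (subst nn_integral_bij_count_space[OF bij, symmetric]) simp
  also have "\<dots> = (\<Sum>i. ennreal (N powr (m * \<rho>) * (N powr (- \<rho>)) ^ i))"
    unfolding nn_integral_count_space_nat
  proof (rule arg_cong[where f = suminf], rule ext)
    fix i
    have "real_of_int (m - int i) * \<rho> = m * \<rho> + (- \<rho>) * real i" by (simp add: algebra_simps)
    moreover have "(N powr (- \<rho>)) ^ i = N powr ((- \<rho>) * real i)"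
      by (simp add: powr_powr flip: powr_realpow[OF x(1)])
    ultimately show "ennreal (N powr (real_of_int (m - int i) * \<rho>)) = ennreal (N powr (m * \<rho>) * (N powr (- \<rho>)) ^ i)"
      by (simp only: powr_add)
  qed
  also have "\<dots> = ennreal (\<Sum>i. N powr (m * \<rho>) * (N powr (- \<rho>)) ^ i)"
    using x by (intro suminf_ennreal2 summable_mult summable_geometric) auto
  also have "(\<Sum>i. N powr (m * \<rho>) * (N powr (- \<rho>)) ^ i) = N powr (m * \<rho>) * (1 / (1 - N powr (- \<rho>)))"
    using x by (subst suminf_mult) (auto intro!: summable_geometric simp: suminf_geometric)
  also have "\<dots> \<le> 1 / (1 - N powr (- \<rho>)) * T powr \<rho>"
  proof -
    have "N powr (m * \<rho>) = (N powr m) powr \<rho>" by (simp add: powr_powr)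
    also have "\<dots> \<le> T powr \<rho>" using m[of m] \<rho> by (intro powr_mono2) auto
    finally have "N powr (m * \<rho>) * (1 / (1 - N powr (- \<rho>))) \<le> T powr \<rho> * (1 / (1 - N powr (- \<rho>)))"
      using x by (intro mult_right_mono) auto
    then show ?thesis by (simp add: mult.commute)
  qed
  finally show "(\<integral>\<^sup>+k. ennreal (N powr (real_of_int k * \<rho>)) * indicator {k. N powr real_of_int k < T} k \<partial>count_space UNIV)
     \<le> ennreal (1 / (1 - N powr (- \<rho>)) * T powr \<rho>)" by (simp add: ennreal_leI)
qed

context ball_space
begin

lemma set_nn_integral_ball_const_plus:
  assumes x: "x \<in> space M" and [measurable]: "w \<in> borel_measurable M" and "0 \<le> c" "0 \<le> d" "0 \<le> e"
    and w: "(\<integral>\<^sup>+y\<in>P g x. w y \<partial>M) \<le> ennreal (e * N powr g)"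
  shows "(\<integral>\<^sup>+y\<in>P g x. (ennreal c + ennreal d * w y) \<partial>M) \<le> ennreal ((c + d * e) * N powr g)"
proof -
  have [measurable]: "P g x \<in> sets M" using x by auto
  have "(\<integral>\<^sup>+y\<in>P g x. (ennreal c + ennreal d * w y) \<partial>M)
      = (\<integral>\<^sup>+y. ennreal c * indicator (P g x) y + ennreal d * (w y * indicator (P g x) y) \<partial>M)"
    by (intro nn_integral_cong) (auto simp: indicator_def)
  also have "\<dots> = (\<integral>\<^sup>+y\<in>P g x. ennreal c \<partial>M) + ennreal d * (\<integral>\<^sup>+y\<in>P g x. w y \<partial>M)"
    by (subst nn_integral_add) (auto simp: nn_integral_cmult)
  also have "\<dots> \<le> ennreal (c * N powr g) + ennreal d * ennreal (e * N powr g)"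
    using w x \<open>0 \<le> c\<close> by (intro add_mono mult_left_mono) (auto simp: set_nn_integral_const)
  also have "\<dots> = ennreal ((c + d * e) * N powr g)"
    using assms(3-5) by (simp add: algebra_simps flip: ennreal_mult ennreal_plus)
  finally show ?thesis .
qed

text \<open>Integrates \<open>epowr_le_interpolate\<close> at the cut-off \<open>c\<close>. It
  serves for the local means of \<open>f\<close>, for the descent from \<open>q\<close>-means to
  1-means in the converse, and for the embedding of Morrey spaces.\<close>

lemma set_nn_integral_epowr_mean:
  assumes x: "x \<in> space M" and [measurable]: "h \<in> borel_measurable M"
    and e: "0 < s" "s \<le> r" and c: "0 < c"
    and le: "(\<integral>\<^sup>+y\<in>P g x. epowr (h y) r \<partial>M) \<le> ennreal (c powr r * N powr g)"
  shows "(\<integral>\<^sup>+y\<in>P g x. epowr (h y) s \<partial>M) \<le> ennreal (2 * c powr s * N powr g)"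
proof -
  have "(\<integral>\<^sup>+y\<in>P g x. epowr (h y) s \<partial>M)
      \<le> (\<integral>\<^sup>+y\<in>P g x. (ennreal (c powr s) + ennreal (c powr (s - r)) * epowr (h y) r) \<partial>M)"
    using e c by (intro nn_integral_ball_mono epowr_le_interpolate) auto
  also have "\<dots> \<le> ennreal ((c powr s + c powr (s - r) * c powr r) * N powr g)"
    by (rule set_nn_integral_ball_const_plus[OF x _ _ _ _ le]) auto
  also have "c powr s + c powr (s - r) * c powr r = 2 * c powr s" by (simp flip: powr_add)
  finally show ?thesis .
qed

end

subsection \<open>Boundedness of the maximal commutator\<close>

text \<open>The parameters \<open>a\<close> and \<open>l\<close> stand for \<open>\<alpha> / n\<close> and \<open>\<lambda> / n\<close>; the exponents \<open>t\<close> and \<open>s\<close> are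
  conjugate, with \<open>s < r\<close>.\<close>

locale commutator = ball_space +
  fixes b :: "'a \<Rightarrow> real" and K a l r q s :: real and t :: nat
  assumes b: "loc_integrable b" "bmo_bound b K" and K_pos: "0 < K"
    and a_pos: "0 < a" and r_gt_1: "1 < r" and l_pos: "0 < l" and l_less: "l < 1 - a * r"
    and q_eq: "1 / q = 1 / r - a / (1 - l)"
    and t_ge_2: "2 \<le> t" and s_eq: "s = real t / (real t - 1)" and s_less_r: "s < r"
begin

text \<open>The rate at which the Morrey condition makes \<open>r\<close>-means decay with the
  level: \<open>N powr (g * l)\<close> divided by the measure \<open>N powr g\<close>, raised to
  \<open>1 / r\<close>.\<close>

definition \<kappa> :: real where "\<kappa> = (1 - l) / r"

lemma l_less_1: "l < 1"
proof -
  have "0 < a * r" using a_pos r_gt_1 by simp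
  with l_less show ?thesis by linarith
qed

lemma kappa_gt: "a < \<kappa>" and kappa_pos: "0 < \<kappa>"
  using l_less r_gt_1 l_less_1 by (auto simp: \<kappa>_def field_simps)

lemma s_gt_1: "1 < s"
  using t_ge_2 by (simp add: s_eq field_simps)

lemma q_inverse: "1 / q = (\<kappa> - a) / (1 - l)"
  using l_less_1 r_gt_1 unfolding q_eq \<kappa>_def by (simp add: field_simps)

lemma q_pos: "0 < q"
proof -
  have "0 < 1 / q" unfolding q_inverse using kappa_gt l_less_1 by simp
  then show ?thesis by simp
qed

lemma kappa_a_q: "(\<kappa> - a) * q = 1 - l"
  using q_inverse q_pos l_less_1 by (simp add: field_simps)

lemma kappa_r: "\<kappa> * r = 1 - l"
  using r_gt_1 by (simp add: \<kappa>_def)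

text \<open>The Hedberg-Adams balance: it converts the power \<open>a * q\<close> of a radius into
  the power \<open>q - r\<close> of the mean that determines this radius.\<close>

lemma a_q: "a * q = \<kappa> * (q - r)"
  using kappa_a_q kappa_r by (simp add: algebra_simps)

lemma b_measurable [measurable]: "b \<in> borel_measurable M"
  using b(1) by (rule loc_integrable_measurable)

text \<open>What Young's inequality leaves after averaging: \<open>2 ^ t\<close> comes from
  splitting \<open>b x - b y\<close> at the mean, \<open>C\<close> stands for a bound of the
  \<open>t\<close>-th moment, and the last 1 is the normalised power of \<open>f\<close>. For
  \<open>0 \<le> C\<close> the value is at least 1, which later allows the exponent to be
  enlarged.\<close>

definition D :: "real \<Rightarrow> int \<Rightarrow> 'a \<Rightarrow> real" where
  "D C g x = 2 ^ t * (\<bar>b x - avg b g x\<bar> ^ t + C) + 1"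

definition S :: "('a \<Rightarrow> real) \<Rightarrow> int \<Rightarrow> 'a \<Rightarrow> real" where
  "S f g x = avg (\<lambda>y. \<bar>f y\<bar> powr s) g x powr (1 / s)"

definition morrey_bound :: "('a \<Rightarrow> real) \<Rightarrow> real \<Rightarrow> bool" where
  "morrey_bound f L \<longleftrightarrow> f \<in> borel_measurable M \<and> (\<forall>g. \<forall>x\<in>space M.
      (\<integral>\<^sup>+y\<in>P g x. ennreal (\<bar>f y\<bar> powr r) \<partial>M) \<le> ennreal (L powr r * N powr (g * l)))"

lemma D_measurable [measurable]: "D C g \<in> borel_measurable M"
  unfolding D_def by measurable

lemma S_measurable [measurable]: "S f g \<in> borel_measurable M"
  unfolding S_def by measurable

lemma S_nonneg [simp]: "0 \<le> S f g x"
  by (simp add: S_def)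

lemma S_ball: "x \<in> space M \<Longrightarrow> y \<in> P g x \<Longrightarrow> S f g y = S f g x"
  by (simp add: S_def avg_ball)

context
  fixes f L
  assumes f: "morrey_bound f L" and L: "0 < L"
begin

lemma f_measurable [measurable]: "f \<in> borel_measurable M"
  using f by (simp add: morrey_bound_def)

lemma morrey_boundD: "x \<in> space M \<Longrightarrow>
    (\<integral>\<^sup>+y\<in>P g x. ennreal (\<bar>f y\<bar> powr r) \<partial>M) \<le> ennreal (L powr r * N powr (g * l))"
  using f by (simp add: morrey_bound_def)

lemma f_powr_s_le:
  assumes x: "x \<in> space M"
  shows "(\<integral>\<^sup>+y\<in>P g x. ennreal (\<bar>f y\<bar> powr s) \<partial>M) \<le> ennreal (2 * (L * N powr (- (g * \<kappa>))) powr s * N powr g)"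
proof -
  \<comment> \<open>Chosen so that \<open>?c powr r\<close> is the Morrey bound for the mean of the
    \<open>r\<close>-th power, by \<open>\<kappa> * r = 1 - l\<close>.\<close>
  let ?c = "L * N powr (- (g * \<kappa>))"
  have c: "0 < ?c" using L N_pos by simp
  have "?c powr r * N powr g = L powr r * N powr (- (g * \<kappa>) * r + g)"
    using L N_pos by (simp add: powr_mult powr_powr flip: powr_add)
  also have "- (g * \<kappa>) * r + g = g * (1 - \<kappa> * r)" by (simp add: algebra_simps)
  also have "1 - \<kappa> * r = l" using kappa_r by simp
  finally have "(\<integral>\<^sup>+y\<in>P g x. epowr (ennreal \<bar>f y\<bar>) r \<partial>M) \<le> ennreal (?c powr r * N powr g)"
    using morrey_boundD[OF x, of g] by simp
  then have "(\<integral>\<^sup>+y\<in>P g x. epowr (ennreal \<bar>f y\<bar>) s \<partial>M) \<le> ennreal (2 * ?c powr s * N powr g)"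
    using c s_gt_1 s_less_r by (intro set_nn_integral_epowr_mean[OF x]) auto
  then show ?thesis by simp
qed

lemma loc_integrable_f_powr_s: "loc_integrable (\<lambda>y. \<bar>f y\<bar> powr s)"
  unfolding loc_integrable_def
proof (intro conjI allI ballI)
  fix g x assume x: "x \<in> space M"
  have [measurable]: "P g x \<in> sets M" using x by auto
  have "(\<integral>\<^sup>+y. ennreal (norm (indicat_real (P g x) y *\<^sub>R \<bar>f y\<bar> powr s)) \<partial>M) = (\<integral>\<^sup>+y\<in>P g x. ennreal (\<bar>f y\<bar> powr s) \<partial>M)"
    by (intro nn_integral_cong) (auto simp: indicator_def)
  also have "\<dots> < \<infinity>" using f_powr_s_le[OF x, of g] by (simp add: le_less_trans)
  finally show "set_integrable M (P g x) (\<lambda>y. \<bar>f y\<bar> powr s)"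
    unfolding set_integrable_def by (intro integrableI_bounded) auto
qed measurable

lemma avg_f_powr_s:
  assumes x: "x \<in> space M"
  shows "0 \<le> avg (\<lambda>y. \<bar>f y\<bar> powr s) g x"
    and "(\<integral>\<^sup>+y\<in>P g x. ennreal (\<bar>f y\<bar> powr s) \<partial>M) = ennreal (avg (\<lambda>y. \<bar>f y\<bar> powr s) g x * N powr g)"
proof -
  have "0 \<le> (LINT y:P g x|M. \<bar>f y\<bar> powr s)"
    unfolding set_lebesgue_integral_def by (intro integral_nonneg_AE) auto
  then show "0 \<le> avg (\<lambda>y. \<bar>f y\<bar> powr s) g x" by (simp add: avg_def)
  have "(\<integral>\<^sup>+y\<in>P g x. ennreal (\<bar>f y\<bar> powr s) \<partial>M) = ennreal (LINT y:P g x|M. \<bar>f y\<bar> powr s)"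
    by (rule set_nn_integral_eq_integral[OF loc_integrableD[OF loc_integrable_f_powr_s x]]) simp
  also have "(LINT y:P g x|M. \<bar>f y\<bar> powr s) = avg (\<lambda>y. \<bar>f y\<bar> powr s) g x * N powr g"
    using N_pos x by (simp add: avg_def measure_ball)
  finally show "(\<integral>\<^sup>+y\<in>P g x. ennreal (\<bar>f y\<bar> powr s) \<partial>M) = ennreal (avg (\<lambda>y. \<bar>f y\<bar> powr s) g x * N powr g)" .
qed

lemma S_powr_s:
  assumes x: "x \<in> space M" shows "S f g x powr s = avg (\<lambda>y. \<bar>f y\<bar> powr s) g x"
  using avg_f_powr_s(1)[OF x] s_gt_1 by (simp add: S_def powr_powr)

lemma S_le:
  assumes x: "x \<in> space M" shows "S f g x \<le> 2 * L * N powr (- (g * \<kappa>))"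
proof -
  let ?c = "L * N powr (- (g * \<kappa>))"
  have c: "0 < ?c" using L N_pos by simp
  have "avg (\<lambda>y. \<bar>f y\<bar> powr s) g x * N powr g \<le> 2 * ?c powr s * N powr g"
    using f_powr_s_le[OF x, of g] unfolding avg_f_powr_s(2)[OF x]
    by (subst (asm) ennreal_le_iff) auto
  then have "avg (\<lambda>y. \<bar>f y\<bar> powr s) g x \<le> 2 * ?c powr s" using N_pos by simp
  also have "\<dots> \<le> 2 powr s * ?c powr s" using s_gt_1 powr_mono[of 1 s 2] by (intro mult_right_mono) auto
  also have "\<dots> = (2 * ?c) powr s" using c by (subst powr_mult) auto
  finally have "S f g x \<le> ((2 * ?c) powr s) powr (1 / s)"
    unfolding S_def using avg_f_powr_s(1)[OF x] s_gt_1 by (intro powr_mono2) auto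
  also have "\<dots> = 2 * ?c" using c s_gt_1 by (simp add: powr_powr)
  finally show ?thesis by simp
qed

text \<open>Young's inequality is applied to \<open>\<bar>f y\<bar> / A\<close> with
  \<open>A\<close> just above the local mean \<open>S f g x\<close>; the mean of its
  \<open>s\<close>-th power is then at most 1, and the bound stays linear in the mean. Dividing by
  \<open>S f g x\<close> itself is avoided since it may be 0.\<close>

lemma commutator_mean_le:
  assumes x: "x \<in> space M" and C: "0 \<le> C"
    and mom: "(\<integral>\<^sup>+y\<in>P g x. ennreal (\<bar>b y - avg b g x\<bar> ^ t) \<partial>M) \<le> ennreal (C * N powr g)"
  shows "(\<integral>\<^sup>+y\<in>P g x. ennreal (\<bar>b x - b y\<bar> * \<bar>f y\<bar>) \<partial>M) \<le> ennreal (S f g x * D C g x * N powr g)"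
proof -
  have [measurable]: "P g x \<in> sets M" using x by auto
  let ?w = "\<bar>b x - avg b g x\<bar>"
  have Dp: "0 < D C g x" unfolding D_def using C by (intro add_nonneg_pos mult_nonneg_nonneg) auto
  have main: "(\<integral>\<^sup>+y\<in>P g x. ennreal (\<bar>b x - b y\<bar> * \<bar>f y\<bar>) \<partial>M) \<le> ennreal (A * D C g x * N powr g)"
    if A: "S f g x < A" for A
  proof -
    have A0: "0 < A" using A S_nonneg[of f g x] by linarith
    have "(\<integral>\<^sup>+y\<in>P g x. ennreal (\<bar>b x - b y\<bar> * \<bar>f y\<bar>) \<partial>M)
      \<le> (\<integral>\<^sup>+y. ennreal (A * 2 ^ t * ?w ^ t) * indicator (P g x) y
          + (ennreal (A * 2 ^ t) * (ennreal (\<bar>b y - avg b g x\<bar> ^ t) * indicator (P g x) y)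
          + ennreal (A / A powr s) * (ennreal (\<bar>f y\<bar> powr s) * indicator (P g x) y)) \<partial>M)"
    proof (intro nn_integral_mono)
      fix y
      have "\<bar>b x - b y\<bar> * (\<bar>f y\<bar> / A) \<le> \<bar>b x - b y\<bar> ^ t + (\<bar>f y\<bar> / A) powr s"
        using A0 by (intro young_conjugate[OF t_ge_2 s_eq]) auto
      also have "\<bar>b x - b y\<bar> ^ t \<le> (?w + \<bar>b y - avg b g x\<bar>) ^ t"
        by (intro power_mono) auto
      also have "\<dots> \<le> 2 ^ t * (?w ^ t + \<bar>b y - avg b g x\<bar> ^ t)" by (rule power_sum_le) auto
      finally have "A * (\<bar>b x - b y\<bar> * (\<bar>f y\<bar> / A)) \<le> A * (2 ^ t * (?w ^ t + \<bar>b y - avg b g x\<bar> ^ t) + (\<bar>f y\<bar> / A) powr s)"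
        using A0 by (intro mult_left_mono) auto
      then have "\<bar>b x - b y\<bar> * \<bar>f y\<bar> \<le> A * 2 ^ t * ?w ^ t + (A * 2 ^ t * \<bar>b y - avg b g x\<bar> ^ t + A / A powr s * \<bar>f y\<bar> powr s)"
        using A0 by (simp add: powr_divide algebra_simps)
      then show "ennreal (\<bar>b x - b y\<bar> * \<bar>f y\<bar>) * indicator (P g x) y \<le> ennreal (A * 2 ^ t * ?w ^ t) * indicator (P g x) y
          + (ennreal (A * 2 ^ t) * (ennreal (\<bar>b y - avg b g x\<bar> ^ t) * indicator (P g x) y)
          + ennreal (A / A powr s) * (ennreal (\<bar>f y\<bar> powr s) * indicator (P g x) y))"
        using A0 by (auto simp: indicator_def simp flip: ennreal_mult ennreal_plus intro!: ennreal_leI)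
    qed
    also have "\<dots> = ennreal (A * 2 ^ t * ?w ^ t * N powr g)
        + (ennreal (A * 2 ^ t) * (\<integral>\<^sup>+y\<in>P g x. ennreal (\<bar>b y - avg b g x\<bar> ^ t) \<partial>M)
        + ennreal (A / A powr s) * (\<integral>\<^sup>+y\<in>P g x. ennreal (\<bar>f y\<bar> powr s) \<partial>M))"
    proof -
      have 1: "(\<integral>\<^sup>+y\<in>P g x. ennreal (A * 2 ^ t * ?w ^ t) \<partial>M) = ennreal (A * 2 ^ t * ?w ^ t * N powr g)"
        using A0 by (intro set_nn_integral_const[OF x]) simp
      have 2: "(\<integral>\<^sup>+y. c1 * (ennreal (\<bar>b y - avg b g x\<bar> ^ t) * indicator (P g x) y) + c2 * (ennreal (\<bar>f y\<bar> powr s) * indicator (P g x) y) \<partial>M)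
        = c1 * (\<integral>\<^sup>+y\<in>P g x. ennreal (\<bar>b y - avg b g x\<bar> ^ t) \<partial>M) + c2 * (\<integral>\<^sup>+y\<in>P g x. ennreal (\<bar>f y\<bar> powr s) \<partial>M)" for c1 c2
        by (subst nn_integral_add) (measurable, simp add: nn_integral_cmult)
      show ?thesis
        unfolding 1[symmetric] 2[symmetric] by (rule nn_integral_add) measurable
    qed
    also have "\<dots> \<le> ennreal (A * 2 ^ t * ?w ^ t * N powr g)
        + (ennreal (A * 2 ^ t) * ennreal (C * N powr g) + ennreal (A / A powr s) * ennreal (A powr s * N powr g))"
    proof (intro add_mono mult_left_mono order_refl mom)
      have "avg (\<lambda>y. \<bar>f y\<bar> powr s) g x \<le> A powr s"
        unfolding S_powr_s[OF x, symmetric] using A s_gt_1 by (intro powr_mono2) auto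
      then show "(\<integral>\<^sup>+y\<in>P g x. ennreal (\<bar>f y\<bar> powr s) \<partial>M) \<le> ennreal (A powr s * N powr g)"
        unfolding avg_f_powr_s(2)[OF x] by (intro ennreal_leI mult_right_mono) auto
    qed auto
    also have "\<dots> = ennreal (A * D C g x * N powr g)"
      using A0 C by (simp add: D_def algebra_simps flip: ennreal_mult ennreal_plus)
    finally show ?thesis .
  qed
  show ?thesis
  proof (rule ennreal_le_epsilon)
    fix e :: real assume e: "0 < e"
    \<comment> \<open>The excess of \<open>A\<close> over the mean is \<open>e\<close> divided by
      the coefficient, so the passage to the limit costs exactly \<open>e\<close>.\<close>
    have Z: "0 < D C g x * N powr g" using Dp N_pos by simp
    have "(\<integral>\<^sup>+y\<in>P g x. ennreal (\<bar>b x - b y\<bar> * \<bar>f y\<bar>) \<partial>M)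
        \<le> ennreal ((S f g x + e / (D C g x * N powr g)) * D C g x * N powr g)"
      using e Z by (intro main) (metis divide_pos_pos less_add_same_cancel1)
    also have "(S f g x + e / (D C g x * N powr g)) * D C g x * N powr g = S f g x * D C g x * N powr g + e"
      using Dp N_pos by (simp add: field_simps)
    also have "ennreal (S f g x * D C g x * N powr g + e) = ennreal (S f g x * D C g x * N powr g) + ennreal e"
      using e Dp by (intro ennreal_plus) auto
    finally show "(\<integral>\<^sup>+y\<in>P g x. ennreal (\<bar>b x - b y\<bar> * \<bar>f y\<bar>) \<partial>M)
        \<le> ennreal (S f g x * D C g x * N powr g) + ennreal e" .
  qed
qed

end

section \<open>The maximal function over balls inside the test ball, and the sum over small
  scales\<close>

definition level_set :: "('a \<Rightarrow> real) \<Rightarrow> int \<Rightarrow> 'a \<Rightarrow> int \<Rightarrow> 'a set" where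
  "level_set f \<beta> x k = {y \<in> space M. y \<in> P \<beta> x \<and> (\<exists>g\<le>\<beta>. N powr k < S f g y)}"

lemma level_set_measurable:
  assumes "x \<in> space M" shows "level_set f \<beta> x k \<in> sets M"
proof -
  have [measurable]: "P \<beta> x \<in> sets M" using assms by auto
  show ?thesis unfolding level_set_def by measurable
qed

text \<open>The weak-type maximal inequality; restricting the right-hand side to large values of \<open>f\<close> is what
  allows summation over all levels.\<close>

lemma level_set_emeasure_le:
  assumes f: "morrey_bound f L" and L: "0 < L" and x: "x \<in> space M"
  shows "ennreal (N powr (k * s) / 2) * emeasure M (level_set f \<beta> x k)
    \<le> (\<integral>\<^sup>+y\<in>P \<beta> x. (ennreal (\<bar>f y\<bar> powr s) * indicator {y. N powr (real_of_int k - 1) < \<bar>f y\<bar>} y) \<partial>M)"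
proof -
  note [measurable] = f_measurable[OF f L] level_set_measurable[OF x, of f \<beta> k]
  have [measurable]: "P \<beta> x \<in> sets M" using x by auto
  define Q where "Q g y \<longleftrightarrow> g \<le> \<beta> \<and> y \<in> P \<beta> x \<and> N powr k < S f g y" for g y
  let ?v = "\<lambda>y. ennreal (\<bar>f y\<bar> powr s) * indicator {y. N powr (real_of_int k - 1) < \<bar>f y\<bar>} y"
  have U: "{y \<in> space M. \<exists>g\<le>\<beta>. Q g y} = level_set f \<beta> x k"
    unfolding level_set_def Q_def by blast
  have QQ: "Q g z \<longleftrightarrow> Q g y" if y: "y \<in> space M" "z \<in> P g y" for g y z
    using ball_mem_iff[OF y _ x] S_ball[OF y, of f] unfolding Q_def by auto
  \<comment> \<open>Values of \<open>f\<close> up to \<open>N powr (k - 1)\<close> account for at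
    most half of the lower bound on a selected ball, as
    \<open>N powr (- s) \<le> 1 / N \<le> 1 / 2\<close>, and can be absorbed.\<close>
  have half: "N powr ((real_of_int k - 1) * s) \<le> N powr (k * s) / 2"
  proof -
    have "N powr ((real_of_int k - 1) * s) = N powr (k * s) * N powr (- s)"
      by (simp add: algebra_simps flip: powr_add)
    also have "N powr (- s) \<le> N powr (- 1)" using s_gt_1 N_gt_1 by (intro powr_mono) auto
    also have "N powr (- 1) \<le> 1 / 2" using N_ge_2 by (simp add: powr_minus divide_simps)
    finally show ?thesis by (simp add: mult_left_mono)
  qed
  have "(\<integral>\<^sup>+y\<in>level_set f \<beta> x k. ennreal (N powr (k * s) / 2) \<partial>M) \<le> (\<integral>\<^sup>+y\<in>level_set f \<beta> x k. ?v y \<partial>M)"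
    unfolding U[symmetric]
  proof (rule top_ball_cover(2)[OF QQ])
    fix g y assume y: "y \<in> space M" and Q: "Q g y"
    have [measurable]: "P g y \<in> sets M" using y by auto
    have "N powr (k * s) = (N powr k) powr s" by (simp add: powr_powr)
    also have "\<dots> \<le> S f g y powr s" using Q s_gt_1 by (intro powr_mono2) (auto simp: Q_def)
    also have "\<dots> = avg (\<lambda>y. \<bar>f y\<bar> powr s) g y" by (rule S_powr_s[OF f L y])
    finally have "ennreal (N powr (k * s) * N powr g) \<le> (\<integral>\<^sup>+z\<in>P g y. ennreal (\<bar>f z\<bar> powr s) \<partial>M)"
      unfolding avg_f_powr_s(2)[OF f L y] by (intro ennreal_leI mult_right_mono) auto
    also have "\<dots> \<le> (\<integral>\<^sup>+z. ?v z * indicator (P g y) z + ennreal (N powr (k * s) / 2) * indicator (P g y) z \<partial>M)"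
    proof (rule nn_integral_mono)
      fix z
      show "ennreal (\<bar>f z\<bar> powr s) * indicator (P g y) z
          \<le> ?v z * indicator (P g y) z + ennreal (N powr (k * s) / 2) * indicator (P g y) z"
      proof (cases "N powr (real_of_int k - 1) < \<bar>f z\<bar>")
        case False
        then have "\<bar>f z\<bar> powr s \<le> (N powr (real_of_int k - 1)) powr s" using s_gt_1 by (intro powr_mono2) auto
        also have "\<dots> \<le> N powr (k * s) / 2" using half by (simp add: powr_powr)
        finally show ?thesis using False by (auto simp: indicator_def intro!: ennreal_leI)
      qed (simp add: indicator_def)
    qed
    also have "\<dots> = (\<integral>\<^sup>+z\<in>P g y. ?v z \<partial>M) + (\<integral>\<^sup>+z\<in>P g y. ennreal (N powr (k * s) / 2) \<partial>M)"
      by (rule nn_integral_add) measurable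
    also have "(\<integral>\<^sup>+z\<in>P g y. ennreal (N powr (k * s) / 2) \<partial>M) = ennreal (N powr (k * s) / 2 * N powr g)"
      using y by (intro set_nn_integral_const) auto
    finally have le: "ennreal (N powr (k * s) * N powr g) \<le> (\<integral>\<^sup>+z\<in>P g y. ?v z \<partial>M) + ennreal (N powr (k * s) / 2 * N powr g)" .
    have "ennreal (N powr (k * s) / 2 * N powr g) \<le> (\<integral>\<^sup>+z\<in>P g y. ?v z \<partial>M)"
    proof (cases "(\<integral>\<^sup>+z\<in>P g y. ?v z \<partial>M)")
      case (real c)
      show ?thesis using le real(1) unfolding real(2) by (simp flip: ennreal_plus)
    qed simp
    then show "(\<integral>\<^sup>+z\<in>P g y. ennreal (N powr (k * s) / 2) \<partial>M) \<le> (\<integral>\<^sup>+z\<in>P g y. ?v z \<partial>M)"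
      using y by (subst set_nn_integral_const) auto
  qed measurable
  also have "\<dots> \<le> (\<integral>\<^sup>+y\<in>P \<beta> x. ?v y \<partial>M)"
    by (rule nn_integral_ball_mono) (auto simp: level_set_def)
  finally show ?thesis by (simp add: nn_integral_cmult_indicator)
qed

text \<open>Marcinkiewicz interpolation in discrete form: the weak-type bound, weighted with
  \<open>2 * N powr (k * (r - s))\<close>, is summed over the heights \<open>k\<close>. At a point
  \<open>y\<close> only heights with \<open>N powr k < N * \<bar>f y\<bar>\<close> remain, so the
  geometric sum supplies the missing power \<open>r - s\<close> of \<open>f\<close>; it converges
  because \<open>s < r\<close>.\<close>

lemma level_set_sum_le:
  "\<exists>C>0. \<forall>f L \<beta>. \<forall>x\<in>space M. morrey_bound f L \<longrightarrow> 0 < L \<longrightarrow>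
    (\<integral>\<^sup>+k. ennreal (N powr (real_of_int k * r)) * emeasure M (level_set f \<beta> x k) \<partial>count_space UNIV)
      \<le> ennreal (C * L powr r * N powr (\<beta> * l))"
proof -
  obtain C where C: "0 < C" and geo: "\<And>T. 0 < T \<Longrightarrow>
      (\<integral>\<^sup>+k. ennreal (N powr (real_of_int k * (r - s))) * indicator {k. N powr real_of_int k < T} k \<partial>count_space UNIV)
      \<le> ennreal (C * T powr (r - s))"
    using geometric_sum_below[OF N_gt_1, of "r - s"] s_less_r by auto
  let ?C = "2 * C * N powr (r - s)"
  show ?thesis
  proof (intro exI[of _ ?C] conjI allI ballI impI)
    show "0 < ?C" using C N_pos by simp
    fix f L \<beta> x assume x: "x \<in> space M" and f: "morrey_bound f L" and L: "0 < L"
    note [measurable] = f_measurable[OF f L]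
    have [measurable]: "P \<beta> x \<in> sets M" using x by auto
    let ?v = "\<lambda>k y. ennreal (\<bar>f y\<bar> powr s) * indicator {y. N powr (real_of_int k - 1) < \<bar>f y\<bar>} y"
    let ?c = "\<lambda>k :: int. ennreal (2 * N powr (k * (r - s)))"
    have "(\<integral>\<^sup>+k. ennreal (N powr (real_of_int k * r)) * emeasure M (level_set f \<beta> x k) \<partial>count_space UNIV)
        \<le> (\<integral>\<^sup>+k. ?c k * (\<integral>\<^sup>+y\<in>P \<beta> x. ?v k y \<partial>M) \<partial>count_space UNIV)"
    proof (rule nn_integral_mono)
      fix k :: int
      have "N powr (real_of_int k * r) = 2 * N powr (k * (r - s)) * (N powr (k * s) / 2)"
        by (simp add: right_diff_distrib flip: powr_add)
      then have "ennreal (N powr (real_of_int k * r)) = ?c k * ennreal (N powr (k * s) / 2)"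
        by (simp only:) (rule ennreal_mult, auto)
      then have "ennreal (N powr (real_of_int k * r)) * emeasure M (level_set f \<beta> x k)
          = ?c k * (ennreal (N powr (k * s) / 2) * emeasure M (level_set f \<beta> x k))"
        by (simp only: mult.assoc)
      also have "\<dots> \<le> ?c k * (\<integral>\<^sup>+y\<in>P \<beta> x. ?v k y \<partial>M)"
        by (rule mult_left_mono[OF level_set_emeasure_le[OF f L x]]) simp
      finally show "ennreal (N powr (real_of_int k * r)) * emeasure M (level_set f \<beta> x k) \<le> ?c k * (\<integral>\<^sup>+y\<in>P \<beta> x. ?v k y \<partial>M)" .
    qed
    also have "\<dots> = (\<integral>\<^sup>+k. (\<integral>\<^sup>+y. ?c k * (?v k y * indicator (P \<beta> x) y) \<partial>M) \<partial>count_space UNIV)"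
      by (intro nn_integral_cong nn_integral_cmult[symmetric]) measurable
    also have "\<dots> = (\<integral>\<^sup>+y. (\<integral>\<^sup>+k. ?c k * (?v k y * indicator (P \<beta> x) y) \<partial>count_space UNIV) \<partial>M)"
      by (rule nn_integral_count_space_nn_integral[symmetric]) auto
    also have "\<dots> \<le> (\<integral>\<^sup>+y. ennreal ?C * (ennreal (\<bar>f y\<bar> powr r) * indicator (P \<beta> x) y) \<partial>M)"
    proof (rule nn_integral_mono)
      fix y
      show "(\<integral>\<^sup>+k. ?c k * (?v k y * indicator (P \<beta> x) y) \<partial>count_space UNIV)
         \<le> ennreal ?C * (ennreal (\<bar>f y\<bar> powr r) * indicator (P \<beta> x) y)"
      proof (cases "f y = 0 \<or> y \<notin> P \<beta> x")
        case False
        then have f0: "0 < \<bar>f y\<bar>" by simp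
        have iff: "N powr (real_of_int k - 1) < \<bar>f y\<bar> \<longleftrightarrow> N powr real_of_int k < N * \<bar>f y\<bar>" for k
          using N_pos by (simp add: powr_diff field_simps)
        have "(\<integral>\<^sup>+k. ?c k * (?v k y * indicator (P \<beta> x) y) \<partial>count_space UNIV)
          = (\<integral>\<^sup>+k. ennreal (2 * \<bar>f y\<bar> powr s) * (ennreal (N powr (real_of_int k * (r - s))) * indicator {k. N powr real_of_int k < N * \<bar>f y\<bar>} k) \<partial>count_space UNIV)"
          using False by (intro nn_integral_cong) (auto simp: iff indicator_def mult_ac simp flip: ennreal_mult)
        also have "\<dots> = ennreal (2 * \<bar>f y\<bar> powr s) * (\<integral>\<^sup>+k. (ennreal (N powr (real_of_int k * (r - s))) * indicator {k. N powr real_of_int k < N * \<bar>f y\<bar>} k) \<partial>count_space UNIV)"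
          by (rule nn_integral_cmult) simp
        also have "\<dots> \<le> ennreal (2 * \<bar>f y\<bar> powr s) * ennreal (C * (N * \<bar>f y\<bar>) powr (r - s))"
          using f0 N_pos by (intro mult_left_mono geo) auto
        also have "\<dots> = ennreal (?C * (\<bar>f y\<bar> powr s * \<bar>f y\<bar> powr (r - s)))"
          using C N_pos by (subst ennreal_mult[symmetric]) (auto simp: powr_mult mult_ac)
        also have "\<bar>f y\<bar> powr s * \<bar>f y\<bar> powr (r - s) = \<bar>f y\<bar> powr r" by (simp flip: powr_add)
        also have "ennreal (?C * \<bar>f y\<bar> powr r) = ennreal ?C * (ennreal (\<bar>f y\<bar> powr r) * indicator (P \<beta> x) y)"
          using False C by (simp add: ennreal_mult)
        finally show ?thesis .
      qed auto
    qed
    also have "\<dots> = ennreal ?C * (\<integral>\<^sup>+y\<in>P \<beta> x. ennreal (\<bar>f y\<bar> powr r) \<partial>M)"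
      by (rule nn_integral_cmult) measurable
    also have "\<dots> \<le> ennreal ?C * ennreal (L powr r * N powr (\<beta> * l))"
      by (rule mult_left_mono[OF morrey_boundD[OF f L x]]) simp
    also have "\<dots> = ennreal (?C * L powr r * N powr (\<beta> * l))"
      using C by (simp add: mult.assoc flip: ennreal_mult)
    finally show "(\<integral>\<^sup>+k. ennreal (N powr (real_of_int k * r)) * emeasure M (level_set f \<beta> x k) \<partial>count_space UNIV)
      \<le> ennreal (?C * L powr r * N powr (\<beta> * l))" .
  qed
qed

text \<open>Hedberg's argument, organised by height. By the Morrey condition a mean of size about
  \<open>N powr k\<close> occurs only at scales below a threshold depending on \<open>k\<close>, so
  the factors \<open>N powr (g * (a * q))\<close> form a geometric sum controlled by that threshold.
  Interchanging the sums leaves the layer-cake sum for the \<open>r\<close>-th power of the maximal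
  function.\<close>

lemma scale_sum_pointwise_le:
  "\<exists>C>0. \<forall>f L \<beta>. \<forall>y\<in>space M. morrey_bound f L \<longrightarrow> 0 < L \<longrightarrow>
    (\<integral>\<^sup>+g. ennreal ((N powr (real_of_int g * a) * S f g y) powr q) * indicator {..\<beta>} g \<partial>count_space UNIV)
      \<le> ennreal (C * L powr (q - r)) *
        (\<integral>\<^sup>+k. ennreal (N powr (real_of_int k * r)) * indicator {k. \<exists>g\<le>\<beta>. N powr (real_of_int k) < S f g y} k \<partial>count_space UNIV)"
proof -
  have aq: "0 < a * q" using a_pos q_pos by simp
  obtain C where C: "0 < C" and geo: "\<And>T. 0 < T \<Longrightarrow>
      (\<integral>\<^sup>+k. ennreal (N powr (real_of_int k * (a * q))) * indicator {k. N powr real_of_int k < T} k \<partial>count_space UNIV)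
      \<le> ennreal (C * T powr (a * q))"
    using geometric_sum_below[OF N_gt_1 aq] by auto
  let ?C = "C * 2 powr (q - r) * N powr q"
  show ?thesis
  proof (intro exI[of _ ?C] conjI allI ballI impI)
    show "0 < ?C" using C N_pos by simp
    fix f L \<beta> y assume y: "y \<in> space M" and f: "morrey_bound f L" and L: "0 < L"
    \<comment> \<open>Solving \<open>N powr k < 2 * L * N powr (- (g * \<kappa>))\<close> for
      \<open>N powr g\<close> gives this threshold.\<close>
    define T where "T k = (2 * L * N powr (- k)) powr (1 / \<kappa>)" for k :: real
    have T: "0 < T k" for k using L N_pos by (simp add: T_def)
    let ?E = "{k. \<exists>g\<le>\<beta>. N powr (real_of_int k) < S f g y}"
    let ?h = "\<lambda>(k::int) (g::int). ennreal (N powr ((real_of_int k + 1) * q)) * indicator ?E k * (ennreal (N powr (real_of_int g * (a * q))) * indicator {g. N powr real_of_int g < T k} g)"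
    have "(\<integral>\<^sup>+g. ennreal ((N powr (real_of_int g * a) * S f g y) powr q) * indicator {..\<beta>} g \<partial>count_space UNIV)
      \<le> (\<integral>\<^sup>+g. (\<integral>\<^sup>+k. ?h k g \<partial>count_space UNIV) \<partial>count_space UNIV)"
    proof (rule nn_integral_mono)
      fix g :: int
      show "ennreal ((N powr (real_of_int g * a) * S f g y) powr q) * indicator {..\<beta>} g \<le> (\<integral>\<^sup>+k. ?h k g \<partial>count_space UNIV)"
      proof (cases "g \<le> \<beta> \<and> S f g y \<noteq> 0")
        case True
        then have S0: "0 < S f g y" using S_nonneg[of f g y] by linarith
        \<comment> \<open>The height bracket is
          \<open>N powr k < S f g y \<le> N powr (k + 1)\<close>; its strict lower bound matches
          \<open>level_set\<close>.\<close>
        define k where "k = \<lceil>log N (S f g y)\<rceil> - 1"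
        have "real_of_int k < log N (S f g y)" "log N (S f g y) \<le> real_of_int k + 1"
          unfolding k_def by linarith+
        then have k: "N powr k < S f g y" "S f g y \<le> N powr (real_of_int k + 1)"
          using N_gt_1 S0 by (simp_all add: less_log_iff log_le_iff)
        have "N powr k < 2 * L * N powr (- (g * \<kappa>))" using k(1) S_le[OF f L y, of g] by linarith
        then have lt: "N powr k * (N powr (- k) * N powr (g * \<kappa>)) < 2 * L * N powr (- (g * \<kappa>)) * (N powr (- k) * N powr (g * \<kappa>))"
          using N_pos by (intro mult_strict_right_mono) auto
        have e1: "N powr k * (N powr (- k) * N powr (g * \<kappa>)) = N powr (g * \<kappa>)"
          using N_pos by (simp add: powr_minus field_simps)
        have e2: "2 * L * N powr (- (g * \<kappa>)) * (N powr (- k) * N powr (g * \<kappa>)) = 2 * L * N powr (- k)"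
          using N_pos by (simp add: powr_minus field_simps)
        have "N powr (g * \<kappa>) < 2 * L * N powr (- k)" using lt unfolding e1 e2 .
        then have "(N powr (g * \<kappa>)) powr (1 / \<kappa>) < T k"
          unfolding T_def using kappa_pos by (intro powr_less_mono2) auto
        then have gT: "N powr g < T k" using kappa_pos by (simp add: powr_powr)
        have "(N powr (g * a) * S f g y) powr q \<le> (N powr (g * a) * N powr (real_of_int k + 1)) powr q"
          using k(2) q_pos S0 by (intro powr_mono2 mult_left_mono) auto
        also have "\<dots> = N powr ((real_of_int k + 1) * q) * N powr (g * (a * q))"
          by (simp add: powr_mult powr_powr mult_ac)
        finally have "ennreal ((N powr (real_of_int g * a) * S f g y) powr q) * indicator {..\<beta>} g \<le> ?h k g"
          using True k(1) gT by (auto simp: indicator_def simp flip: ennreal_mult intro!: ennreal_leI)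
        also have "\<dots> \<le> (\<integral>\<^sup>+k. ?h k g \<partial>count_space UNIV)" by (rule nn_integral_ge_point) simp
        finally show ?thesis .
      qed (auto simp: indicator_def)
    qed
    also have "\<dots> = (\<integral>\<^sup>+k. (\<integral>\<^sup>+g. ?h k g \<partial>count_space UNIV) \<partial>count_space UNIV)"
      by (rule nn_integral_count_space_nn_integral) auto
    also have "\<dots> \<le> (\<integral>\<^sup>+k. ennreal (?C * L powr (q - r)) * (ennreal (N powr (real_of_int k * r)) * indicator ?E k) \<partial>count_space UNIV)"
    proof (rule nn_integral_mono)
      fix k :: int
      have "(\<integral>\<^sup>+g. ?h k g \<partial>count_space UNIV) = ennreal (N powr ((real_of_int k + 1) * q)) * indicator ?E k *
         (\<integral>\<^sup>+g. (ennreal (N powr (real_of_int g * (a * q))) * indicator {g. N powr real_of_int g < T k} g) \<partial>count_space UNIV)"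
        by (rule nn_integral_cmult) simp
      also have "\<dots> \<le> ennreal (N powr ((real_of_int k + 1) * q)) * indicator ?E k * ennreal (C * T k powr (a * q))"
        by (intro mult_left_mono geo T) auto
      \<comment> \<open>By \<open>a_q\<close> the exponent of \<open>L\<close> becomes
        \<open>q - r\<close>, and the exponents \<open>q\<close> and \<open>- (q - r)\<close> of
        \<open>N powr k\<close> add up to \<open>r\<close>.\<close>
      also have "T k powr (a * q) = (2 * L * N powr (- k)) powr (q - r)"
        unfolding T_def a_q using kappa_pos by (simp add: powr_powr)
      also have "\<dots> = 2 powr (q - r) * L powr (q - r) * N powr (- k * (q - r))"
        using L by (simp add: powr_mult powr_powr)
      also have "ennreal (N powr ((real_of_int k + 1) * q)) * indicator ?E k * ennreal (C * (2 powr (q - r) * L powr (q - r) * N powr (- k * (q - r))))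
         = ennreal (C * 2 powr (q - r) * L powr (q - r) * (N powr ((real_of_int k + 1) * q) * N powr (- k * (q - r)))) * indicator ?E k"
        using C by (auto simp: indicator_def mult_ac simp flip: ennreal_mult)
      also have "N powr ((real_of_int k + 1) * q) * N powr (- k * (q - r)) = N powr q * N powr (k * r)"
        by (simp add: algebra_simps flip: powr_add)
      also have "ennreal (C * 2 powr (q - r) * L powr (q - r) * (N powr q * N powr (k * r))) * indicator ?E k
         = ennreal (?C * L powr (q - r)) * (ennreal (N powr (real_of_int k * r)) * indicator ?E k)"
        using C by (auto simp: indicator_def mult_ac simp flip: ennreal_mult)
      finally show "(\<integral>\<^sup>+g. ?h k g \<partial>count_space UNIV) \<le> ennreal (?C * L powr (q - r)) * (ennreal (N powr (real_of_int k * r)) * indicator ?E k)" .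
    qed
    also have "\<dots> = ennreal (?C * L powr (q - r)) * (\<integral>\<^sup>+k. (ennreal (N powr (real_of_int k * r)) * indicator ?E k) \<partial>count_space UNIV)"
      by (rule nn_integral_cmult) simp
    finally show "(\<integral>\<^sup>+g. ennreal ((N powr (real_of_int g * a) * S f g y) powr q) * indicator {..\<beta>} g \<partial>count_space UNIV)
      \<le> ennreal (?C * L powr (q - r)) * (\<integral>\<^sup>+k. (ennreal (N powr (real_of_int k * r)) * indicator ?E k) \<partial>count_space UNIV)" .
  qed
qed

text \<open>Integrating the pointwise estimate turns its indicator into the measure of a level set;
  the powers \<open>L powr (q - r)\<close> and \<open>L powr r\<close> of the two estimates multiply
  to \<open>L powr q\<close>.\<close>

lemma small_scales_le:
  "\<exists>C>0. \<forall>f L \<beta>. \<forall>x\<in>space M. morrey_bound f L \<longrightarrow> 0 < L \<longrightarrow>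
    (\<integral>\<^sup>+g. (\<integral>\<^sup>+y\<in>P \<beta> x. ennreal ((N powr (real_of_int g * a) * S f g y) powr q) \<partial>M) * indicator {..\<beta>} g \<partial>count_space UNIV)
      \<le> ennreal (C * L powr q * N powr (\<beta> * l))"
proof -
  obtain C1 where C1: "0 < C1" and le1: "\<And>f L \<beta> x. x \<in> space M \<Longrightarrow> morrey_bound f L \<Longrightarrow> 0 < L \<Longrightarrow>
    (\<integral>\<^sup>+k. ennreal (N powr (real_of_int k * r)) * emeasure M (level_set f \<beta> x k) \<partial>count_space UNIV)
      \<le> ennreal (C1 * L powr r * N powr (\<beta> * l))"
    using level_set_sum_le by blast
  obtain C2 where C2: "0 < C2" and le2: "\<And>f L \<beta> y. y \<in> space M \<Longrightarrow> morrey_bound f L \<Longrightarrow> 0 < L \<Longrightarrow>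
    (\<integral>\<^sup>+g. ennreal ((N powr (real_of_int g * a) * S f g y) powr q) * indicator {..\<beta>} g \<partial>count_space UNIV)
      \<le> ennreal (C2 * L powr (q - r)) *
        (\<integral>\<^sup>+k. ennreal (N powr (real_of_int k * r)) * indicator {k. \<exists>g\<le>\<beta>. N powr (real_of_int k) < S f g y} k \<partial>count_space UNIV)"
    using scale_sum_pointwise_le by blast
  show ?thesis
  proof (intro exI[of _ "C2 * C1"] conjI allI ballI impI)
    show "0 < C2 * C1" using C1 C2 by simp
    fix f L \<beta> x assume x: "x \<in> space M" and f: "morrey_bound f L" and L: "0 < L"
    have [measurable]: "P \<beta> x \<in> sets M" using x by auto
    note [measurable] = level_set_measurable[OF x]
    let ?u = "\<lambda>g y. ennreal ((N powr (real_of_int g * a) * S f g y) powr q)"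
    let ?c = "ennreal (C2 * L powr (q - r))"
    have "(\<integral>\<^sup>+g. (\<integral>\<^sup>+y\<in>P \<beta> x. ?u g y \<partial>M) * indicator {..\<beta>} g \<partial>count_space UNIV)
      = (\<integral>\<^sup>+g. (\<integral>\<^sup>+y. ?u g y * indicator (P \<beta> x) y * indicator {..\<beta>} g \<partial>M) \<partial>count_space UNIV)"
      by (intro nn_integral_cong nn_integral_multc[symmetric]) measurable
    also have "\<dots> = (\<integral>\<^sup>+y. (\<integral>\<^sup>+g. ?u g y * indicator (P \<beta> x) y * indicator {..\<beta>} g \<partial>count_space UNIV) \<partial>M)"
      by (rule nn_integral_count_space_nn_integral[symmetric]) auto
    also have "\<dots> \<le> (\<integral>\<^sup>+y. (\<integral>\<^sup>+k. ?c * (ennreal (N powr (real_of_int k * r)) * indicator (level_set f \<beta> x k) y) \<partial>count_space UNIV) \<partial>M)"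
    proof (rule nn_integral_mono)
      fix y assume y: "y \<in> space M"
      show "(\<integral>\<^sup>+g. ?u g y * indicator (P \<beta> x) y * indicator {..\<beta>} g \<partial>count_space UNIV)
        \<le> (\<integral>\<^sup>+k. ?c * (ennreal (N powr (real_of_int k * r)) * indicator (level_set f \<beta> x k) y) \<partial>count_space UNIV)"
      proof (cases "y \<in> P \<beta> x")
        case True
        then have ind: "indicator (level_set f \<beta> x k) y = (indicator {k. \<exists>g\<le>\<beta>. N powr (real_of_int k) < S f g y} k :: ennreal)" for k
          using y by (simp add: level_set_def indicator_def)
        show ?thesis using le2[OF y f L, of \<beta>] True by (simp add: ind nn_integral_cmult)
      qed simp
    qed
    also have "\<dots> = (\<integral>\<^sup>+k. (\<integral>\<^sup>+y. ?c * (ennreal (N powr (real_of_int k * r)) * indicator (level_set f \<beta> x k) y) \<partial>M) \<partial>count_space UNIV)"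
      by (rule nn_integral_count_space_nn_integral) auto
    also have "\<dots> = (\<integral>\<^sup>+k. ?c * (ennreal (N powr (real_of_int k * r)) * emeasure M (level_set f \<beta> x k)) \<partial>count_space UNIV)"
      by (simp add: nn_integral_cmult nn_integral_cmult_indicator)
    also have "\<dots> = ?c * (\<integral>\<^sup>+k. ennreal (N powr (real_of_int k * r)) * emeasure M (level_set f \<beta> x k) \<partial>count_space UNIV)"
      by (rule nn_integral_cmult) simp
    also have "\<dots> \<le> ?c * ennreal (C1 * L powr r * N powr (\<beta> * l))"
      by (rule mult_left_mono[OF le1[OF x f L]]) simp
    also have "\<dots> = ennreal (C2 * C1 * (L powr (q - r) * L powr r) * N powr (\<beta> * l))"
      using C1 C2 by (simp add: mult_ac flip: ennreal_mult)
    also have "L powr (q - r) * L powr r = L powr q" by (simp flip: powr_add)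
    finally show "(\<integral>\<^sup>+g. (\<integral>\<^sup>+y\<in>P \<beta> x. ?u g y \<partial>M) * indicator {..\<beta>} g \<partial>count_space UNIV)
      \<le> ennreal (C2 * C1 * L powr q * N powr (\<beta> * l))" .
  qed
qed

end

section \<open>Measurability of the maximal commutator and the drift of means between levels\<close>

context ball_space
begin

definition maxc :: "real \<Rightarrow> ('a \<Rightarrow> real) \<Rightarrow> ('a \<Rightarrow> real) \<Rightarrow> 'a \<Rightarrow> ennreal" where
  "maxc a b f x = (SUP g. ennreal (measure M (P g x) powr (a - 1))
      * (\<integral>\<^sup>+y\<in>P g x. ennreal (\<bar>b x - b y\<bar> * \<bar>f y\<bar>) \<partial>M))"

text \<open>The integral depends on \<open>x\<close> through the ball as well as through
  \<open>b x\<close>, so joint measurability is needed: the set of pairs with \<open>y\<close> in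
  \<open>P g x\<close> is a union of countably many squares of balls.\<close>

lemma maxc_measurable:
  assumes [measurable]: "b \<in> borel_measurable M" "f \<in> borel_measurable M"
  shows "maxc a b f \<in> borel_measurable M"
proof -
  interpret sigma_finite_measure M by (rule sigma_finite)
  have "(\<lambda>x. \<integral>\<^sup>+y\<in>P g x. ennreal (\<bar>b x - b y\<bar> * \<bar>f y\<bar>) \<partial>M) \<in> borel_measurable M" for g
  proof (rule borel_measurable_nn_integral)
    define B where "B = {z \<in> space (M \<Otimes>\<^sub>M M). snd z \<in> P g (fst z)}"
    have "B = (\<Union>p\<in>P g ` space M. p \<times> p)"
    proof (intro equalityI subsetI)
      fix z assume "z \<in> B"
      then have z: "fst z \<in> space M" "snd z \<in> P g (fst z)" by (auto simp: B_def space_pair_measure)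
      then have "z \<in> P g (fst z) \<times> P g (fst z)" using ball_refl[OF z(1), of g] by (cases z) simp
      then show "z \<in> (\<Union>p\<in>P g ` space M. p \<times> p)" using z(1) by blast
    next
      fix z assume "z \<in> (\<Union>p\<in>P g ` space M. p \<times> p)"
      then obtain x where x: "x \<in> space M" "fst z \<in> P g x" "snd z \<in> P g x" by auto
      then show "z \<in> B"
        using ball_eq[OF x(1,2)] ball_in_space[OF x(1,2)] ball_in_space[OF x(1,3)]
        by (cases z) (simp add: B_def space_pair_measure)
    qed
    also have "\<dots> \<in> sets (M \<Otimes>\<^sub>M M)"
      by (intro sets.countable_UN'' countable_balls) auto
    finally have B [measurable]: "B \<in> sets (M \<Otimes>\<^sub>M M)" .
    have "(\<lambda>(x, y). ennreal (\<bar>b x - b y\<bar> * \<bar>f y\<bar>) * indicator B (x, y)) \<in> borel_measurable (M \<Otimes>\<^sub>M M)"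
      by measurable
    also have "?this \<longleftrightarrow> (\<lambda>(x, y). ennreal (\<bar>b x - b y\<bar> * \<bar>f y\<bar>) * indicator (P g x) y) \<in> borel_measurable (M \<Otimes>\<^sub>M M)"
      by (intro measurable_cong) (auto simp: B_def indicator_def)
    finally show "(\<lambda>(x, y). ennreal (\<bar>b x - b y\<bar> * \<bar>f y\<bar>) * indicator (P g x) y) \<in> borel_measurable (M \<Otimes>\<^sub>M M)" .
  qed
  note [measurable] = this
  have [measurable]: "(\<lambda>x. measure M (P g x)) \<in> borel_measurable M" for g
    by (rule level_const_measurable[of g]) (use ball_eq in auto)
  show ?thesis unfolding maxc_def by measurable
qed

lemma avg_steps_le:
  assumes b: "loc_integrable b" "bmo_bound b K" "0 \<le> K" and x: "x \<in> space M"
  shows "\<bar>avg b g x - avg b (g + int n) x\<bar> \<le> real n * (N * K)"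
proof (induction n)
  case (Suc n)
  have "\<bar>avg b (g + int n) x - avg b (g + int (Suc n)) x\<bar> \<le> N * K"
    using avg_step_le[OF b x, of "g + int n"] by (simp add: add.commute add.left_commute)
  with Suc show ?case by (simp add: algebra_simps)
qed simp

end

context commutator
begin

text \<open>From level \<open>\<beta>\<close> to \<open>\<beta> + n\<close> the mean drifts by at
  most \<open>n * (N * K)\<close>, hence \<open>D\<close> grows polynomially in \<open>n\<close>.
  The constants are crude; what matters is the separation of \<open>n\<close> from the oscillation
  at level \<open>\<beta>\<close>.\<close>

lemma D_powr_le:
  assumes C: "0 \<le> C"
  shows "\<exists>J c. 0 < c \<and> (\<forall>\<beta> n. \<forall>x\<in>space M.
    D C (\<beta> + int n) x powr q \<le> c * (real n + 1) ^ J * (\<bar>b x - avg b \<beta> x\<bar> ^ J + 1))"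
proof -
  \<comment> \<open>As \<open>D\<close> is at least 1, the real exponent \<open>q\<close> may be
    rounded up to a natural number.\<close>
  define m where "m = nat \<lceil>q\<rceil>"
  have mq: "q \<le> real m" unfolding m_def using q_pos by simp
  define c0 where "c0 = 2 ^ t * (1 + C) + 1"
  have c0: "0 < c0" using C by (simp add: c0_def add_nonneg_pos)
  define NK where "NK = N * K"
  have NK: "0 < NK" using N_pos K_pos by (simp add: NK_def)
  define c where "c = c0 ^ m * 2 ^ m * (2 ^ (t * m) * (1 + NK ^ (t * m)) + 1)"
  have c: "0 < c" unfolding c_def using c0 NK by (intro mult_pos_pos add_nonneg_pos) auto
  show ?thesis
  proof (intro exI[of _ "t * m"] exI[of _ c] conjI allI ballI c)
    fix \<beta> n x assume x: "x \<in> space M"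
    define w where "w = \<bar>b x - avg b \<beta> x\<bar>"
    define w' where "w' = \<bar>b x - avg b (\<beta> + int n) x\<bar>"
    have w0: "0 \<le> w" "0 \<le> w'" by (auto simp: w_def w'_def)
    have "w' \<le> w + real n * NK"
      using avg_steps_le[OF b less_imp_le[OF K_pos] x, of \<beta> n] unfolding w_def w'_def NK_def by linarith
    also have "\<dots> \<le> (real n + 1) * (w + NK)" using w0 NK by (simp add: algebra_simps)
    finally have "w' ^ t \<le> ((real n + 1) * (w + NK)) ^ t" using w0 by (intro power_mono)
    then have wt: "w' ^ t \<le> (real n + 1) ^ t * (w + NK) ^ t" by (simp add: power_mult_distrib)
    have n1: "1 \<le> (real n + 1) ^ t" by simp
    have W: "0 \<le> (w + NK) ^ t" using w0 NK by simp
    have D1: "1 \<le> D C (\<beta> + int n) x" using C by (simp add: D_def)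
    have "D C (\<beta> + int n) x = 2 ^ t * w' ^ t + (2 ^ t * C + 1)" by (simp add: D_def w'_def algebra_simps)
    also have "\<dots> \<le> 2 ^ t * ((real n + 1) ^ t * (w + NK) ^ t) + (2 ^ t * C + 1) * (real n + 1) ^ t"
    proof (intro add_mono mult_left_mono wt)
      have "(2 ^ t * C + 1) * 1 \<le> (2 ^ t * C + 1) * (real n + 1) ^ t"
        using C by (intro mult_left_mono n1) auto
      then show "2 ^ t * C + 1 \<le> (2 ^ t * C + 1) * (real n + 1) ^ t" by simp
    qed simp
    also have "\<dots> = (real n + 1) ^ t * (2 ^ t * (w + NK) ^ t + (2 ^ t * C + 1))" by (simp add: algebra_simps)
    also have "\<dots> \<le> (real n + 1) ^ t * (c0 * (w + NK) ^ t + c0 * 1)"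
    proof (intro mult_left_mono add_mono mult_right_mono W)
      show "2 ^ t \<le> c0" "2 ^ t * C + 1 \<le> c0 * 1" using C by (simp_all add: c0_def algebra_simps)
    qed simp
    finally have "D C (\<beta> + int n) x \<le> c0 * (real n + 1) ^ t * ((w + NK) ^ t + 1)" by (simp add: algebra_simps)
    then have "D C (\<beta> + int n) x ^ m \<le> (c0 * (real n + 1) ^ t * ((w + NK) ^ t + 1)) ^ m"
      using D1 by (intro power_mono) auto
    also have "\<dots> = c0 ^ m * (real n + 1) ^ (t * m) * ((w + NK) ^ t + 1) ^ m"
      by (simp add: power_mult_distrib power_mult)
    also have "\<dots> \<le> c0 ^ m * (real n + 1) ^ (t * m) * (2 ^ m * (((w + NK) ^ t) ^ m + 1 ^ m))"
      using c0 W by (intro mult_left_mono power_sum_le) auto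
    also have "\<dots> = c0 ^ m * (real n + 1) ^ (t * m) * (2 ^ m * ((w + NK) ^ (t * m) + 1))"
      by (simp add: power_mult)
    also have "\<dots> \<le> c0 ^ m * (real n + 1) ^ (t * m) * (2 ^ m * ((2 ^ (t * m) * (1 + NK ^ (t * m)) + 1) * (w ^ (t * m) + 1)))"
    proof (intro mult_left_mono)
      have "(w + NK) ^ (t * m) + 1 \<le> 2 ^ (t * m) * (w ^ (t * m) + NK ^ (t * m)) + 1"
        using w0 NK by (intro add_mono power_sum_le) auto
      also have "\<dots> \<le> 2 ^ (t * m) * ((1 + NK ^ (t * m)) * (w ^ (t * m) + 1)) + (w ^ (t * m) + 1)"
      proof (intro add_mono mult_left_mono)
        have "(1 + NK ^ (t * m)) * (w ^ (t * m) + 1) = w ^ (t * m) + NK ^ (t * m) + (1 + NK ^ (t * m) * w ^ (t * m))"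
          by (simp add: algebra_simps)
        then show "w ^ (t * m) + NK ^ (t * m) \<le> (1 + NK ^ (t * m)) * (w ^ (t * m) + 1)"
          using w0 NK by simp
      qed (use w0 in auto)
      also have "\<dots> = (2 ^ (t * m) * (1 + NK ^ (t * m)) + 1) * (w ^ (t * m) + 1)" by (simp add: algebra_simps)
      finally show "(w + NK) ^ (t * m) + 1 \<le> (2 ^ (t * m) * (1 + NK ^ (t * m)) + 1) * (w ^ (t * m) + 1)" .
    qed (use c0 in auto)
    also have "\<dots> = c * (real n + 1) ^ (t * m) * (w ^ (t * m) + 1)" by (simp add: c_def)
    finally have "D C (\<beta> + int n) x ^ m \<le> c * (real n + 1) ^ (t * m) * (w ^ (t * m) + 1)" .
    moreover have "D C (\<beta> + int n) x powr q \<le> D C (\<beta> + int n) x ^ m"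
    proof -
      have "D C (\<beta> + int n) x powr q \<le> D C (\<beta> + int n) x powr real m" using D1 mq by (intro powr_mono) auto
      then show ?thesis using D1 by (simp add: powr_realpow)
    qed
    ultimately show "D C (\<beta> + int n) x powr q \<le> c * (real n + 1) ^ (t * m) * (\<bar>b x - avg b \<beta> x\<bar> ^ (t * m) + 1)"
      unfolding w_def by linarith
  qed
qed

text \<open>For \<open>n = 0\<close> this is the bounded mean of the oscillation factor over a ball
  of its own level; for \<open>n > 0\<close> it controls the scales above the test ball.\<close>

lemma D_integral_le:
  assumes C: "0 \<le> C"
  shows "\<exists>J c. 0 < c \<and> (\<forall>\<beta> n. \<forall>x\<in>space M.
    (\<integral>\<^sup>+y\<in>P \<beta> x. ennreal (D C (\<beta> + int n) y powr q) \<partial>M) \<le> ennreal (c * (real n + 1) ^ J * N powr \<beta>))"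
proof -
  obtain J c where c: "0 < c" and le: "\<And>\<beta> n x. x \<in> space M \<Longrightarrow>
    D C (\<beta> + int n) x powr q \<le> c * (real n + 1) ^ J * (\<bar>b x - avg b \<beta> x\<bar> ^ J + 1)"
    using D_powr_le[OF C] by blast
  obtain CJ where CJ: "0 < CJ" and mom: "\<And>g x. x \<in> space M \<Longrightarrow>
      (\<integral>\<^sup>+y\<in>P g x. ennreal (\<bar>b y - avg b g x\<bar> ^ J) \<partial>M) \<le> ennreal (CJ * N powr g)"
    using bmo_moments[OF b K_pos, of J] by blast
  show ?thesis
  proof (intro exI[of _ J] exI[of _ "c * (1 + CJ)"] conjI allI ballI)
    show "0 < c * (1 + CJ)" using c CJ by simp
    fix \<beta> n x assume x: "x \<in> space M"
    let ?d = "c * (real n + 1) ^ J"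
    have d: "0 \<le> ?d" using c by simp
    have eq: "ennreal e + ennreal e * ennreal u = ennreal (e * (u + 1))" if "0 \<le> e" "0 \<le> u" for e u
      unfolding ennreal_mult[OF that, symmetric] ennreal_plus[OF that(1) mult_nonneg_nonneg[OF that], symmetric]
      by (simp add: algebra_simps)
    have "(\<integral>\<^sup>+y\<in>P \<beta> x. ennreal (D C (\<beta> + int n) y powr q) \<partial>M)
      \<le> (\<integral>\<^sup>+y\<in>P \<beta> x. (ennreal ?d + ennreal ?d * ennreal (\<bar>b y - avg b \<beta> x\<bar> ^ J)) \<partial>M)"
    proof (rule nn_integral_ball_mono[OF order_refl])
      fix y assume y: "y \<in> P \<beta> x"
      have "D C (\<beta> + int n) y powr q \<le> ?d * (\<bar>b y - avg b \<beta> x\<bar> ^ J + 1)"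
        using le[OF ball_in_space[OF x y], of \<beta> n] unfolding avg_ball[OF x y] .
      then show "ennreal (D C (\<beta> + int n) y powr q) \<le> ennreal ?d + ennreal ?d * ennreal (\<bar>b y - avg b \<beta> x\<bar> ^ J)"
        using eq[OF d, of "\<bar>b y - avg b \<beta> x\<bar> ^ J"] by (simp add: ennreal_leI)
    qed
    also have "\<dots> \<le> ennreal ((?d + ?d * CJ) * N powr \<beta>)"
      using d CJ by (intro set_nn_integral_ball_const_plus[OF x _ _ _ _ mom[OF x]]) auto
    also have "(?d + ?d * CJ) * N powr \<beta> = c * (1 + CJ) * (real n + 1) ^ J * N powr \<beta>" by (simp add: algebra_simps)
    finally show "(\<integral>\<^sup>+y\<in>P \<beta> x. ennreal (D C (\<beta> + int n) y powr q) \<partial>M) \<le> ennreal (c * (1 + CJ) * (real n + 1) ^ J * N powr \<beta>)" .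
  qed
qed

lemma maxc_morrey_bound:
  "\<exists>C>0. \<forall>f L \<beta>. \<forall>x\<in>space M. morrey_bound f L \<longrightarrow> 0 < L \<longrightarrow>
    (\<integral>\<^sup>+y\<in>P \<beta> x. epowr (maxc a b f y) q \<partial>M) \<le> ennreal (C * L powr q * N powr (\<beta> * l))"
proof -
  obtain Ct where Ct: "0 < Ct" and mom: "\<And>g x. x \<in> space M \<Longrightarrow>
      (\<integral>\<^sup>+y\<in>P g x. ennreal (\<bar>b y - avg b g x\<bar> ^ t) \<partial>M) \<le> ennreal (Ct * N powr g)"
    using bmo_moments[OF b K_pos, of t] by blast
  obtain J c where c: "0 < c" and Dle: "\<And>\<beta> n x. x \<in> space M \<Longrightarrow>
    (\<integral>\<^sup>+y\<in>P \<beta> x. ennreal (D Ct (\<beta> + int n) y powr q) \<partial>M) \<le> ennreal (c * (real n + 1) ^ J * N powr \<beta>)"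
    using D_integral_le[OF less_imp_le[OF Ct]] by blast
  obtain C1 where C1: "0 < C1" and small: "\<And>f L \<beta> x. x \<in> space M \<Longrightarrow> morrey_bound f L \<Longrightarrow> 0 < L \<Longrightarrow>
    (\<integral>\<^sup>+g. (\<integral>\<^sup>+y\<in>P \<beta> x. ennreal ((N powr (real_of_int g * a) * S f g y) powr q) \<partial>M) * indicator {..\<beta>} g \<partial>count_space UNIV)
      \<le> ennreal (C1 * L powr q * N powr (\<beta> * l))"
    using small_scales_le by blast
  \<comment> \<open>The gain per level above the test ball, where \<open>G g y powr q\<close> is of
    order \<open>N powr (- (g * (1 - l)))\<close>.\<close>
  define \<rho> where "\<rho> = N powr (l - 1)"
  have \<rho>: "0 < \<rho>" "\<rho> < 1" using N_pos N_gt_1 l_less_1 powr_less_mono[of "l - 1" 0 N] by (auto simp: \<rho>_def)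
  define d where "d n = (real n + 1) ^ J * \<rho> ^ n" for n
  have d: "summable d" unfolding d_def by (rule summable_poly_geometric[OF \<rho>])
  have d0: "0 < d n" for n using \<rho> by (simp add: d_def)
  then have d_suc: "summable (\<lambda>i. d (Suc i))" using d by (simp add: summable_Suc_iff)
  have d0': "0 \<le> (\<Sum>i. d (Suc i))" using d0 by (intro suminf_nonneg d_suc less_imp_le)
  let ?C = "c * C1 + c * 2 powr q * (\<Sum>i. d (Suc i))"
  show ?thesis
  proof (intro exI[of _ ?C] conjI allI ballI impI)
    show "0 < ?C" using c C1 d0' by (intro add_pos_nonneg) auto
    fix f L \<beta> x assume x: "x \<in> space M" and f: "morrey_bound f L" and L: "0 < L"
    note [measurable] = f_measurable[OF f L]
    have [measurable]: "P g y \<in> sets M" if "y \<in> space M" for g y using that by auto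
    note [measurable] = ball_sets[OF x, of \<beta>]
    have D0: "0 \<le> D Ct g y" for g y using Ct by (simp add: D_def)
    define G where "G g y = N powr (real_of_int g * a) * S f g y" for g y
    have [measurable]: "G g \<in> borel_measurable M" for g unfolding G_def by measurable
    have G0: "0 \<le> G g y" for g y by (simp add: G_def)
    have G_ball: "G g z = G g y" if "y \<in> space M" "z \<in> P g y" for g y z
      using S_ball[OF that] by (simp add: G_def)
    define I where "I g = (\<integral>\<^sup>+y\<in>P \<beta> x. ennreal ((D Ct g y * G g y) powr q) \<partial>M)" for g
    \<comment> \<open>The weight of the ball and the measure from averaging combine to
      \<open>N powr (g * a)\<close>, leaving at each scale the product of oscillation factor and
      scaled mean.\<close>
    have pw: "maxc a b f y \<le> (SUP g. ennreal (D Ct g y * G g y))" if y: "y \<in> space M" for y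
      unfolding maxc_def
    proof (rule SUP_mono')
      fix g
      have "ennreal (measure M (P g y) powr (a - 1)) * (\<integral>\<^sup>+z\<in>P g y. ennreal (\<bar>b y - b z\<bar> * \<bar>f z\<bar>) \<partial>M)
         \<le> ennreal (measure M (P g y) powr (a - 1)) * ennreal (S f g y * D Ct g y * N powr g)"
        by (rule mult_left_mono[OF commutator_mean_le[OF f L y less_imp_le[OF Ct] mom[OF y]]]) simp
      also have "\<dots> = ennreal (N powr (g * (a - 1)) * (S f g y * D Ct g y * N powr g))"
        using D0 by (simp add: measure_ball[OF y] powr_powr flip: ennreal_mult)
      also have "N powr (g * (a - 1)) * (S f g y * D Ct g y * N powr g) = D Ct g y * (N powr (g * (a - 1)) * N powr g * S f g y)"
        by simp
      also have "N powr (g * (a - 1)) * N powr g = N powr (g * a)"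
        by (simp add: algebra_simps flip: powr_add)
      finally show "ennreal (measure M (P g y) powr (a - 1)) * (\<integral>\<^sup>+z\<in>P g y. ennreal (\<bar>b y - b z\<bar> * \<bar>f z\<bar>) \<partial>M)
          \<le> ennreal (D Ct g y * G g y)" by (simp add: G_def)
    qed
    have "(\<integral>\<^sup>+y\<in>P \<beta> x. epowr (maxc a b f y) q \<partial>M)
      \<le> (\<integral>\<^sup>+y. (\<integral>\<^sup>+g. ennreal ((D Ct g y * G g y) powr q) * indicator (P \<beta> x) y \<partial>count_space UNIV) \<partial>M)"
    proof (rule nn_integral_mono)
      fix y assume y: "y \<in> space M"
      have "epowr (maxc a b f y) q \<le> epowr (SUP g. ennreal (D Ct g y * G g y)) q"
        using pw[OF y] q_pos by (intro epowr_mono) auto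
      also have "\<dots> \<le> (\<integral>\<^sup>+g. ennreal ((D Ct g y * G g y) powr q) \<partial>count_space UNIV)"
        using D0 G0 q_pos by (intro epowr_SUP_le) auto
      finally show "epowr (maxc a b f y) q * indicator (P \<beta> x) y
          \<le> (\<integral>\<^sup>+g. ennreal ((D Ct g y * G g y) powr q) * indicator (P \<beta> x) y \<partial>count_space UNIV)"
        by (simp add: indicator_def)
    qed
    also have "\<dots> = (\<integral>\<^sup>+g. I g \<partial>count_space UNIV)"
      unfolding I_def by (rule nn_integral_count_space_nn_integral) auto
    also have "\<dots> = (\<integral>\<^sup>+g. I g * indicator {..\<beta>} g + I g * indicator {\<beta><..} g \<partial>count_space UNIV)"
      by (intro nn_integral_cong) (auto simp: indicator_def)
    also have "\<dots> = (\<integral>\<^sup>+g. I g * indicator {..\<beta>} g \<partial>count_space UNIV) + (\<integral>\<^sup>+g. I g * indicator {\<beta><..} g \<partial>count_space UNIV)"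
      by (rule nn_integral_add) auto
    also have "(\<integral>\<^sup>+g. I g * indicator {..\<beta>} g \<partial>count_space UNIV) \<le> ennreal (c * C1 * L powr q * N powr (\<beta> * l))"
    proof -
      have "I g \<le> ennreal c * (\<integral>\<^sup>+y\<in>P \<beta> x. ennreal (G g y powr q) \<partial>M)" if g: "g \<le> \<beta>" for g
      proof -
        have "I g \<le> (\<integral>\<^sup>+y\<in>P \<beta> x. (ennreal c * ennreal (G g y powr q)) \<partial>M)"
          unfolding I_def
        proof (rule nn_integral_ball_partition_le[OF _ _ x g])
          fix y assume "y \<in> P \<beta> x"
          then have y: "y \<in> space M" by (rule ball_in_space[OF x])
          note [measurable] = ball_sets[OF y, of g]
          have "(\<integral>\<^sup>+z\<in>P g y. ennreal ((D Ct g z * G g z) powr q) \<partial>M)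
              = (\<integral>\<^sup>+z. ennreal (G g y powr q) * (ennreal (D Ct g z powr q) * indicator (P g y) z) \<partial>M)"
            by (intro nn_integral_cong)
               (auto simp: indicator_def G_ball[OF y] powr_mult D0 G0 mult.commute simp flip: ennreal_mult)
          also have "\<dots> = ennreal (G g y powr q) * (\<integral>\<^sup>+z\<in>P g y. ennreal (D Ct g z powr q) \<partial>M)"
            by (rule nn_integral_cmult) measurable
          also have "\<dots> \<le> ennreal (G g y powr q) * ennreal (c * N powr g)"
            using Dle[OF y, of g 0] by (intro mult_left_mono) auto
          also have "\<dots> = ennreal (c * G g y powr q * N powr g)" using c by (simp add: mult_ac flip: ennreal_mult)
          also have "\<dots> = (\<integral>\<^sup>+z\<in>P g y. ennreal (c * G g y powr q) \<partial>M)"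
            using c by (intro set_nn_integral_const[OF y, symmetric]) auto
          also have "\<dots> = (\<integral>\<^sup>+z\<in>P g y. (ennreal c * ennreal (G g z powr q)) \<partial>M)"
            using c by (intro nn_integral_cong) (auto simp: indicator_def G_ball[OF y] ennreal_mult)
          finally show "(\<integral>\<^sup>+z\<in>P g y. ennreal ((D Ct g z * G g z) powr q) \<partial>M)
            \<le> (\<integral>\<^sup>+z\<in>P g y. (ennreal c * ennreal (G g z powr q)) \<partial>M)" .
        qed measurable
        also have "\<dots> = ennreal c * (\<integral>\<^sup>+y\<in>P \<beta> x. ennreal (G g y powr q) \<partial>M)"
          unfolding mult.assoc by (rule nn_integral_cmult) measurable
        finally show ?thesis .
      qed
      then have "(\<integral>\<^sup>+g. I g * indicator {..\<beta>} g \<partial>count_space UNIV)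
          \<le> (\<integral>\<^sup>+g. ennreal c * ((\<integral>\<^sup>+y\<in>P \<beta> x. ennreal (G g y powr q) \<partial>M) * indicator {..\<beta>} g) \<partial>count_space UNIV)"
        by (intro nn_integral_mono) (auto simp: indicator_def)
      also have "\<dots> = ennreal c * (\<integral>\<^sup>+g. (\<integral>\<^sup>+y\<in>P \<beta> x. ennreal (G g y powr q) \<partial>M) * indicator {..\<beta>} g \<partial>count_space UNIV)"
        by (rule nn_integral_cmult) simp
      also have "\<dots> \<le> ennreal c * ennreal (C1 * L powr q * N powr (\<beta> * l))"
        unfolding G_def by (rule mult_left_mono[OF small[OF x f L]]) simp
      also have "\<dots> = ennreal (c * C1 * L powr q * N powr (\<beta> * l))"
        using c C1 by (simp add: mult_ac flip: ennreal_mult)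
      finally show ?thesis .
    qed
    also have "(\<integral>\<^sup>+g. I g * indicator {\<beta><..} g \<partial>count_space UNIV)
        \<le> ennreal (c * 2 powr q * (\<Sum>i. d (Suc i)) * L powr q * N powr (\<beta> * l))"
    proof -
      \<comment> \<open>Large scales are numbered from \<open>Suc i\<close>, since level
        \<open>\<beta>\<close> itself belongs to the small ones.\<close>
      have bij: "bij_betw (\<lambda>i::nat. \<beta> + int (Suc i)) UNIV {\<beta><..}"
        by (rule bij_betw_byWitness[where f' = "\<lambda>g. nat (g - \<beta> - 1)"]) auto
      let ?e = "c * 2 powr q * L powr q * N powr (\<beta> * l)"
      have "(\<integral>\<^sup>+g. I g * indicator {\<beta><..} g \<partial>count_space UNIV) = (\<integral>\<^sup>+g. I g \<partial>count_space {\<beta><..})"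
        by (subst nn_integral_count_space_indicator) auto
      also have "\<dots> = (\<Sum>i. I (\<beta> + int (Suc i)))"
        by (subst nn_integral_bij_count_space[OF bij, symmetric]) (rule nn_integral_count_space_nat)
      also have "\<dots> \<le> (\<Sum>i. ennreal (?e * d (Suc i)))"
      proof (intro suminf_le summableI)
        fix i
        define n where "n = Suc i"
        let ?g = "\<beta> + int n"
        \<comment> \<open>A bound for \<open>G ?g y powr q\<close> uniform in \<open>y\<close>; the
          exponent \<open>1 - l\<close> is \<open>(\<kappa> - a) * q\<close>.\<close>
        define h where "h = 2 powr q * L powr q * N powr (- ?g * (1 - l))"
        have Gq: "G ?g y powr q \<le> h" if y: "y \<in> space M" for y
        proof -
          have "G ?g y \<le> N powr (?g * a) * (2 * L * N powr (- (?g * \<kappa>)))"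
            unfolding G_def using S_le[OF f L y, of ?g] by (intro mult_left_mono) auto
          also have "\<dots> = 2 * L * (N powr (?g * a) * N powr (- (?g * \<kappa>)))" by simp
          also have "N powr (?g * a) * N powr (- (?g * \<kappa>)) = N powr (- ?g * (\<kappa> - a))"
            by (simp add: algebra_simps flip: powr_add)
          finally have "G ?g y powr q \<le> (2 * L * N powr (- ?g * (\<kappa> - a))) powr q"
            using G0 q_pos by (intro powr_mono2) auto
          also have "\<dots> = 2 powr q * L powr q * N powr (- ?g * ((\<kappa> - a) * q))"
            using L by (simp add: powr_mult powr_powr mult.assoc)
          finally show ?thesis unfolding kappa_a_q h_def .
        qed
        have h0: "0 \<le> h" by (simp add: h_def)
        have "I ?g \<le> (\<integral>\<^sup>+y. ennreal h * (ennreal (D Ct ?g y powr q) * indicator (P \<beta> x) y) \<partial>M)"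
          unfolding I_def
        proof (rule nn_integral_mono)
          fix y assume y: "y \<in> space M"
          have "(D Ct ?g y * G ?g y) powr q = D Ct ?g y powr q * G ?g y powr q"
            using D0 G0 by (simp add: powr_mult)
          also have "\<dots> \<le> D Ct ?g y powr q * h" using Gq[OF y] by (intro mult_left_mono) auto
          finally show "ennreal ((D Ct ?g y * G ?g y) powr q) * indicator (P \<beta> x) y
              \<le> ennreal h * (ennreal (D Ct ?g y powr q) * indicator (P \<beta> x) y)"
            using h0 by (auto simp: indicator_def mult.commute simp flip: ennreal_mult intro!: ennreal_leI)
        qed
        also have "\<dots> = ennreal h * (\<integral>\<^sup>+y\<in>P \<beta> x. ennreal (D Ct ?g y powr q) \<partial>M)"
          by (rule nn_integral_cmult) measurable
        also have "\<dots> \<le> ennreal h * ennreal (c * (real n + 1) ^ J * N powr \<beta>)"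
          by (rule mult_left_mono[OF Dle[OF x]]) simp
        also have "\<dots> = ennreal (h * (c * (real n + 1) ^ J * N powr \<beta>))"
          using h0 c by (simp flip: ennreal_mult)
        also have "h * (c * (real n + 1) ^ J * N powr \<beta>) = c * 2 powr q * L powr q * (real n + 1) ^ J * (N powr (- ?g * (1 - l)) * N powr \<beta>)"
          by (simp add: h_def)
        also have "N powr (- ?g * (1 - l)) * N powr \<beta> = N powr (\<beta> * l) * N powr ((l - 1) * real n)"
          by (simp add: algebra_simps flip: powr_add)
        also have "N powr ((l - 1) * real n) = \<rho> ^ n"
          unfolding \<rho>_def using N_pos by (simp add: powr_powr flip: powr_realpow)
        also have "c * 2 powr q * L powr q * (real n + 1) ^ J * (N powr (\<beta> * l) * \<rho> ^ n) = ?e * d n"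
          by (simp add: d_def)
        finally show "I (\<beta> + int (Suc i)) \<le> ennreal (?e * d (Suc i))" unfolding n_def .
      qed
      also have "\<dots> = ennreal (\<Sum>i. ?e * d (Suc i))"
        using c d0 by (intro suminf_ennreal2 summable_mult d_suc mult_nonneg_nonneg) (auto simp: less_imp_le)
      also have "(\<Sum>i. ?e * d (Suc i)) = c * 2 powr q * (\<Sum>i. d (Suc i)) * L powr q * N powr (\<beta> * l)"
        by (subst suminf_mult[OF d_suc]) simp
      finally show ?thesis .
    qed
    also have "ennreal (c * C1 * L powr q * N powr (\<beta> * l)) + ennreal (c * 2 powr q * (\<Sum>i. d (Suc i)) * L powr q * N powr (\<beta> * l))
       = ennreal (?C * L powr q * N powr (\<beta> * l))"
      using c C1 d0' by (simp add: algebra_simps flip: ennreal_plus)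
    finally show "(\<integral>\<^sup>+y\<in>P \<beta> x. epowr (maxc a b f y) q \<partial>M) \<le> ennreal (?C * L powr q * N powr (\<beta> * l))"
      by (simp add: add_mono)
  qed
qed

end

section \<open>Morrey norms and BMO as inequalities on balls\<close>

lemma epowr_root_le_iff:
  assumes "0 < q" "0 \<le> L"
  shows "epowr z (1 / q) \<le> ennreal L \<longleftrightarrow> z \<le> ennreal (L powr q)"
proof (cases z)
  case (real u)
  have "u powr (1 / q) \<le> L \<longleftrightarrow> u \<le> L powr q"
  proof
    assume "u powr (1 / q) \<le> L"
    then have "(u powr (1 / q)) powr q \<le> L powr q" using assms by (intro powr_mono2) auto
    then show "u \<le> L powr q" using assms real by (simp add: powr_powr)
  next
    assume "u \<le> L powr q"
    then have "u powr (1 / q) \<le> (L powr q) powr (1 / q)" using assms real by (intro powr_mono2) auto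
    then show "u powr (1 / q) \<le> L" using assms by (simp add: powr_powr)
  qed
  then show ?thesis using real assms by simp
qed (simp add: epowr_def top_unique)

text \<open>Replaces a norm by arbitrary positive real upper bounds \<open>L\<close>, so that a
  vanishing or infinite norm needs no treatment of its own later; the norm itself is approached
  through the bounds \<open>u + e / C\<close>.\<close>

lemma ennreal_le_cmultI:
  assumes "0 < C" and le: "\<And>L. 0 < L \<Longrightarrow> A \<le> ennreal L \<Longrightarrow> B \<le> ennreal (C * L)"
  shows "B \<le> ennreal C * A"
proof (cases A)
  case (real u)
  show ?thesis
  proof (rule ennreal_le_epsilon)
    fix e :: real assume e: "0 < e"
    have "B \<le> ennreal (C * (u + e / C))"
      using real e \<open>0 < C\<close> by (intro le) (auto intro!: add_nonneg_pos ennreal_leI)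
    also have "C * (u + e / C) = C * u + e" using \<open>0 < C\<close> by (simp add: field_simps)
    also have "ennreal (C * u + e) = ennreal C * A + ennreal e"
      using real e \<open>0 < C\<close> by (simp add: ennreal_mult)
    finally show "B \<le> ennreal C * A + ennreal e" .
  qed
qed (use assms in \<open>simp add: ennreal_mult_top\<close>)

context ball_space
begin

definition mnorm :: "real \<Rightarrow> real \<Rightarrow> ('a \<Rightarrow> ennreal) \<Rightarrow> ennreal" where
  "mnorm q l h = epowr (SUP (g, x)\<in>UNIV \<times> space M.
      ennreal (measure M (P g x) powr (- l)) * (\<integral>\<^sup>+y\<in>P g x. epowr (h y) q \<partial>M)) (1 / q)"

definition maxc_bounded :: "real \<Rightarrow> ('a \<Rightarrow> real) \<Rightarrow> real \<Rightarrow> real \<Rightarrow> real \<Rightarrow> real \<Rightarrow> bool" where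
  "maxc_bounded a b r l q l' \<longleftrightarrow> (\<exists>C\<ge>0. \<forall>f. f \<in> borel_measurable M \<and> mnorm r l (\<lambda>y. ennreal \<bar>f y\<bar>) < \<infinity> \<longrightarrow>
      maxc a b f \<in> borel_measurable M \<and>
      mnorm q l' (maxc a b f) \<le> ennreal C * mnorm r l (\<lambda>y. ennreal \<bar>f y\<bar>))"

text \<open>Trades the supremum and the root for an estimate on every ball, in the shape of
  \<open>morrey_bound\<close>.\<close>

lemma mnorm_le_iff:
  assumes "0 < q" "0 \<le> L"
  shows "mnorm q l h \<le> ennreal L \<longleftrightarrow>
    (\<forall>g. \<forall>x\<in>space M. (\<integral>\<^sup>+y\<in>P g x. epowr (h y) q \<partial>M) \<le> ennreal (L powr q * N powr (g * l)))"
proof -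
  have iff: "ennreal (measure M (P g x) powr (- l)) * I \<le> ennreal (L powr q) \<longleftrightarrow> I \<le> ennreal (L powr q * N powr (g * l))"
    if x: "x \<in> space M" for g x I
  proof -
    have c: "ennreal (measure M (P g x) powr (- l)) = ennreal (N powr (- (g * l)))"
      by (simp add: measure_ball[OF x] powr_powr)
    have inv: "N powr (- (g * l)) * N powr (g * l) = 1"
      using N_pos by (simp flip: powr_add)
    show ?thesis
    proof (cases I)
      case (real u)
      have "N powr (- (g * l)) * u \<le> L powr q \<longleftrightarrow> u \<le> L powr q * N powr (g * l)"
        using N_pos by (simp add: powr_minus field_simps)
      then show ?thesis using real by (simp add: c flip: ennreal_mult)
    next
      case top
      then show ?thesis using N_pos unfolding c by (simp add: ennreal_mult_top top_unique)
    qed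
  qed
  show ?thesis
    unfolding mnorm_def epowr_root_le_iff[OF assms] using iff by (auto simp: SUP_le_iff)
qed

lemma bmo_iff:
  assumes b: "loc_integrable b"
  shows "(\<exists>C. \<forall>g. \<forall>x\<in>space M. (1 / measure M (P g x)) * (LINT y:P g x|M. \<bar>b y - avg b g x\<bar>) \<le> C)
    \<longleftrightarrow> (\<exists>K>0. bmo_bound b K)"
proof -
  have iff: "(1 / measure M (P g x)) * (LINT y:P g x|M. \<bar>b y - avg b g x\<bar>) \<le> C
      \<longleftrightarrow> (\<integral>\<^sup>+y\<in>P g x. ennreal \<bar>b y - avg b g x\<bar> \<partial>M) \<le> ennreal (C * N powr g)"
    if x: "x \<in> space M" and C: "0 < C" for g x C
  proof -
    have "set_integrable M (P g x) (\<lambda>y. \<bar>b y - avg b g x\<bar>)"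
      by (intro set_integrable_abs set_integral_diff loc_integrableD[OF b x] set_integrable_const_ball[OF x])
    then have "(\<integral>\<^sup>+y\<in>P g x. ennreal \<bar>b y - avg b g x\<bar> \<partial>M) = ennreal (LINT y:P g x|M. \<bar>b y - avg b g x\<bar>)"
      by (rule set_nn_integral_eq_integral) simp
    moreover have "(1 / measure M (P g x)) * (LINT y:P g x|M. \<bar>b y - avg b g x\<bar>) \<le> C
      \<longleftrightarrow> (LINT y:P g x|M. \<bar>b y - avg b g x\<bar>) \<le> C * N powr g"
      using N_pos by (simp add: measure_ball[OF x] field_simps)
    ultimately show ?thesis using C by (simp add: ennreal_le_iff)
  qed
  show ?thesis
  proof
    assume "\<exists>C. \<forall>g. \<forall>x\<in>space M. (1 / measure M (P g x)) * (LINT y:P g x|M. \<bar>b y - avg b g x\<bar>) \<le> C"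
    then obtain C where C: "\<And>g x. x \<in> space M \<Longrightarrow>
        (1 / measure M (P g x)) * (LINT y:P g x|M. \<bar>b y - avg b g x\<bar>) \<le> C" by blast
    \<comment> \<open>The maximum with 1 provides a positive constant, as \<open>iff\<close> and the
      John-Nirenberg estimates require.\<close>
    have "bmo_bound b (max C 1)"
      unfolding bmo_bound_def
    proof (intro allI ballI)
      fix g x assume x: "x \<in> space M"
      have "(1 / measure M (P g x)) * (LINT y:P g x|M. \<bar>b y - avg b g x\<bar>) \<le> max C 1"
        using C[OF x, of g] by (rule order_trans) simp
      then show "(\<integral>\<^sup>+y\<in>P g x. ennreal \<bar>b y - avg b g x\<bar> \<partial>M) \<le> ennreal (max C 1 * N powr g)"
        by (subst (asm) iff[OF x]) auto
    qed
    then show "\<exists>K>0. bmo_bound b K" by (intro exI[of _ "max C 1"]) auto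
  next
    assume "\<exists>K>0. bmo_bound b K"
    then obtain K where K: "0 < K" "bmo_bound b K" by blast
    have "(1 / measure M (P g x)) * (LINT y:P g x|M. \<bar>b y - avg b g x\<bar>) \<le> K" if x: "x \<in> space M" for g x
      using bmo_boundD[OF K(2) x, of g] unfolding iff[OF x K(1)] .
    then show "\<exists>C. \<forall>g. \<forall>x\<in>space M. (1 / measure M (P g x)) * (LINT y:P g x|M. \<bar>b y - avg b g x\<bar>) \<le> C" by blast
  qed
qed

section \<open>Necessity of BMO: testing on indicators of balls\<close>

lemma maxc_indicator_ge:
  fixes a :: real
  assumes b: "loc_integrable b" and x: "x \<in> space M" and y: "y \<in> P g x"
  shows "ennreal (N powr (g * a)) * ennreal \<bar>b y - avg b g x\<bar> \<le> maxc a b (indicator (P g x)) y"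
proof -
  have ys: "y \<in> space M" by (rule ball_in_space[OF x y])
  \<comment> \<open>A ball is centred at each of its points, so the term of level \<open>g\<close>
    integrates \<open>\<bar>b y - b z\<bar>\<close> over all of \<open>P g x\<close>; this dominates
    the deviation of \<open>b y\<close> from the mean.\<close>
  have Py: "P g y = P g x" by (rule ball_eq[OF x y])
  have "N powr (g * (a - 1)) * N powr g = N powr (g * a)"
    by (simp add: algebra_simps flip: powr_add)
  then have "ennreal (N powr (g * a)) * ennreal \<bar>b y - avg b g x\<bar>
      = ennreal (N powr (g * (a - 1))) * ennreal (\<bar>avg b g x - b y\<bar> * N powr g)"
    by (simp add: mult_ac abs_minus_commute flip: ennreal_mult)
  also have "\<dots> \<le> ennreal (N powr (g * (a - 1))) * (\<integral>\<^sup>+z\<in>P g x. ennreal \<bar>b z - b y\<bar> \<partial>M)"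
    by (rule mult_left_mono[OF avg_diff_le[OF b x]]) simp
  also have "(\<integral>\<^sup>+z\<in>P g x. ennreal \<bar>b z - b y\<bar> \<partial>M)
      = (\<integral>\<^sup>+z\<in>P g y. ennreal (\<bar>b y - b z\<bar> * \<bar>indicator (P g x) z\<bar>) \<partial>M)"
    unfolding Py by (intro nn_integral_cong) (auto simp: indicator_def abs_minus_commute)
  also have "N powr (g * (a - 1)) = measure M (P g y) powr (a - 1)"
    by (simp add: measure_ball[OF ys] powr_powr)
  also have "ennreal (measure M (P g y) powr (a - 1)) * (\<integral>\<^sup>+z\<in>P g y. ennreal (\<bar>b y - b z\<bar> * \<bar>indicator (P g x) z\<bar>) \<partial>M)
     \<le> maxc a b (indicator (P g x)) y"
    unfolding maxc_def by (rule SUP_upper) simp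
  finally show ?thesis .
qed

text \<open>Two balls that meet are nested, so the intersection is the smaller one. If that is
  \<open>P h z\<close>, the estimate uses \<open>0 \<le> 1 - l\<close>, otherwise
  \<open>0 \<le> l\<close>.\<close>

lemma mnorm_indicator_le:
  assumes x: "x \<in> space M" and l: "0 \<le> l" "l < 1" and r: "0 < r"
  shows "mnorm r l (\<lambda>y. ennreal \<bar>indicator (P g x) y\<bar>) \<le> ennreal (N powr (g * ((1 - l) / r)))"
  unfolding mnorm_le_iff[OF r powr_ge_zero]
proof (intro allI ballI)
  fix h z assume z: "z \<in> space M"
  have [measurable]: "P g x \<in> sets M" "P h z \<in> sets M" using x z by auto
  have c: "(N powr (g * ((1 - l) / r))) powr r = N powr (g * (1 - l))" using r by (simp add: powr_powr)
  have "(\<integral>\<^sup>+y\<in>P h z. epowr (ennreal \<bar>indicator (P g x) y\<bar>) r \<partial>M) = (\<integral>\<^sup>+y. indicator (P h z \<inter> P g x) y \<partial>M)"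
    using r by (intro nn_integral_cong) (auto simp: indicator_def epowr_def)
  also have "\<dots> = emeasure M (P h z \<inter> P g x)" by simp
  also have "\<dots> \<le> ennreal (N powr (g * (1 - l)) * N powr (h * l))"
  proof (cases "P h z \<inter> P g x = {}")
    case False
    then obtain w where w: "w \<in> P h z" "w \<in> P g x" by blast
    show ?thesis
    proof (cases "h \<le> g")
      case True
      have "emeasure M (P h z \<inter> P g x) \<le> emeasure M (P h z)" by (intro emeasure_mono) auto
      also have "\<dots> = ennreal (N powr (h * (1 - l)) * N powr (h * l))"
        using z by (simp add: emeasure_ball algebra_simps flip: powr_add)
      also have "\<dots> \<le> ennreal (N powr (g * (1 - l)) * N powr (h * l))"
        using True l N_gt_1 by (intro ennreal_leI mult_right_mono powr_mono) auto
      finally show ?thesis .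
    next
      case False
      have "emeasure M (P h z \<inter> P g x) \<le> emeasure M (P g x)" by (intro emeasure_mono) auto
      also have "\<dots> = ennreal (N powr (g * (1 - l)) * N powr (g * l))"
        using x by (simp add: emeasure_ball algebra_simps flip: powr_add)
      also have "\<dots> \<le> ennreal (N powr (g * (1 - l)) * N powr (h * l))"
        using False l N_gt_1 by (intro ennreal_leI mult_left_mono powr_mono mult_right_mono) auto
      finally show ?thesis .
    qed
  qed simp
  finally show "(\<integral>\<^sup>+y\<in>P h z. epowr (ennreal \<bar>indicator (P g x) y\<bar>) r \<partial>M)
    \<le> ennreal ((N powr (g * ((1 - l) / r))) powr r * N powr (h * l))" unfolding c .
qed

text \<open>Hypothesis \<open>e\<close> is the scaling identity under which the powers of
  \<open>N powr g\<close> cancel up to the measure of the ball. Both relations between the exponents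
  satisfy it, so one argument serves for both.\<close>

lemma maxc_bounded_imp_bmo:
  assumes b: "loc_integrable b" and l: "0 \<le> l" "l < 1" and r: "0 < r" and q: "1 \<le> q"
    and e: "l' + (1 - l) * q / r = 1 + a * q"
    and bd: "maxc_bounded a b r l q l'"
  shows "\<exists>K>0. bmo_bound b K"
proof -
  have [measurable]: "b \<in> borel_measurable M" by (rule loc_integrable_measurable[OF b])
  obtain C where C: "0 \<le> C" and bound: "\<And>f. f \<in> borel_measurable M \<Longrightarrow> mnorm r l (\<lambda>y. ennreal \<bar>f y\<bar>) < \<infinity> \<Longrightarrow>
      mnorm q l' (maxc a b f) \<le> ennreal C * mnorm r l (\<lambda>y. ennreal \<bar>f y\<bar>)"
    using bd unfolding maxc_bounded_def by blast
  have "bmo_bound b (2 * (C + 1))"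
    unfolding bmo_bound_def
  proof (intro allI ballI)
    fix g x assume x: "x \<in> space M"
    have [measurable]: "P g x \<in> sets M" using x by auto
    let ?f = "indicator (P g x) :: 'a \<Rightarrow> real"
    let ?n = "N powr (g * ((1 - l) / r))"
    have n: "mnorm r l (\<lambda>y. ennreal \<bar>?f y\<bar>) \<le> ennreal ?n" by (rule mnorm_indicator_le[OF x l r])
    have fm: "?f \<in> borel_measurable M" by measurable
    have "mnorm q l' (maxc a b ?f) \<le> ennreal C * mnorm r l (\<lambda>y. ennreal \<bar>?f y\<bar>)"
      using n by (intro bound fm) (simp add: le_less_trans)
    \<comment> \<open>\<open>C\<close> may be 0, whereas the comparison of means below needs a
      positive cut-off.\<close>
    also have "\<dots> \<le> ennreal (C + 1) * ennreal ?n" using C by (intro mult_mono n ennreal_leI) auto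
    also have "\<dots> = ennreal ((C + 1) * ?n)" using C by (intro ennreal_mult[symmetric]) auto
    finally have "(\<integral>\<^sup>+y\<in>P g x. epowr (maxc a b ?f y) q \<partial>M) \<le> ennreal (((C + 1) * ?n) powr q * N powr (g * l'))"
      using q C x by (subst (asm) mnorm_le_iff) auto
    also have "((C + 1) * ?n) powr q * N powr (g * l') = (C + 1) powr q * (N powr (g * ((1 - l) / r) * q) * N powr (g * l'))"
      using C by (simp add: powr_mult powr_powr)
    also have "N powr (g * ((1 - l) / r) * q) * N powr (g * l') = N powr (g * (l' + (1 - l) * q / r))"
      by (simp add: algebra_simps flip: powr_add)
    also have "\<dots> = N powr (g * a * q) * N powr g"
      unfolding e by (simp add: algebra_simps flip: powr_add)
    also have "(C + 1) powr q * (N powr (g * a * q) * N powr g) = ((C + 1) * N powr (g * a)) powr q * N powr g"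
      using C by (simp add: powr_mult powr_powr)
    \<comment> \<open>Descent from the \<open>q\<close>-mean to the 1-mean, at the cost of the
      factor 2 from interpolation.\<close>
    finally have "(\<integral>\<^sup>+y\<in>P g x. epowr (maxc a b ?f y) 1 \<partial>M)
        \<le> ennreal (2 * ((C + 1) * N powr (g * a)) powr 1 * N powr g)"
      using q C N_pos by (intro set_nn_integral_epowr_mean[OF x] maxc_measurable) auto
    moreover have "epowr h 1 = h" for h by (cases h) (auto simp: epowr_def)
    ultimately have le: "(\<integral>\<^sup>+y\<in>P g x. maxc a b ?f y \<partial>M) \<le> ennreal (2 * ((C + 1) * N powr (g * a)) * N powr g)"
      using C N_pos by simp
    have "ennreal (N powr (g * a)) * (\<integral>\<^sup>+y\<in>P g x. ennreal \<bar>b y - avg b g x\<bar> \<partial>M)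
        = (\<integral>\<^sup>+y\<in>P g x. (ennreal (N powr (g * a)) * ennreal \<bar>b y - avg b g x\<bar>) \<partial>M)"
      unfolding mult.assoc by (rule nn_integral_cmult[symmetric]) measurable
    also have "\<dots> \<le> (\<integral>\<^sup>+y\<in>P g x. maxc a b ?f y \<partial>M)"
      by (rule nn_integral_ball_mono[OF order_refl]) (rule maxc_indicator_ge[OF b x])
    also note le
    finally have "ennreal (N powr (- (g * a))) * (ennreal (N powr (g * a)) * (\<integral>\<^sup>+y\<in>P g x. ennreal \<bar>b y - avg b g x\<bar> \<partial>M))
      \<le> ennreal (N powr (- (g * a))) * ennreal (2 * ((C + 1) * N powr (g * a)) * N powr g)"
      by (rule mult_left_mono) simp
    moreover have inv: "N powr (- (g * a)) * N powr (g * a) = 1" using N_pos by (simp flip: powr_add)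
    then have "ennreal (N powr (- (g * a))) * (ennreal (N powr (g * a)) * (\<integral>\<^sup>+y\<in>P g x. ennreal \<bar>b y - avg b g x\<bar> \<partial>M))
      = (\<integral>\<^sup>+y\<in>P g x. ennreal \<bar>b y - avg b g x\<bar> \<partial>M)"
      by (simp add: mult.assoc[symmetric] flip: ennreal_mult)
    moreover have "ennreal (N powr (- (g * a))) * ennreal (2 * ((C + 1) * N powr (g * a)) * N powr g) = ennreal (2 * (C + 1) * N powr g)"
    proof -
      have "N powr (- (g * a)) * (2 * ((C + 1) * N powr (g * a)) * N powr g) = 2 * (C + 1) * N powr g * (N powr (- (g * a)) * N powr (g * a))"
        by simp
      then show ?thesis unfolding inv using C by (simp flip: ennreal_mult)
    qed
    ultimately show "(\<integral>\<^sup>+y\<in>P g x. ennreal \<bar>b y - avg b g x\<bar> \<partial>M) \<le> ennreal (2 * (C + 1) * N powr g)" by simp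
  qed
  then show ?thesis using C by (intro exI[of _ "2 * (C + 1)"]) auto
qed

section \<open>Sufficiency of BMO and the passage to the second scale of exponents\<close>

lemma bmo_imp_maxc_bounded:
  assumes b: "loc_integrable b" "bmo_bound b K" "0 < K"
    and p: "0 < a" "1 < r" "0 < l" "l < 1 - a * r" "1 / q = 1 / r - a / (1 - l)"
  shows "maxc_bounded a b r l q l"
proof -
  \<comment> \<open>\<open>s < r\<close> amounts to \<open>t > r / (r - 1)\<close>, the conjugate
    exponent of \<open>r\<close>; the summand 2 makes this strict and also gives
    \<open>2 \<le> t\<close>.\<close>
  define t where "t = nat \<lceil>r / (r - 1)\<rceil> + 2"
  define s where "s = real t / (real t - 1)"
  have "r / (r - 1) < real t" using p by (simp add: t_def) linarith
  then have "r < real t * (r - 1)" using p by (simp add: field_simps)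
  then have s: "s < r" by (simp add: s_def t_def field_simps)
  interpret commutator M P N b K a l r q s t
    by unfold_locales (use b p s in \<open>auto simp: s_def t_def\<close>)
  obtain C where C: "0 < C" and le: "\<And>f L \<beta> x. x \<in> space M \<Longrightarrow> morrey_bound f L \<Longrightarrow> 0 < L \<Longrightarrow>
    (\<integral>\<^sup>+y\<in>P \<beta> x. epowr (maxc a b f y) q \<partial>M) \<le> ennreal (C * L powr q * N powr (\<beta> * l))"
    using maxc_morrey_bound by blast
  show ?thesis
    unfolding maxc_bounded_def
  proof (intro exI[of _ "C powr (1 / q)"] conjI allI impI)
    fix f assume f: "f \<in> borel_measurable M \<and> mnorm r l (\<lambda>y. ennreal \<bar>f y\<bar>) < \<infinity>"
    then show "maxc a b f \<in> borel_measurable M" by (intro maxc_measurable) auto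
    show "mnorm q l (maxc a b f) \<le> ennreal (C powr (1 / q)) * mnorm r l (\<lambda>y. ennreal \<bar>f y\<bar>)"
    proof (rule ennreal_le_cmultI)
      fix L :: real assume L: "0 < L" and n: "mnorm r l (\<lambda>y. ennreal \<bar>f y\<bar>) \<le> ennreal L"
      have "morrey_bound f L"
        using f n L p unfolding morrey_bound_def by (subst (asm) mnorm_le_iff) auto
      note le' = le[OF _ this L]
      have "(C powr (1 / q) * L) powr q = C * L powr q"
        using C L q_pos by (simp add: powr_mult powr_powr)
      then show "mnorm q l (maxc a b f) \<le> ennreal (C powr (1 / q) * L)"
        using le' q_pos L by (subst mnorm_le_iff) auto
    qed (use C in simp)
  qed simp
qed

text \<open>Condition \<open>e\<close> says that local means in the two Morrey spaces obey the same
  power of the ball measure. As \<open>q \<le> q1\<close>, comparing power means on each ball embeds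
  the space with exponent \<open>q1\<close> into that with \<open>q\<close>.\<close>

lemma maxc_bounded_embed:
  assumes bd: "maxc_bounded a b r l q1 l" and q: "0 < q" "q \<le> q1" and e: "(1 - l') / q = (1 - l) / q1"
  shows "maxc_bounded a b r l q l'"
proof -
  obtain C where C: "0 \<le> C" and bound: "\<And>f. f \<in> borel_measurable M \<Longrightarrow> mnorm r l (\<lambda>y. ennreal \<bar>f y\<bar>) < \<infinity> \<Longrightarrow>
      maxc a b f \<in> borel_measurable M \<and> mnorm q1 l (maxc a b f) \<le> ennreal C * mnorm r l (\<lambda>y. ennreal \<bar>f y\<bar>)"
    using bd unfolding maxc_bounded_def by blast
  have embed: "mnorm q l' h \<le> ennreal (2 powr (1 / q)) * mnorm q1 l h" if h: "h \<in> borel_measurable M" for h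
  proof (rule ennreal_le_cmultI)
    fix L :: real assume L: "0 < L" and n: "mnorm q1 l h \<le> ennreal L"
    have c: "(2 powr (1 / q) * L) powr q = 2 * L powr q"
      using L q by (simp add: powr_mult powr_powr)
    show "mnorm q l' h \<le> ennreal (2 powr (1 / q) * L)"
      unfolding mnorm_le_iff[OF q(1) mult_nonneg_nonneg[OF powr_ge_zero less_imp_le[OF L]]] c
    proof (intro allI ballI)
      fix g :: int and x assume x: "x \<in> space M"
      \<comment> \<open>The common bound for local means: \<open>?c powr q1 * N powr g\<close> is
        the given estimate, and \<open>?c powr q * N powr g\<close> has the size claimed for
        \<open>l'\<close>.\<close>
      let ?c = "L * N powr (g * ((l - 1) / q1))"
      have "?c powr q1 * N powr g = L powr q1 * (N powr (g * ((l - 1) / q1) * q1) * N powr g)"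
        using L by (simp add: powr_mult powr_powr)
      also have "g * ((l - 1) / q1) * q1 = g * (l - 1)" using q by simp
      also have "N powr (g * (l - 1)) * N powr g = N powr (g * l)"
        by (simp add: algebra_simps flip: powr_add)
      finally have c1: "?c powr q1 * N powr g = L powr q1 * N powr (g * l)" .
      have "(\<integral>\<^sup>+y\<in>P g x. epowr (h y) q1 \<partial>M) \<le> ennreal (?c powr q1 * N powr g)"
        unfolding c1 using n L q x by (subst (asm) mnorm_le_iff) auto
      then have "(\<integral>\<^sup>+y\<in>P g x. epowr (h y) q \<partial>M) \<le> ennreal (2 * ?c powr q * N powr g)"
        using L N_pos q by (intro set_nn_integral_epowr_mean[OF x h]) auto
      also have "2 * ?c powr q * N powr g = 2 * L powr q * (N powr (g * ((l - 1) / q1) * q) * N powr g)"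
        using L by (simp add: powr_mult powr_powr)
      also have "N powr (g * ((l - 1) / q1) * q) * N powr g = N powr (g * ((l - 1) / q1 * q + 1))"
        by (simp add: algebra_simps flip: powr_add)
      also have "(l - 1) / q1 * q + 1 = l'"
      proof -
        have "(1 - l') = (1 - l) / q1 * q" using e q by (simp add: field_simps)
        then show ?thesis by (simp add: algebra_simps diff_divide_distrib)
      qed
      finally show "(\<integral>\<^sup>+y\<in>P g x. epowr (h y) q \<partial>M) \<le> ennreal (2 * L powr q * N powr (g * l'))" .
    qed
  qed simp
  show ?thesis
    unfolding maxc_bounded_def
  proof (intro exI[of _ "2 powr (1 / q) * C"] conjI allI impI)
    fix f assume f: "f \<in> borel_measurable M \<and> mnorm r l (\<lambda>y. ennreal \<bar>f y\<bar>) < \<infinity>"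
    then show m: "maxc a b f \<in> borel_measurable M" using bound by blast
    have "mnorm q l' (maxc a b f) \<le> ennreal (2 powr (1 / q)) * (ennreal C * mnorm r l (\<lambda>y. ennreal \<bar>f y\<bar>))"
      using embed[OF m] bound[of f] f by (meson mult_left_mono order_trans zero_le)
    then show "mnorm q l' (maxc a b f) \<le> ennreal (2 powr (1 / q) * C) * mnorm r l (\<lambda>y. ennreal \<bar>f y\<bar>)"
      using C by (simp add: ennreal_mult mult.assoc)
  qed (use C in simp)
qed

end

section \<open>The p-adic space as an instance, and the two equivalences\<close>

lemma countable_pballs:
  assumes "1 < p"
  shows "countable (pball p g ` (Qpn p :: ((int \<Rightarrow> rat) ^ 'n) set))"
proof -
  \<comment> \<open>A ball of given level is determined by the residues of its points at that level,
    a vector of rationals.\<close>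
  let ?F = "\<lambda>c :: rat ^ 'n. {y \<in> Qpn p. \<forall>j. (y $ j) (- g) = c $ j}"
  have "pball p g ` (Qpn p :: ((int \<Rightarrow> rat) ^ 'n) set) \<subseteq> range ?F"
  proof
    fix B assume "B \<in> pball p g ` (Qpn p :: ((int \<Rightarrow> rat) ^ 'n) set)"
    then obtain x :: "(int \<Rightarrow> rat) ^ 'n" where "x \<in> Qpn p" "B = pball p g x" by blast
    then have "B = ?F (\<chi> j. (x $ j) (- g))" using pball_eq[OF assms] by simp
    then show "B \<in> range ?F" by blast
  qed
  then show ?thesis by (rule countable_subset) simp
qed

lemma ball_space_haar:
  assumes "prime p"
  shows "ball_space (haar p :: ((int \<Rightarrow> rat) ^ 'n) measure) (pball p) (real p ^ CARD('n))"
proof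
  have p: "1 < p" using assms by (rule prime_gt_1_nat)
  have sp: "space (haar p :: ((int \<Rightarrow> rat) ^ 'n) measure) = Qpn p" by (rule space_haar)
  have "2 \<le> real p" using p by simp
  also have "real p ^ 1 \<le> real p ^ CARD('n)" using p by (intro power_increasing) auto
  finally show "2 \<le> real p ^ CARD('n)" by simp
  fix x :: "(int \<Rightarrow> rat) ^ 'n" and g assume "x \<in> space (haar p)"
  then have x: "x \<in> Qpn p" by (simp add: sp)
  show "x \<in> pball p g x" using x by (simp add: pball_eq[OF p x])
  show "pball p g x \<subseteq> space (haar p)" by (auto simp: sp pball_def)
  show "pball p g y = pball p g x" if "y \<in> pball p g x" for y
  proof -
    have y: "y \<in> Qpn p" "\<And>j. (y $ j) (- g) = (x $ j) (- g)" using that by (auto simp: pball_eq[OF p x])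
    then show ?thesis by (simp add: pball_eq[OF p x] pball_eq[OF p y(1)])
  qed
  show "pball p g x \<subseteq> pball p (g + 1) x"
  proof
    fix y assume "y \<in> pball p g x"
    then have y: "y \<in> Qpn p" "\<And>j. (y $ j) (- g) = (x $ j) (- g)" by (auto simp: pball_eq[OF p x])
    have "(y $ j) (- (g + 1)) = (x $ j) (- (g + 1))" for j
      by (rule Qp_eq_mono[where k = "- g"]) (use x y in \<open>auto simp: Qpn_def\<close>)
    then show "y \<in> pball p (g + 1) x" using y(1) by (simp add: pball_eq[OF p x])
  qed
  show "emeasure (haar p) (pball p g x) = ennreal ((real p ^ CARD('n)) powr real_of_int g)"
  proof -
    have "real p powi (int CARD('n) * g) = (real p ^ CARD('n)) powr real_of_int g"
      using p by (simp add: power_int_mult powr_real_of_int')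
    then show ?thesis by (simp add: emeasure_haar_pball[OF p x])
  qed
next
  have p: "1 < p" using assms by (rule prime_gt_1_nat)
  show "countable (pball p g ` space (haar p :: ((int \<Rightarrow> rat) ^ 'n) measure))" for g
    unfolding space_haar by (rule countable_pballs[OF p])
  show "sets (haar p :: ((int \<Rightarrow> rat) ^ 'n) measure)
      = sigma_sets (space (haar p)) (\<Union>g. pball p g ` space (haar p))"
    unfolding sets_haar space_haar by (rule arg_cong[where f = "sigma_sets (Qpn p)"]) auto
qed

theorem theorem4:
  fixes p :: nat and b :: "(int \<Rightarrow> rat) ^ 'n \<Rightarrow> real"
    and \<alpha> r lam :: real
  assumes "prime p"
    and "locally_integrable p b"
    and "0 < \<alpha>" and "\<alpha> < real CARD('n)"
    and "1 < r" and "r < real CARD('n) / \<alpha>"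
    and "0 < lam" and "lam < real CARD('n) - \<alpha> * r"
  shows "(\<forall>q. 1 / q = 1 / r - \<alpha> / (real CARD('n) - lam)
            \<longrightarrow> (BMO p b \<longleftrightarrow> maxcomm_bounded p \<alpha> b r lam q lam))
       \<and> (\<forall>q \<mu>. 1 / q = 1 / r - \<alpha> / real CARD('n) \<and> lam / r = \<mu> / q
            \<longrightarrow> (BMO p b \<longleftrightarrow> maxcomm_bounded p \<alpha> b r lam q \<mu>))"
proof -
  interpret ball_space "haar p :: ((int \<Rightarrow> rat) ^ 'n) measure" "pball p" "real p ^ CARD('n)"
    by (rule ball_space_haar[OF \<open>prime p\<close>])
  define n where "n = real CARD('n)"
  have n: "0 < n" by (simp add: n_def)
  \<comment> \<open>Balls have measure \<open>N powr g\<close> with \<open>N\<close> already a power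
    by the dimension, so \<open>\<alpha>\<close> and \<open>lam\<close> enter as exponents of the
    measure.\<close>
  define a l where "a = \<alpha> / n" and "l = lam / n"
  have b: "loc_integrable b"
    using assms(2) by (simp add: locally_integrable_def loc_integrable_def space_haar)
  have BMO: "BMO p b \<longleftrightarrow> (\<exists>K>0. bmo_bound b K)"
    unfolding bmo_iff[OF b, symmetric] BMO_def avg_def ball_avg_def space_haar ..
  have maxc: "maxcomm p \<alpha> b f = maxc a b f" for f
    by (rule ext) (simp add: maxcomm_def maxc_def a_def n_def)
  have mnorm: "morrey_norm p q m h = mnorm q (m / n) h" for q m and h :: "(int \<Rightarrow> rat) ^ 'n \<Rightarrow> ennreal"
    by (simp add: morrey_norm_def mnorm_def space_haar n_def)
  have bounded: "maxcomm_bounded p \<alpha> b r lam q \<mu> \<longleftrightarrow> maxc_bounded a b r l q (\<mu> / n)" for q \<mu>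
    unfolding maxcomm_bounded_def maxc_bounded_def morrey_def maxc mnorm l_def by auto
  have a: "0 < a" using assms n by (simp add: a_def)
  have l: "0 < l" "l < 1 - a * r" using assms n by (auto simp: l_def a_def n_def[symmetric] field_simps)
  have ar: "0 < a * r" using a assms by simp
  have l1: "l < 1" using l ar by linarith
  have div: "\<alpha> / (n - lam) = a / (1 - l)" using n l1 by (simp add: a_def l_def field_simps)
  have "a * r < 1 - l" using l by simp
  then have inv1: "0 < 1 / r - a / (1 - l)" using assms l1 by (simp add: field_simps)
  have q1: "1 \<le> q" if "1 / q \<le> 1 / r" "0 < 1 / q" for q
  proof -
    have "0 < q" using that by simp
    then have "r \<le> q" using that assms by (simp add: field_simps)
    then show ?thesis using assms by simp
  qed
  have dle: "a \<le> a / (1 - l)" using a l l1 by (simp add: field_simps)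
  show ?thesis
  proof (intro conjI allI impI)
    fix q assume "1 / q = 1 / r - \<alpha> / (real CARD('n) - lam)"
    then have q: "1 / q = 1 / r - a / (1 - l)" by (simp add: n_def[symmetric] div)
    have q_ge: "1 \<le> q" using q inv1 dle a by (intro q1) linarith+
    have e: "l + (1 - l) * q / r = 1 + a * q"
    proof -
      have "(1 - l) * q * (1 / q) = (1 - l) * q * (1 / r - a / (1 - l))" unfolding q ..
      moreover have "(1 - l) * q * (1 / r - a / (1 - l)) = (1 - l) * q / r - a * q"
        using l1 by (simp add: right_diff_distrib)
      ultimately show ?thesis using q_ge by simp
    qed
    show "BMO p b \<longleftrightarrow> maxcomm_bounded p \<alpha> b r lam q lam"
      unfolding BMO bounded l_def[symmetric]
    proof
      assume "\<exists>K>0. bmo_bound b K"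
      then show "maxc_bounded a b r l q l"
        using bmo_imp_maxc_bounded[OF b] a l q assms by blast
    next
      assume "maxc_bounded a b r l q l"
      then show "\<exists>K>0. bmo_bound b K"
        by (rule maxc_bounded_imp_bmo[OF b _ l1 _ q_ge e, rotated 2]) (use l assms in auto)
    qed
  next
    fix q \<mu> assume H: "1 / q = 1 / r - \<alpha> / real CARD('n) \<and> lam / r = \<mu> / q"
    then have q: "1 / q = 1 / r - a" by (simp add: n_def[symmetric] a_def)
    have lq: "l / r = (\<mu> / n) / q"
    proof -
      have "l / r = (lam / r) / n" by (simp add: l_def mult.commute)
      also have "\<dots> = (\<mu> / n) / q" using H by (simp add: mult.commute)
      finally show ?thesis .
    qed
    have pos: "0 < 1 / q" using q inv1 dle by linarith
    have q_ge: "1 \<le> q" using q pos a by (intro q1) linarith+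
    have e: "\<mu> / n + (1 - l) * q / r = 1 + a * q"
    proof -
      have "\<mu> / n = q * (l / r)" using lq q_ge by simp
      moreover have "q * (1 / q) = q * (1 / r - a)" unfolding q ..
      ultimately show ?thesis using q_ge by (simp add: algebra_simps diff_divide_distrib)
    qed
    \<comment> \<open>The exponent of the first scale. As \<open>a \<le> a / (1 - l)\<close>, it is
      at least \<open>q\<close>, so boundedness with target exponent \<open>q'\<close> passes to the
      required target by embedding.\<close>
    define q' where "q' = 1 / (1 / r - a / (1 - l))"
    have q': "1 / q' = 1 / r - a / (1 - l)" by (simp add: q'_def)
    have q'_pos: "0 < q'" using inv1 by (simp add: q'_def)
    have "1 / q' \<le> 1 / q" using q q' dle by linarith
    then have qq: "q \<le> q'" using q_ge q'_pos by (simp add: field_simps)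
    \<comment> \<open>Both sides equal \<open>(1 - l) / r - a\<close>, the quantity
      \<open>\<kappa> - a\<close> of the commutator estimate.\<close>
    have emb: "(1 - \<mu> / n) / q = (1 - l) / q'"
    proof -
      have "(1 - \<mu> / n) / q = 1 / q - l / r" unfolding lq by (simp add: diff_divide_distrib)
      also have "\<dots> = (1 - l) * (1 / r - a / (1 - l))"
        unfolding q using l1 by (simp add: right_diff_distrib) (simp add: diff_divide_distrib)
      also have "\<dots> = (1 - l) / q'" unfolding q'[symmetric] by simp
      finally show ?thesis .
    qed
    show "BMO p b \<longleftrightarrow> maxcomm_bounded p \<alpha> b r lam q \<mu>"
      unfolding BMO bounded
    proof
      assume "\<exists>K>0. bmo_bound b K"
      then have "maxc_bounded a b r l q' l"
        using bmo_imp_maxc_bounded[OF b] a l q' assms by blast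
      then show "maxc_bounded a b r l q (\<mu> / n)"
        by (rule maxc_bounded_embed[OF _ _ qq emb]) (use q_ge in simp)
    next
      assume "maxc_bounded a b r l q (\<mu> / n)"
      then show "\<exists>K>0. bmo_bound b K"
        by (rule maxc_bounded_imp_bmo[OF b _ l1 _ q_ge e, rotated 2]) (use l assms in auto)
    qed
  qed
qed

end
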